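(* Let $p \ge 5$ be a prime number and $\ell = \operatorname{lcm}(2,3,p) = 6p$. The line bundle $\mathcal{O}(\ell)$ on the weighted projective space $\mathbb{P}(1,6,2p,3p)$ is very ample if and only if $p \equiv 1 \pmod 3$.
   Context: $\mathbb{P}(a_0,\dots,a_n) = \operatorname{Proj} k[x_0,\dots,x_n]$ over a field $k$ (one may take $k=\mathbb{C}$) with $\deg x_i = a_i$. *)

theory Defs
  imports
    "HOL-Algebra.Module"
    "HOL-Algebra.Ideal"
    "HOL-Analysis.Abstract_Topology"
    "HOL-Computational_Algebra.Fraction_Field"
    "HOL-Computational_Algebra.Primes"
    "HOL-Library.Poly_Mapping"
begin

section \<open>Locally ringed spaces over a field\<close>

text \<open>
  A space over a field \<open>k\<close>: \<open>ring_of X U\<close> is the ring of sections of the structure sheaf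
  over an open set \<open>U\<close>, \<open>res X V\<close> restricts a section given over a larger open set to \<open>V\<close>,
  and \<open>scal X U\<close> is the structure map from \<open>k\<close> to the sections over \<open>U\<close>. The record carries data only; the sheaf
  axioms are not imposed here but hold for \<open>Proj\<close> below.
\<close>

record ('p, 's, 'k) kspace =
  top_of :: "'p topology"
  ring_of :: "'p set \<Rightarrow> 's ring"
  res :: "'p set \<Rightarrow> 's \<Rightarrow> 's"
  scal :: "'p set \<Rightarrow> 'k \<Rightarrow> 's"

text \<open>Sheaves of modules. Only the additive structure and \<open>smult\<close> of the module record matter.\<close>

record ('p, 's, 'm) module_sheaf =
  mod_of :: "'p set \<Rightarrow> ('s, 'm) module"
  mres :: "'p set \<Rightarrow> 'm \<Rightarrow> 'm"

definition preim :: "('p, 's, 'k) kspace \<Rightarrow> ('p \<Rightarrow> 'q) \<Rightarrow> 'q set \<Rightarrow> 'p set" where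
  "preim X f V = {x \<in> topspace (top_of X). f x \<in> V}"

text \<open>
  Morphisms of ringed spaces over \<open>k\<close>; the component \<open>h V\<close> maps sections over \<open>V\<close>
  to sections over the preimage of \<open>V\<close>.
\<close>

definition ringed_morphism ::
  "('p, 's, 'k) kspace \<Rightarrow> ('q, 't, 'k) kspace \<Rightarrow> ('p \<Rightarrow> 'q) \<Rightarrow> ('q set \<Rightarrow> 't \<Rightarrow> 's) \<Rightarrow> bool" where
  "ringed_morphism X Y f h \<longleftrightarrow>
     continuous_map (top_of X) (top_of Y) f \<and>
     (\<forall>V. openin (top_of Y) V \<longrightarrow>
        h V \<in> ring_hom (ring_of Y V) (ring_of X (preim X f V)) \<and>
        (\<forall>c. h V (scal Y V c) = scal X (preim X f V) c) \<and>
        (\<forall>W t. openin (top_of Y) W \<longrightarrow> W \<subseteq> V \<longrightarrow> t \<in> carrier (ring_of Y V) \<longrightarrow>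
           h W (res Y W t) = res X (preim X f W) (h V t)))"

text \<open>The germ of the section \<open>s\<close> over \<open>U\<close> at the point \<open>x\<close> is a unit of the stalk.\<close>

definition unit_at :: "('p, 's, 'k) kspace \<Rightarrow> 'p set \<Rightarrow> 's \<Rightarrow> 'p \<Rightarrow> bool" where
  "unit_at X U s x \<longleftrightarrow>
     (\<exists>V. openin (top_of X) V \<and> x \<in> V \<and> V \<subseteq> U \<and> res X V s \<in> Units (ring_of X V))"

text \<open>The second condition says that the induced homomorphisms of stalks are local.\<close>

definition local_morphism ::
  "('p, 's, 'k) kspace \<Rightarrow> ('q, 't, 'k) kspace \<Rightarrow> ('p \<Rightarrow> 'q) \<Rightarrow> ('q set \<Rightarrow> 't \<Rightarrow> 's) \<Rightarrow> bool" where
  "local_morphism X Y f h \<longleftrightarrow>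
     ringed_morphism X Y f h \<and>
     (\<forall>V t x. openin (top_of Y) V \<longrightarrow> t \<in> carrier (ring_of Y V) \<longrightarrow> x \<in> preim X f V \<longrightarrow>
        unit_at X (preim X f V) (h V t) x \<longrightarrow> unit_at Y V t (f x))"

text \<open>
  Closed immersions: a homeomorphism onto a closed subset for which the map of sheaves
  \<open>O_Y \<rightarrow> f\<^sub>* O_X\<close> is surjective, that is, sections of \<open>f\<^sub>* O_X\<close> lift locally on \<open>Y\<close>.
\<close>

definition closed_immersion ::
  "('p, 's, 'k) kspace \<Rightarrow> ('q, 't, 'k) kspace \<Rightarrow> ('p \<Rightarrow> 'q) \<Rightarrow> ('q set \<Rightarrow> 't \<Rightarrow> 's) \<Rightarrow> bool" where
  "closed_immersion X Y f h \<longleftrightarrow>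
     local_morphism X Y f h \<and>
     embedding_map (top_of X) (top_of Y) f \<and>
     closedin (top_of Y) (f ` topspace (top_of X)) \<and>
     (\<forall>V s y. openin (top_of Y) V \<longrightarrow> s \<in> carrier (ring_of X (preim X f V)) \<longrightarrow> y \<in> V \<longrightarrow>
        (\<exists>W t. openin (top_of Y) W \<and> y \<in> W \<and> W \<subseteq> V \<and> t \<in> carrier (ring_of Y W) \<and>
           h W t = res X (preim X f W) s))"


section \<open>Line bundles and very ampleness\<close>

text \<open>The section \<open>e\<close> of \<open>L\<close> over \<open>U\<close> is a free generator of the restriction of \<open>L\<close> to \<open>U\<close>.\<close>

definition frame ::
  "('p, 's, 'k) kspace \<Rightarrow> ('p, 's, 'm) module_sheaf \<Rightarrow> 'p set \<Rightarrow> 'm \<Rightarrow> bool" where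
  "frame X L U e \<longleftrightarrow>
     e \<in> carrier (mod_of L U) \<and>
     (\<forall>W. openin (top_of X) W \<longrightarrow> W \<subseteq> U \<longrightarrow>
        bij_betw (\<lambda>t. t \<odot>\<^bsub>mod_of L W\<^esub> mres L W e)
          (carrier (ring_of X W)) (carrier (mod_of L W)))"

definition line_bundle :: "('p, 's, 'k) kspace \<Rightarrow> ('p, 's, 'm) module_sheaf \<Rightarrow> bool" where
  "line_bundle X L \<longleftrightarrow>
     (\<forall>x \<in> topspace (top_of X). \<exists>U e. openin (top_of X) U \<and> x \<in> U \<and> frame X L U e)"

text \<open>
  A homomorphism \<open>M \<rightarrow> f\<^sub>* L\<close> of sheaves of \<open>O_Y\<close>-modules, equivalently (by adjunction) a
  homomorphism \<open>f\<^sup>* M \<rightarrow> L\<close> of sheaves of \<open>O_X\<close>-modules.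
\<close>

definition hom_over ::
  "('p, 's, 'k) kspace \<Rightarrow> ('q, 't, 'k) kspace \<Rightarrow> ('p \<Rightarrow> 'q) \<Rightarrow> ('q set \<Rightarrow> 't \<Rightarrow> 's) \<Rightarrow>
   ('q, 't, 'n) module_sheaf \<Rightarrow> ('p, 's, 'm) module_sheaf \<Rightarrow> ('q set \<Rightarrow> 'n \<Rightarrow> 'm) \<Rightarrow> bool" where
  "hom_over X Y f h M L \<theta> \<longleftrightarrow>
     (\<forall>V. openin (top_of Y) V \<longrightarrow>
        (\<forall>m \<in> carrier (mod_of M V).
           \<theta> V m \<in> carrier (mod_of L (preim X f V)) \<and>
           (\<forall>m' \<in> carrier (mod_of M V).
              \<theta> V (m \<oplus>\<^bsub>mod_of M V\<^esub> m') = \<theta> V m \<oplus>\<^bsub>mod_of L (preim X f V)\<^esub> \<theta> V m') \<and>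
           (\<forall>t \<in> carrier (ring_of Y V).
              \<theta> V (t \<odot>\<^bsub>mod_of M V\<^esub> m) = h V t \<odot>\<^bsub>mod_of L (preim X f V)\<^esub> \<theta> V m) \<and>
           (\<forall>W. openin (top_of Y) W \<longrightarrow> W \<subseteq> V \<longrightarrow>
              \<theta> W (mres M W m) = mres L (preim X f W) (\<theta> V m))))"

text \<open>
  \<open>f\<^sup>* M \<cong> L\<close> for a line bundle \<open>M\<close>. If \<open>e\<close> generates \<open>M\<close> freely over \<open>V\<close>, then \<open>f\<^sup>* e\<close>
  generates \<open>f\<^sup>* M\<close> freely over the preimage of \<open>V\<close>, so that a homomorphism \<open>f\<^sup>* M \<rightarrow> L\<close> is an
  isomorphism precisely when it maps every such generator to a free generator of \<open>L\<close>.
\<close>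

definition pullback_iso ::
  "('p, 's, 'k) kspace \<Rightarrow> ('q, 't, 'k) kspace \<Rightarrow> ('p \<Rightarrow> 'q) \<Rightarrow> ('q set \<Rightarrow> 't \<Rightarrow> 's) \<Rightarrow>
   ('q, 't, 'n) module_sheaf \<Rightarrow> ('p, 's, 'm) module_sheaf \<Rightarrow> bool" where
  "pullback_iso X Y f h M L \<longleftrightarrow>
     line_bundle Y M \<and>
     (\<exists>\<theta>. hom_over X Y f h M L \<theta> \<and>
        (\<forall>V e. openin (top_of Y) V \<longrightarrow> frame Y M V e \<longrightarrow> frame X L (preim X f V) (\<theta> V e)))"


section \<open>Proj of a graded domain\<close>

text \<open>
  A graded domain is given by its homogeneous parts \<open>gr d\<close>, as subsets of a type of class
  \<open>idom\<close>; the ring itself is their (direct) sum.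
\<close>

definition graded_ring :: "(nat \<Rightarrow> 'r::idom set) \<Rightarrow> 'r ring" where
  "graded_ring gr =
     \<lparr>carrier = {\<Sum>d\<le>D. c d | D c. \<forall>d. c d \<in> gr d},
      monoid.mult = (*), one = 1, zero = 0, add = (+)\<rparr>"

definition proj_points :: "(nat \<Rightarrow> 'r::idom set) \<Rightarrow> 'r set set" where
  "proj_points gr =
     {P. primeideal P (graded_ring gr) \<and>
         (\<forall>D c. (\<forall>d. c d \<in> gr d) \<longrightarrow> (\<Sum>d\<le>D. c d) \<in> P \<longrightarrow> (\<forall>d\<le>D. c d \<in> P)) \<and>
         \<not> (\<Union>d\<in>{1..}. gr d) \<subseteq> P}"

definition proj_top :: "(nat \<Rightarrow> 'r::idom set) \<Rightarrow> 'r set topology" where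
  "proj_top gr = topology_generated_by {{P \<in> proj_points gr. f \<notin> P} | f d. f \<in> gr d}"

text \<open>
  The sections over \<open>U\<close> of the sheaf \<open>O(n)\<close> associated with the shifted graded module \<open>S(n)\<close>:
  functions on \<open>U\<close> whose value at \<open>P\<close> lies in the degree \<open>n\<close> part of the homogeneous
  localization at \<open>P\<close> and which are locally given by a fraction. As \<open>S\<close> is a domain,
  all these localizations are subsets of its field of fractions.
\<close>

definition twist_sections ::
  "(nat \<Rightarrow> 'r::idom set) \<Rightarrow> nat \<Rightarrow> 'r set set \<Rightarrow> ('r set \<Rightarrow> 'r fract) set" where
  "twist_sections gr n U =
     {s \<in> extensional U. \<forall>P\<in>U. \<exists>V d a b.
        openin (proj_top gr) V \<and> P \<in> V \<and> V \<subseteq> U \<and> a \<in> gr (d + n) \<and> b \<in> gr d \<and>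
        (\<forall>Q\<in>V. b \<notin> Q \<and> s Q = Fract a b)}"

text \<open>The argument \<open>\<iota>\<close> is the structure map from the base field to the degree zero part.\<close>

definition Proj ::
  "('k \<Rightarrow> 'r) \<Rightarrow> (nat \<Rightarrow> 'r::idom set) \<Rightarrow> ('r set, 'r set \<Rightarrow> 'r fract, 'k) kspace" where
  "Proj \<iota> gr =
     \<lparr>top_of = proj_top gr,
      ring_of = (\<lambda>U. \<lparr>carrier = twist_sections gr 0 U,
                      monoid.mult = (\<lambda>s t. \<lambda>P\<in>U. s P * t P), one = (\<lambda>P\<in>U. 1),
                      zero = (\<lambda>P\<in>U. 0), add = (\<lambda>s t. \<lambda>P\<in>U. s P + t P)\<rparr>),
      res = (\<lambda>V s. restrict s V),
      scal = (\<lambda>U c. \<lambda>P\<in>U. Fract (\<iota> c) 1)\<rparr>"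

text \<open>The \<open>mult\<close> and \<open>one\<close> fields, which every module record has, carry no meaning here.\<close>

definition twisting_sheaf ::
  "(nat \<Rightarrow> 'r::idom set) \<Rightarrow> nat \<Rightarrow> ('r set, 'r set \<Rightarrow> 'r fract, 'r set \<Rightarrow> 'r fract) module_sheaf" where
  "twisting_sheaf gr n =
     \<lparr>mod_of = (\<lambda>U. \<lparr>carrier = twist_sections gr n U, monoid.mult = undefined, one = undefined,
                     zero = (\<lambda>P\<in>U. 0), add = (\<lambda>s t. \<lambda>P\<in>U. s P + t P),
                     smult = (\<lambda>t s. \<lambda>P\<in>U. t P * s P)\<rparr>),
      mres = (\<lambda>V s. restrict s V)\<rparr>"


section \<open>Weighted projective spaces\<close>

text \<open>
  Polynomials in variables indexed by the natural numbers; for a list \<open>a\<close> of weights, only the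
  variables with index below \<open>length a\<close> are used, and the one with index \<open>i\<close> has degree \<open>a ! i\<close>.
\<close>

type_synonym 'k npoly = "(nat \<Rightarrow>\<^sub>0 nat) \<Rightarrow>\<^sub>0 'k"

definition wpoly_part :: "nat list \<Rightarrow> nat \<Rightarrow> 'k::field npoly set" where
  "wpoly_part a d =
     {f. \<forall>m \<in> Poly_Mapping.keys f. Poly_Mapping.keys m \<subseteq> {..<length a} \<and>
           (\<Sum>i<length a. a ! i * Poly_Mapping.lookup m i) = d}"

definition weighted_proj_space ::
  "nat list \<Rightarrow> ('k npoly set, 'k npoly set \<Rightarrow> 'k npoly fract, 'k::field) kspace" where
  "weighted_proj_space a = Proj (Poly_Mapping.single 0) (wpoly_part a)"

definition weighted_twist ::
  "nat list \<Rightarrow> nat \<Rightarrow>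
   ('k npoly set, 'k npoly set \<Rightarrow> 'k npoly fract, 'k::field npoly set \<Rightarrow> 'k npoly fract) module_sheaf"
where
  "weighted_twist a n = twisting_sheaf (wpoly_part a) n"

text \<open>
  Very ampleness over \<open>k\<close>: \<open>L\<close> is the pullback of \<open>O(1)\<close> under a closed immersion over \<open>k\<close>
  into some projective space, which is the weighted one with \<open>N + 1\<close> weights equal to 1.
\<close>

definition very_ample :: "('p, 's, 'k::field) kspace \<Rightarrow> ('p, 's, 'm) module_sheaf \<Rightarrow> bool" where
  "very_ample X L \<longleftrightarrow>
     (\<exists>N f h. closed_immersion X (weighted_proj_space (replicate (N + 1) 1)) f h \<and>
        pullback_iso X (weighted_proj_space (replicate (N + 1) 1)) f h
          (weighted_twist (replicate (N + 1) 1) 1) L)"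

end

theory Submission
  imports Defs
begin

text \<open>
  Very ampleness of \<open>O(6p)\<close> can be tested on the charts where a variable is invertible: the map given by all
  monomials of degree \<open>6p\<close> is a closed immersion as soon as, for each variable, every homogeneous
  fraction of degree zero whose denominator is a power of that variable is a polynomial in the quotients of
  monomials of degree \<open>6p\<close>. For \<open>p = 6q + 1\<close> this is a statement on exponents: every exponent
  without the inverted variable and of degree divisible by the weight of that variable splits off a part
  of the same kind of degree at most \<open>6p\<close>.

  For \<open>p = 6q + 5\<close>, no monomial of degree \<open>6p\<close> contains \<open>x\<^sub>0\<close> with exponent exactly one.
  Global sections of \<open>O(6p)\<close> are polynomials, so near a point of a closed immersion
  given by \<open>O(6p)\<close> every function is a quotient of polynomials without terms linear in \<open>x\<^sub>0\<close>.
  At the generic point of the divisor \<open>x\<^sub>0 = 0\<close> this fails for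
  \<open>x\<^sub>0 x\<^sub>2\<^sup>2 x\<^sub>3 / x\<^sub>1\<^sup>e\<close>, where \<open>6e = 7p + 1\<close>.
\<close>

section \<open>Graded domains and their homogeneous primes\<close>

text \<open>What separates the two residues is a congruence. Let \<open>c\<close> and
  \<open>d\<close> be the exponents of \<open>x\<^sub>2\<close> and \<open>x\<^sub>3\<close> in a
  monomial linear in \<open>x\<^sub>0\<close>; its degree is divisible by 6 iff 6 divides
  \<open>1 + 2 * p * c + 3 * p * d\<close>. For \<open>p = 6q + 1\<close> the least solution is
  \<open>c = d = 1\<close>, and \<open>x\<^sub>0 x\<^sub>2 x\<^sub>3\<close> has degree
  \<open>5p + 1\<close>, below \<open>6p\<close>. For \<open>p = 6q + 5\<close> it is
  \<open>c = 2\<close>, \<open>d = 1\<close>, of degree \<open>7p + 1\<close>, above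
  \<open>6p\<close>: this is where the test function comes from.

  For the negative half the obstacle is that \<open>very_ample\<close> allows arbitrary
  \<open>f\<close> and \<open>h\<close>. The isomorphism with \<open>O(1)\<close> controls them: the
  coordinates go to sections of \<open>O(6p)\<close>, and linearity forces \<open>h\<close> to send
  \<open>x\<^sub>i / x\<^sub>j\<close> to the quotient of the corresponding sections.

  For the positive half the points of the image must be lifted. A homogeneous prime of the target
  sees only degrees divisible by \<open>6p\<close>, so the prime above it has to be defined in all
  other degrees through multiples whose degree is divisible by \<open>6p\<close>.\<close>

definition hspan :: "(nat \<Rightarrow> 'r::idom set) \<Rightarrow> 'r set" where
  "hspan J = {\<Sum>d\<le>D. c d | D c. \<forall>d. c d \<in> J d}"

text \<open>For \<open>J = gr\<close> the span is the carrier of \<open>graded_ring gr\<close>; for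
  the parts of a homogeneous ideal it is that ideal. Padding the components with zeros makes every
  larger bound valid, so two elements can be written under a common bound.\<close>

lemma hspanE:
  assumes "x \<in> hspan J" "\<And>d. 0 \<in> J d"
  obtains c D where "\<And>d. c d \<in> J d" "\<And>d. d > D \<Longrightarrow> c d = 0" "\<And>E. E \<ge> D \<Longrightarrow> x = (\<Sum>d\<le>E. c d)"
proof -
  obtain D c where c: "x = (\<Sum>d\<le>D. c d)" "\<And>d. c d \<in> J d"
    using assms(1) unfolding hspan_def by blast
  let ?c = "\<lambda>d. if d \<le> D then c d else 0"
  have "x = (\<Sum>d\<le>E. ?c d)" if "E \<ge> D" for E
  proof -
    have "(\<Sum>d\<le>E. ?c d) = (\<Sum>d\<le>D. ?c d)"
      using that by (intro sum.mono_neutral_right) auto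
    then show ?thesis using c(1) by simp
  qed
  then show thesis using that[of ?c D] c(2) assms(2) by simp
qed

lemma hspanI: "(\<And>d. c d \<in> J d) \<Longrightarrow> (\<Sum>d\<le>D. c d) \<in> hspan J"
  unfolding hspan_def by blast

lemma hspan_homogeneous:
  assumes "x \<in> J d" "\<And>d. 0 \<in> J d"
  shows "x \<in> hspan J"
proof -
  have "(\<Sum>e\<le>d. if e = d then x else 0) \<in> hspan J"
    using assms by (intro hspanI) simp
  then show ?thesis by simp
qed

lemma hspan_mono: "(\<And>d. J d \<subseteq> K d) \<Longrightarrow> hspan J \<subseteq> hspan K"
  unfolding hspan_def by blast

lemma hspan_add:
  assumes "\<And>d. 0 \<in> J d" "\<And>d x y. x \<in> J d \<Longrightarrow> y \<in> J d \<Longrightarrow> x + y \<in> J d"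
    and "x \<in> hspan J" "y \<in> hspan J"
  shows "x + y \<in> hspan J"
proof -
  obtain c D where c: "\<And>d. c d \<in> J d" "\<And>E. E \<ge> D \<Longrightarrow> x = (\<Sum>d\<le>E. c d)"
    using hspanE[OF assms(3,1)] by metis
  obtain b E where b: "\<And>d. b d \<in> J d" "\<And>D. D \<ge> E \<Longrightarrow> y = (\<Sum>d\<le>D. b d)"
    using hspanE[OF assms(4,1)] by metis
  have "x + y = (\<Sum>d\<le>max D E. c d + b d)"
    using c(2)[of "max D E"] b(2)[of "max D E"] by (simp add: sum.distrib)
  then show ?thesis using hspanI[of "\<lambda>d. c d + b d" J] assms(2) c(1) b(1) by simp
qed

lemma hspan_sum:
  assumes "\<And>d. 0 \<in> J d" "\<And>d x y. x \<in> J d \<Longrightarrow> y \<in> J d \<Longrightarrow> x + y \<in> J d"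
    and "\<And>i. i \<in> A \<Longrightarrow> f i \<in> hspan J"
  shows "(\<Sum>i\<in>A. f i) \<in> hspan J"
  using assms(3)
proof (induction A rule: infinite_finite_induct)
  case (insert x F)
  then show ?case using hspan_add[OF assms(1,2)] by simp
qed (use hspan_homogeneous[OF assms(1,1)] in auto)

lemma hspan_mult:
  assumes "\<And>d. 0 \<in> I d" "\<And>d. 0 \<in> J d" "\<And>d. 0 \<in> K d"
    and "\<And>d x y. x \<in> K d \<Longrightarrow> y \<in> K d \<Longrightarrow> x + y \<in> K d"
    and "\<And>d e x y. x \<in> I d \<Longrightarrow> y \<in> J e \<Longrightarrow> x * y \<in> K (d + e)"
    and "x \<in> hspan I" "y \<in> hspan J"
  shows "x * y \<in> hspan K"
proof -
  obtain D c where c: "x = (\<Sum>d\<le>D. c d)" "\<And>d. c d \<in> I d"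
    using assms(6) unfolding hspan_def by blast
  obtain E b where b: "y = (\<Sum>d\<le>E. b d)" "\<And>d. b d \<in> J d"
    using assms(7) unfolding hspan_def by blast
  have "c d * b e \<in> hspan K" for d e
    by (rule hspan_homogeneous[of _ K "d + e"]) (use c b assms in auto)
  then show ?thesis
    unfolding c b sum_product by (intro hspan_sum[OF assms(3,4)]) auto
qed

lemma hspan_uminus:
  assumes "\<And>d x. x \<in> J d \<Longrightarrow> - x \<in> J d" "x \<in> hspan J"
  shows "- x \<in> hspan J"
proof -
  obtain D c where c: "x = (\<Sum>d\<le>D. c d)" "\<And>d. c d \<in> J d"
    using assms(2) unfolding hspan_def by blast
  then show ?thesis using hspanI[of "\<lambda>d. - c d" J D] assms(1) by (simp add: sum_negf)
qed

text \<open>\<open>gr_indep\<close> makes the sum of the parts direct, which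
  \<open>graded_ring\<close> and \<open>Proj\<close> do not enforce. The parts may span less than
  the whole type.\<close>

locale graded_domain =
  fixes gr :: "nat \<Rightarrow> 'r::idom set"
  assumes gr_zero [simp]: "0 \<in> gr d"
    and gr_add: "x \<in> gr d \<Longrightarrow> y \<in> gr d \<Longrightarrow> x + y \<in> gr d"
    and gr_uminus: "x \<in> gr d \<Longrightarrow> - x \<in> gr d"
    and gr_one [simp]: "1 \<in> gr 0"
    and gr_mult: "x \<in> gr d \<Longrightarrow> y \<in> gr e \<Longrightarrow> x * y \<in> gr (d + e)"
    and gr_indep: "(\<And>d. c d \<in> gr d) \<Longrightarrow> (\<Sum>d\<le>D. c d) = 0 \<Longrightarrow> d \<le> D \<Longrightarrow> c d = 0"
begin

lemma gr_diff: "x \<in> gr d \<Longrightarrow> y \<in> gr d \<Longrightarrow> x - y \<in> gr d"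
  using gr_add[of x d "- y"] gr_uminus[of y d] by simp

lemma gr_power: "x \<in> gr d \<Longrightarrow> x ^ n \<in> gr (n * d)"
  by (induction n) (auto intro: gr_mult)

lemma gr_sum: "(\<And>i. i \<in> A \<Longrightarrow> f i \<in> gr d) \<Longrightarrow> (\<Sum>i\<in>A. f i) \<in> gr d"
  by (induction A rule: infinite_finite_induct) (auto intro: gr_add)

lemma components_unique:
  assumes "\<And>d. b d \<in> gr d" "\<And>d. c d \<in> gr d" "(\<Sum>d\<le>D. b d) = (\<Sum>d\<le>D. c d)" "d \<le> D"
  shows "b d = c d"
  using gr_indep[of "\<lambda>d. b d - c d" D d] assms by (simp add: gr_diff sum_subtractf)

lemma carrier_graded_ring: "carrier (graded_ring gr) = hspan gr"
  by (simp add: graded_ring_def hspan_def)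

lemma cring_graded_ring: "cring (graded_ring gr)"
proof (rule cringI)
  have z: "0 \<in> hspan gr" "1 \<in> hspan gr"
    using hspan_homogeneous[of 0 gr 0] hspan_homogeneous[of 1 gr 0] by auto
  show "abelian_group (graded_ring gr)"
    using z hspan_add[of gr] hspan_uminus[of gr]
    by (intro abelian_groupI)
       (auto simp: graded_ring_def hspan_def[symmetric] gr_add gr_uminus add_ac intro: bexI[of _ "- _"])
  show "comm_monoid (graded_ring gr)"
    using z hspan_mult[of gr gr gr]
    by (intro comm_monoidI)
       (auto simp: graded_ring_def hspan_def[symmetric] gr_add gr_mult mult_ac)
qed (auto simp: graded_ring_def algebra_simps)

text \<open>A homogeneous prime is handled through its homogeneous parts \<open>J d\<close>.\<close>

definition hprime :: "(nat \<Rightarrow> 'r set) \<Rightarrow> bool" where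
  "hprime J \<longleftrightarrow>
     (\<forall>d. J d \<subseteq> gr d) \<and> (\<forall>d. 0 \<in> J d) \<and>
     (\<forall>d x y. x \<in> J d \<longrightarrow> y \<in> J d \<longrightarrow> x + y \<in> J d) \<and>
     (\<forall>d e x y. x \<in> gr d \<longrightarrow> y \<in> J e \<longrightarrow> x * y \<in> J (d + e)) \<and>
     (\<forall>d e x y. x \<in> gr d \<longrightarrow> y \<in> gr e \<longrightarrow> x * y \<in> J (d + e) \<longrightarrow> x \<in> J d \<or> y \<in> J e) \<and>
     (\<exists>d\<ge>1. \<exists>x\<in>gr d. x \<notin> J d)"

lemma hprimeI:
  assumes "\<And>d. J d \<subseteq> gr d" "\<And>d. 0 \<in> J d"
    and "\<And>d x y. x \<in> J d \<Longrightarrow> y \<in> J d \<Longrightarrow> x + y \<in> J d"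
    and "\<And>d e x y. x \<in> gr d \<Longrightarrow> y \<in> J e \<Longrightarrow> x * y \<in> J (d + e)"
    and "\<And>d e x y. x \<in> gr d \<Longrightarrow> y \<in> gr e \<Longrightarrow> x * y \<in> J (d + e) \<Longrightarrow> x \<notin> J d \<Longrightarrow> y \<in> J e"
    and "d \<ge> 1" "x \<in> gr d" "x \<notin> J d"
  shows "hprime J"
  unfolding hprime_def using assms by metis

lemma hprime_nontrivial: "hprime J \<Longrightarrow> \<exists>d x. d \<ge> 1 \<and> x \<in> gr d \<and> x \<notin> J d"
  unfolding hprime_def by (elim conjE) blast

lemma hprime_zero: "hprime J \<Longrightarrow> 0 \<in> J d"
  unfolding hprime_def by simp

text \<open>Components are unique, so passing from the parts to their span creates no new
  homogeneous elements.\<close>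

lemma hspan_hprime_homogeneous:
  assumes J: "hprime J" and x: "x \<in> gr d"
  shows "x \<in> hspan J \<longleftrightarrow> x \<in> J d"
proof
  assume "x \<in> hspan J"
  then obtain c D where c: "\<And>d. c d \<in> J d" "\<And>d. d > D \<Longrightarrow> c d = 0" "\<And>E. E \<ge> D \<Longrightarrow> x = (\<Sum>d\<le>E. c d)"
    using hspanE[of x J] J unfolding hprime_def by metis
  have "(\<Sum>e\<le>max d D. if e = d then x else 0) = (\<Sum>e\<le>max d D. c e)"
    using c(3)[of "max d D"] by simp
  moreover have "\<And>e. (if e = d then x else 0) \<in> gr e" "\<And>e. c e \<in> gr e"
    using c(1) x J unfolding hprime_def by auto
  ultimately have "(if d = d then x else 0) = c d"
    using components_unique[of "\<lambda>e. if e = d then x else 0" c "max d D" d] by simp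
  then show "x \<in> J d" using c(1) by simp
qed (use J in \<open>auto simp: hprime_def intro: hspan_homogeneous\<close>)

lemma hspan_hprime_components:
  assumes J: "hprime J" and c: "\<And>d. c d \<in> gr d" and "(\<Sum>d\<le>D. c d) \<in> hspan J" "d \<le> D"
  shows "c d \<in> J d"
proof -
  obtain b E where b: "\<And>d. b d \<in> J d" "\<And>d. d > E \<Longrightarrow> b d = 0"
    "\<And>D'. D' \<ge> E \<Longrightarrow> (\<Sum>d\<le>D. c d) = (\<Sum>d\<le>D'. b d)"
    using hspanE[of _ J, OF assms(3)] J unfolding hprime_def by metis
  let ?c = "\<lambda>d. if d \<le> D then c d else 0"
  have "(\<Sum>d\<le>max D E. ?c d) = (\<Sum>d\<le>D. c d)"
    by (rule sum.mono_neutral_cong_right) auto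
  then have "(\<Sum>d\<le>max D E. ?c d) = (\<Sum>d\<le>max D E. b d)"
    using b(3)[of "max D E"] by simp
  moreover have "\<And>d. ?c d \<in> gr d" "\<And>d. b d \<in> gr d"
    using b(1) c J unfolding hprime_def by auto
  ultimately have "?c d = b d"
    using components_unique[of ?c b "max D E" d] assms(4) by simp
  then show ?thesis using b(1)[of d] assms(4) by simp
qed

text \<open>Primality on homogeneous elements suffices: if neither factor lies in the span, the
  product of their lowest components outside \<open>J\<close> agrees, up to elements of
  \<open>J\<close>, with a component of the product.\<close>

lemma hspan_hprime_primeideal:
  assumes J: "hprime J"
  shows "primeideal (hspan J) (graded_ring gr)"
proof -
  interpret cring "graded_ring gr" by (rule cring_graded_ring)
  have J0: "\<And>d. 0 \<in> J d" and Jgr: "\<And>d. J d \<subseteq> gr d"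
    and Jadd: "\<And>d x y. x \<in> J d \<Longrightarrow> y \<in> J d \<Longrightarrow> x + y \<in> J d"
    and Jmult: "\<And>d e x y. x \<in> gr d \<Longrightarrow> y \<in> J e \<Longrightarrow> x * y \<in> J (d + e)"
    and Jprime: "\<And>d e x y. x \<in> gr d \<Longrightarrow> y \<in> gr e \<Longrightarrow> x * y \<in> J (d + e) \<Longrightarrow> x \<in> J d \<or> y \<in> J e"
    using J unfolding hprime_def by auto
  have Juminus: "- x \<in> J d" if "x \<in> J d" for x d
    using Jmult[of "-1" 0 x d] that gr_uminus[of 1 0] by simp
  have sub: "hspan J \<subseteq> hspan gr" by (rule hspan_mono) (use Jgr in auto)
  have inv: "\<ominus>\<^bsub>graded_ring gr\<^esub> x = - x" if "x \<in> hspan gr" for x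
  proof (rule minus_equality)
    show "- x \<oplus>\<^bsub>graded_ring gr\<^esub> x = \<zero>\<^bsub>graded_ring gr\<^esub>" by (simp add: graded_ring_def)
    show "x \<in> carrier (graded_ring gr)" "- x \<in> carrier (graded_ring gr)"
      using that hspan_uminus[of gr x] gr_uminus by (auto simp: carrier_graded_ring)
  qed
  have mult: "x * y \<in> hspan J" if "x \<in> hspan gr" "y \<in> hspan J" for x y
    using hspan_mult[of gr J J x y] that J0 Jadd Jmult by auto
  have idl: "ideal (hspan J) (graded_ring gr)"
  proof (rule idealI)
    show "subgroup (hspan J) (add_monoid (graded_ring gr))"
    proof (rule group.subgroupI)
      show "group (add_monoid (graded_ring gr))" by (rule a_group)
      show "hspan J \<subseteq> carrier (add_monoid (graded_ring gr))"
        using sub by (simp add: carrier_graded_ring)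
      have "0 \<in> hspan J" by (rule hspan_homogeneous[of 0 J 0]) (simp_all add: J0)
      then show "hspan J \<noteq> {}" by auto
      fix a assume a: "a \<in> hspan J"
      then have "- a \<in> hspan J" using hspan_uminus Juminus by blast
      then show "inv\<^bsub>add_monoid (graded_ring gr)\<^esub> a \<in> hspan J"
        using inv[of a] a sub unfolding a_inv_def by auto
      fix b assume b: "b \<in> hspan J"
      show "a \<otimes>\<^bsub>add_monoid (graded_ring gr)\<^esub> b \<in> hspan J"
        using hspan_add[OF J0 Jadd a b] by (simp add: graded_ring_def)
    qed
    fix a x assume "a \<in> hspan J" "x \<in> carrier (graded_ring gr)"
    then show "x \<otimes>\<^bsub>graded_ring gr\<^esub> a \<in> hspan J" "a \<otimes>\<^bsub>graded_ring gr\<^esub> x \<in> hspan J"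
      using mult[of x a] by (simp_all add: carrier_graded_ring, simp_all add: graded_ring_def mult.commute)
  qed (rule ring_axioms)
  show ?thesis
  proof (rule primeidealI[OF idl cring_axioms])
    obtain d x where dx: "x \<in> gr d" "x \<notin> J d" using hprime_nontrivial[OF J] by blast
    then have "x \<notin> hspan J" "x \<in> hspan gr"
      using hspan_hprime_homogeneous[OF J] hspan_homogeneous[of x gr d] by auto
    then show "carrier (graded_ring gr) \<noteq> hspan J" by (auto simp: carrier_graded_ring)
    fix x y assume "x \<in> carrier (graded_ring gr)" "y \<in> carrier (graded_ring gr)"
      "x \<otimes>\<^bsub>graded_ring gr\<^esub> y \<in> hspan J"
    then have xy: "x \<in> hspan gr" "y \<in> hspan gr" "x * y \<in> hspan J"
      by (auto simp: carrier_graded_ring) (simp add: graded_ring_def)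
    obtain a D where a: "\<And>d. a d \<in> gr d" "\<And>d. d > D \<Longrightarrow> a d = 0" "\<And>E. E \<ge> D \<Longrightarrow> x = (\<Sum>d\<le>E. a d)"
      using hspanE[OF xy(1)] gr_zero by metis
    obtain b E where b: "\<And>d. b d \<in> gr d" "\<And>d. d > E \<Longrightarrow> b d = 0" "\<And>D. D \<ge> E \<Longrightarrow> y = (\<Sum>d\<le>D. b d)"
      using hspanE[OF xy(2)] gr_zero by metis
    define c where "c n = (\<Sum>i\<le>n. a i * b (n - i))" for n
    have cgr: "c n \<in> gr n" for n
      unfolding c_def using gr_mult[OF a(1) b(1)] by (intro gr_sum) (metis atMost_iff le_add_diff_inverse)
    have "x * y = (\<Sum>n\<le>D + E. c n)"
      using polynomial_product[of D a E b 1] a(2) b(2) unfolding c_def a(3)[OF order_refl] b(3)[OF order_refl] by simp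
    then have cJ: "c n \<in> J n" if "n \<le> D + E" for n
      using hspan_hprime_components[OF J, of c "D + E" n] cgr xy(3) that by simp
    show "x \<in> hspan J \<or> y \<in> hspan J"
    proof (rule ccontr)
      assume "\<not> (x \<in> hspan J \<or> y \<in> hspan J)"
      then have "\<not> (\<forall>d. a d \<in> J d)" "\<not> (\<forall>d. b d \<in> J d)"
        using hspanI[of a J D] hspanI[of b J E] a(3)[of D] b(3)[of E] by auto
      then obtain d e where de: "a d \<notin> J d" "\<And>i. i < d \<Longrightarrow> a i \<in> J i"
        "b e \<notin> J e" "\<And>i. i < e \<Longrightarrow> b i \<in> J i"
        using exists_least_iff[of "\<lambda>d. a d \<notin> J d"] exists_least_iff[of "\<lambda>d. b d \<notin> J d"] by auto
      have le: "d \<le> D" "e \<le> E"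
        using de(1,3) a(2) b(2) J0 by (metis leI)+
      have split: "c (d + e) = a d * b e + (\<Sum>i\<in>{..d + e} - {d}. a i * b (d + e - i))"
        unfolding c_def by (subst sum.remove[of _ d]) auto
      \<comment> \<open>In every other summand of \<open>c (d + e)\<close> one factor has index
        below \<open>d\<close> or below \<open>e\<close>, and so lies in \<open>J\<close> by
        minimality.\<close>
      have rest: "(\<Sum>i\<in>{..d + e} - {d}. a i * b (d + e - i)) \<in> J (d + e)"
      proof -
        have "a i * b (d + e - i) \<in> J (d + e)" if "i \<in> {..d + e} - {d}" for i
        proof (cases "i < d")
          case True
          then show ?thesis
            using Jmult[OF b(1)[of "d + e - i"] de(2)[of i]] by (simp add: mult.commute)
        next
          case False
          then have "d + e - i < e" using that by auto
          then show ?thesis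
            using Jmult[OF a(1)[of i] de(4)[of "d + e - i"]] that by simp
        qed
        then have "(\<Sum>i\<in>A. a i * b (d + e - i)) \<in> J (d + e)" if "A \<subseteq> {..d + e} - {d}" for A
          using that by (induction A rule: infinite_finite_induct) (auto simp: J0 Jadd)
        then show ?thesis by blast
      qed
      have "c (d + e) \<in> J (d + e)" using le by (intro cJ) simp
      from Jadd[OF this Juminus[OF rest]] have "a d * b e \<in> J (d + e)" by (simp add: split)
      then show False using Jprime[OF a(1) b(1)] de by blast
    qed
  qed
qed

lemma hspan_hprime_proj_points:
  assumes J: "hprime J"
  shows "hspan J \<in> proj_points gr"
proof -
  have "c d \<in> hspan J" if "\<forall>d. c d \<in> gr d" "(\<Sum>d\<le>D. c d) \<in> hspan J" "d \<le> D" for c D d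
    using hspan_hprime_components[OF J, of c D d] that hspan_homogeneous[of "c d" J d] hprime_zero[OF J]
    by simp
  moreover have "\<not> (\<Union>d\<in>{1..}. gr d) \<subseteq> hspan J"
  proof -
    obtain d x where "d \<ge> 1" "x \<in> gr d" "x \<notin> J d" using hprime_nontrivial[OF J] by blast
    then show ?thesis using hspan_hprime_homogeneous[OF J] by auto
  qed
  ultimately show ?thesis
    unfolding proj_points_def using hspan_hprime_primeideal[OF J] by blast
qed

section \<open>Membership of homogeneous elements in a point\<close>

lemma point_zero:
  assumes P: "P \<in> proj_points gr" shows "0 \<in> P"
proof -
  interpret primeideal P "graded_ring gr" using P by (simp add: proj_points_def)
  show ?thesis using additive_subgroup.zero_closed[OF additive_subgroup_axioms]
    by (simp add: graded_ring_def)
qed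

lemma point_add:
  assumes P: "P \<in> proj_points gr" shows "x \<in> P \<Longrightarrow> y \<in> P \<Longrightarrow> x + y \<in> P"
proof -
  interpret primeideal P "graded_ring gr" using P by (simp add: proj_points_def)
  show "x \<in> P \<Longrightarrow> y \<in> P \<Longrightarrow> x + y \<in> P"
    using additive_subgroup.a_closed[OF additive_subgroup_axioms, of x y] by (simp add: graded_ring_def)
qed

lemma gr_carrier: "x \<in> gr d \<Longrightarrow> x \<in> carrier (graded_ring gr)"
  unfolding carrier_graded_ring by (rule hspan_homogeneous) auto

lemma point_mult_iff:
  assumes P: "P \<in> proj_points gr" and xy: "x \<in> gr d" "y \<in> gr e"
  shows "x * y \<in> P \<longleftrightarrow> x \<in> P \<or> y \<in> P"
proof -
  interpret primeideal P "graded_ring gr" using P by (simp add: proj_points_def)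
  have "\<And>x y. x \<otimes>\<^bsub>graded_ring gr\<^esub> y = x * y" by (simp add: graded_ring_def)
  then show ?thesis
    using I_prime[OF gr_carrier[OF xy(1)] gr_carrier[OF xy(2)]]
      I_l_closed[of y x] I_r_closed[of x y] gr_carrier[OF xy(1)] gr_carrier[OF xy(2)] by auto
qed

lemma point_one:
  assumes P: "P \<in> proj_points gr" shows "1 \<notin> P"
proof
  assume "1 \<in> P"
  then have "x \<in> P" if "x \<in> gr d" for x d
    using point_mult_iff[OF P gr_one that] by simp
  then show False using P unfolding proj_points_def by blast
qed

lemma point_power_iff:
  assumes P: "P \<in> proj_points gr" and x: "x \<in> gr d"
  shows "x ^ n \<in> P \<longleftrightarrow> n > 0 \<and> x \<in> P"
proof (induction n)
  case (Suc n)
  then show ?case using point_mult_iff[OF P x gr_power[OF x]] by auto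
qed (use point_one[OF P] in simp)

lemma point_component:
  assumes P: "P \<in> proj_points gr" and "\<And>d. c d \<in> gr d" "(\<Sum>d\<le>D. c d) \<in> P" "d \<le> D"
  shows "c d \<in> P"
  using assms unfolding proj_points_def by blast

lemma point_sum:
  assumes P: "P \<in> proj_points gr" and "\<And>i. i \<in> A \<Longrightarrow> f i \<in> P"
  shows "(\<Sum>i\<in>A. f i) \<in> P"
  using assms(2)
  by (induction A rule: infinite_finite_induct) (auto intro: point_add[OF P] point_zero[OF P])

text \<open>With \<open>hspan_hprime_proj_points\<close> in the other direction, points can be built
  and tested through their homogeneous parts.\<close>

lemma hprime_point:
  assumes P: "P \<in> proj_points gr"
  shows "hprime (\<lambda>d. P \<inter> gr d)"
proof -
  obtain d x where "d \<ge> 1" "x \<in> gr d" "x \<notin> P" using P unfolding proj_points_def by auto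
  then show ?thesis
    using point_zero[OF P] point_add[OF P] point_mult_iff[OF P]
    by (intro hprimeI[of "\<lambda>d. P \<inter> gr d" d x]) (auto intro: gr_add gr_mult)
qed

lemma points_eqI:
  assumes P: "P \<in> proj_points gr" and Q: "Q \<in> proj_points gr"
    and "\<And>d x. x \<in> gr d \<Longrightarrow> x \<in> P \<longleftrightarrow> x \<in> Q"
  shows "P = Q"
proof -
  have *: "P \<subseteq> Q" if P: "P \<in> proj_points gr" and Q: "Q \<in> proj_points gr"
    and eq: "\<And>d x. x \<in> gr d \<Longrightarrow> x \<in> P \<longleftrightarrow> x \<in> Q" for P Q
  proof
    fix x assume x: "x \<in> P"
    interpret primeideal P "graded_ring gr" using P by (simp add: proj_points_def)
    have "x \<in> hspan gr" using Icarr[OF x] by (simp add: carrier_graded_ring)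
    then obtain c D where c: "\<And>d. c d \<in> gr d" "x = (\<Sum>d\<le>D. c d)"
      unfolding hspan_def by blast
    have "c d \<in> Q" if "d \<le> D" for d
      using point_component[OF P, of c D d] eq[OF c(1)[of d]] c x that by simp
    then show "x \<in> Q" unfolding c(2) by (intro point_sum[OF Q]) auto
  qed
  show ?thesis using *[OF P Q] *[OF Q P] assms(3) by blast
qed

end

section \<open>The structure sheaf and the twisting sheaves\<close>

context graded_domain
begin

definition basic_open :: "'r \<Rightarrow> 'r set set" where
  "basic_open s = {P \<in> proj_points gr. s \<notin> P}"

lemma in_basic_open [simp]: "P \<in> basic_open s \<longleftrightarrow> P \<in> proj_points gr \<and> s \<notin> P"
  by (simp add: basic_open_def)

lemma openin_basic_open: "s \<in> gr d \<Longrightarrow> openin (proj_top gr) (basic_open s)"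
  unfolding proj_top_def basic_open_def by (rule topology_generated_by_Basis) blast

lemma basic_open_mult:
  "x \<in> gr d \<Longrightarrow> y \<in> gr e \<Longrightarrow> basic_open (x * y) = basic_open x \<inter> basic_open y"
  using point_mult_iff by auto

text \<open>The sets \<open>basic_open s\<close> generate \<open>proj_top\<close> as a subbasis;
  since products of homogeneous elements cut out intersections, they form a basis.\<close>

lemma openin_proj_iff:
  "openin (proj_top gr) U \<longleftrightarrow>
     U \<subseteq> proj_points gr \<and> (\<forall>P\<in>U. \<exists>d. \<exists>s\<in>gr d. s \<notin> P \<and> basic_open s \<subseteq> U)"
proof
  assume "openin (proj_top gr) U"
  then have "generate_topology_on {{P \<in> proj_points gr. f \<notin> P} | f d. f \<in> gr d} U"
    unfolding proj_top_def by (simp add: openin_topology_generated_by_iff)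
  then show "U \<subseteq> proj_points gr \<and> (\<forall>P\<in>U. \<exists>d. \<exists>s\<in>gr d. s \<notin> P \<and> basic_open s \<subseteq> U)"
  proof induction
    case (Int a b)
    have "\<exists>d. \<exists>s\<in>gr d. s \<notin> P \<and> basic_open s \<subseteq> a \<inter> b" if P: "P \<in> a \<inter> b" for P
    proof -
      obtain d s where s: "s \<in> gr d" "s \<notin> P" "basic_open s \<subseteq> a" using Int.IH(1) P by (meson IntD1)
      obtain e t where t: "t \<in> gr e" "t \<notin> P" "basic_open t \<subseteq> b" using Int.IH(2) P by (meson IntD2)
      have "P \<in> proj_points gr" using Int.IH(1) P by blast
      then have "s * t \<notin> P" using point_mult_iff[OF _ s(1) t(1)] s(2) t(2) by blast
      moreover have "basic_open (s * t) \<subseteq> a \<inter> b"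
        using basic_open_mult[OF s(1) t(1)] s(3) t(3) by blast
      ultimately show ?thesis using gr_mult[OF s(1) t(1)] by blast
    qed
    then show ?case using Int.IH by blast
  next
    case (UN K)
    have "\<exists>d. \<exists>s\<in>gr d. s \<notin> P \<and> basic_open s \<subseteq> \<Union>K" if P: "P \<in> \<Union>K" for P
    proof -
      obtain k where k: "k \<in> K" "P \<in> k" using P by blast
      then obtain d s where "s \<in> gr d" "s \<notin> P" "basic_open s \<subseteq> k" using UN.IH by meson
      then show ?thesis using k by blast
    qed
    moreover have "\<Union>K \<subseteq> proj_points gr" using UN.IH by blast
    ultimately show ?case by blast
  next
    case (Basis s)
    then obtain f d where f: "s = basic_open f" "f \<in> gr d" unfolding basic_open_def by blast
    show ?case unfolding f(1)
    proof (intro conjI ballI)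
      show "\<exists>e. \<exists>s\<in>gr e. s \<notin> P \<and> basic_open s \<subseteq> basic_open f" if "P \<in> basic_open f" for P
        using that f(2) by (intro exI[of _ d] bexI[of _ f]) auto
    qed auto
  qed auto
next
  assume U: "U \<subseteq> proj_points gr \<and> (\<forall>P\<in>U. \<exists>d. \<exists>s\<in>gr d. s \<notin> P \<and> basic_open s \<subseteq> U)"
  show "openin (proj_top gr) U"
  proof (subst openin_subopen, intro ballI)
    fix P assume P: "P \<in> U"
    then obtain d s where "s \<in> gr d" "s \<notin> P" "basic_open s \<subseteq> U" using U by meson
    then show "\<exists>T. openin (proj_top gr) T \<and> P \<in> T \<and> T \<subseteq> U"
      using openin_basic_open[of s d] P U by (intro exI[of _ "basic_open s"]) auto
  qed
qed

lemma topspace_proj_top [simp]: "topspace (proj_top gr) = proj_points gr"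
proof
  show "topspace (proj_top gr) \<subseteq> proj_points gr"
    using openin_proj_iff openin_topspace by blast
  have "basic_open 1 = proj_points gr" using point_one by auto
  then show "proj_points gr \<subseteq> topspace (proj_top gr)"
    using openin_basic_open[OF gr_one] openin_subset by metis
qed

lemma open_points: "openin (proj_top gr) U \<Longrightarrow> P \<in> U \<Longrightarrow> P \<in> proj_points gr"
  using openin_proj_iff by blast

lemma not_point_nonzero: "P \<in> proj_points gr \<Longrightarrow> x \<notin> P \<Longrightarrow> x \<noteq> 0"
  using point_zero by blast

lemma twist_sectionsE:
  assumes "s \<in> twist_sections gr n U" "P \<in> U"
  obtains V d a b where "openin (proj_top gr) V" "P \<in> V" "V \<subseteq> U" "a \<in> gr (d + n)" "b \<in> gr d"
    "\<And>Q. Q \<in> V \<Longrightarrow> b \<notin> Q" "\<And>Q. Q \<in> V \<Longrightarrow> s Q = Fract a b"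
proof -
  have "\<exists>V d a b. openin (proj_top gr) V \<and> P \<in> V \<and> V \<subseteq> U \<and> a \<in> gr (d + n) \<and> b \<in> gr d \<and>
        (\<forall>Q\<in>V. b \<notin> Q \<and> s Q = Fract a b)"
    using assms by (simp add: twist_sections_def)
  then show thesis by (elim exE conjE) (rule that, assumption+, simp_all)
qed

text \<open>This asks for less than the definition: \<open>b\<close> has to avoid \<open>P\<close>
  alone, and the equation is needed only where \<open>b\<close> does not vanish. Shrinking to
  \<open>U \<inter> V \<inter> basic_open b\<close> recovers the rest.\<close>

lemma twist_sectionsI:
  assumes U: "openin (proj_top gr) U" and "s \<in> extensional U"
    and loc: "\<And>P. P \<in> U \<Longrightarrow> \<exists>V d a b. openin (proj_top gr) V \<and> P \<in> V \<and> a \<in> gr (d + n) \<and> b \<in> gr d \<and>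
      b \<notin> P \<and> (\<forall>Q\<in>U \<inter> V. b \<notin> Q \<longrightarrow> s Q = Fract a b)"
  shows "s \<in> twist_sections gr n U"
proof -
  have "\<exists>V d a b. openin (proj_top gr) V \<and> P \<in> V \<and> V \<subseteq> U \<and> a \<in> gr (d + n) \<and> b \<in> gr d \<and>
        (\<forall>Q\<in>V. b \<notin> Q \<and> s Q = Fract a b)" if P: "P \<in> U" for P
  proof -
    obtain V d a b where V: "openin (proj_top gr) V" "P \<in> V" "a \<in> gr (d + n)" "b \<in> gr d"
      "b \<notin> P" "\<forall>Q\<in>U \<inter> V. b \<notin> Q \<longrightarrow> s Q = Fract a b"
      using loc[OF P] by (elim exE conjE) (rule that)
    have "openin (proj_top gr) (U \<inter> V \<inter> basic_open b)"
      using U V openin_basic_open by (intro openin_Int) auto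
    then show ?thesis
      using V P open_points[OF U P]
      by (intro exI[of _ "U \<inter> V \<inter> basic_open b"] exI[of _ d] exI[of _ a] exI[of _ b]) auto
  qed
  then show ?thesis using assms(2) by (simp add: twist_sections_def)
qed

lemma twist_sections_extensional: "s \<in> twist_sections gr n U \<Longrightarrow> s \<in> extensional U"
  by (simp add: twist_sections_def)

lemma twist_sections_fraction:
  assumes "openin (proj_top gr) U" "a \<in> gr (d + n)" "b \<in> gr d" "\<And>P. P \<in> U \<Longrightarrow> b \<notin> P"
  shows "(\<lambda>P\<in>U. Fract a b) \<in> twist_sections gr n U"
proof (rule twist_sectionsI[OF assms(1)])
  fix P assume "P \<in> U"
  then show "\<exists>V d' a' b'. openin (proj_top gr) V \<and> P \<in> V \<and> a' \<in> gr (d' + n) \<and> b' \<in> gr d' \<and>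
      b' \<notin> P \<and> (\<forall>Q\<in>U \<inter> V. b' \<notin> Q \<longrightarrow> (\<lambda>P\<in>U. Fract a b) Q = Fract a' b')"
    using assms by (intro exI[of _ U] exI[of _ d] exI[of _ a] exI[of _ b]) auto
qed simp

lemma twist_sections_const:
  assumes "openin (proj_top gr) U" "a \<in> gr n"
  shows "(\<lambda>P\<in>U. Fract a 1) \<in> twist_sections gr n U"
  using assms open_points[OF assms(1)]
  by (intro twist_sections_fraction[where d = 0]) (auto simp: point_one)

lemma twist_sections_restrict:
  assumes W: "openin (proj_top gr) W" and "W \<subseteq> U" and s: "s \<in> twist_sections gr n U"
  shows "restrict s W \<in> twist_sections gr n W"
proof (rule twist_sectionsI[OF W])
  fix P assume P: "P \<in> W"
  have PU: "P \<in> U" using P assms(2) by blast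
  obtain V d a b where V: "openin (proj_top gr) V" "P \<in> V" "V \<subseteq> U" "a \<in> gr (d + n)" "b \<in> gr d"
    "\<And>Q. Q \<in> V \<Longrightarrow> b \<notin> Q" "\<And>Q. Q \<in> V \<Longrightarrow> s Q = Fract a b"
    by (rule twist_sectionsE[OF s PU], rule that, assumption+)
  then show "\<exists>V d a b. openin (proj_top gr) V \<and> P \<in> V \<and> a \<in> gr (d + n) \<and> b \<in> gr d \<and>
      b \<notin> P \<and> (\<forall>Q\<in>W \<inter> V. b \<notin> Q \<longrightarrow> restrict s W Q = Fract a b)"
    by (intro exI[of _ V] exI[of _ d] exI[of _ a] exI[of _ b]) auto
qed simp

lemma twist_sections_mult:
  assumes U: "openin (proj_top gr) U"
    and s: "s \<in> twist_sections gr m U" and t: "t \<in> twist_sections gr n U"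
  shows "(\<lambda>P\<in>U. s P * t P) \<in> twist_sections gr (m + n) U"
proof (rule twist_sectionsI[OF U])
  fix P assume P: "P \<in> U"
  obtain V d a b where V: "openin (proj_top gr) V" "P \<in> V" "V \<subseteq> U" "a \<in> gr (d + m)" "b \<in> gr d"
    "\<And>Q. Q \<in> V \<Longrightarrow> b \<notin> Q" "\<And>Q. Q \<in> V \<Longrightarrow> s Q = Fract a b"
    by (rule twist_sectionsE[OF s P], rule that, assumption+)
  obtain V' d' a' b' where V': "openin (proj_top gr) V'" "P \<in> V'" "V' \<subseteq> U" "a' \<in> gr (d' + n)" "b' \<in> gr d'"
    "\<And>Q. Q \<in> V' \<Longrightarrow> b' \<notin> Q" "\<And>Q. Q \<in> V' \<Longrightarrow> t Q = Fract a' b'"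
    by (rule twist_sectionsE[OF t P], rule that, assumption+)
  have "a * a' \<in> gr ((d + d') + (m + n))" using gr_mult[OF V(4) V'(4)] by (simp add: ac_simps)
  moreover have "b * b' \<in> gr (d + d')" using gr_mult[OF V(5) V'(5)] by (simp add: ac_simps)
  moreover have "b * b' \<notin> P" using point_mult_iff[OF open_points[OF U P] V(5) V'(5)] V V' by blast
  ultimately show "\<exists>V d a b. openin (proj_top gr) V \<and> P \<in> V \<and> a \<in> gr (d + (m + n)) \<and> b \<in> gr d \<and>
      b \<notin> P \<and> (\<forall>Q\<in>U \<inter> V. b \<notin> Q \<longrightarrow> (\<lambda>P\<in>U. s P * t P) Q = Fract a b)"
    using V V' by (intro exI[of _ "V \<inter> V'"] exI[of _ "d + d'"] exI[of _ "a * a'"] exI[of _ "b * b'"]) auto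
qed simp

text \<open>For \<open>z\<close> in the degree \<open>n\<close> part of the localization at \<open>P\<close>: multiplication by \<open>z\<close> is invertible.\<close>

definition nonvanishing :: "nat \<Rightarrow> 'r fract \<Rightarrow> 'r set \<Rightarrow> bool" where
  "nonvanishing n z P \<longleftrightarrow> (\<exists>d. \<exists>a\<in>gr (d + n). \<exists>b\<in>gr d. a \<notin> P \<and> b \<notin> P \<and> z = Fract a b)"

text \<open>Two fractions for the same element satisfy \<open>a * b' = a' * b\<close>, and primality
  of \<open>P\<close> carries nonmembership from one numerator to the other.\<close>

lemma nonvanishing_fraction_iff:
  assumes P: "P \<in> proj_points gr" and ab: "a \<in> gr (d + n)" "b \<in> gr d" "b \<notin> P"
  shows "nonvanishing n (Fract a b) P \<longleftrightarrow> a \<notin> P"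
proof
  assume "nonvanishing n (Fract a b) P"
  then obtain e a' b' where *: "a' \<in> gr (e + n)" "b' \<in> gr e" "a' \<notin> P" "b' \<notin> P" "Fract a b = Fract a' b'"
    unfolding nonvanishing_def by blast
  then have "a * b' = a' * b"
    using ab not_point_nonzero[OF P] by (simp add: eq_fract)
  then have "a * b' \<notin> P"
    using point_mult_iff[OF P *(1) ab(2)] * ab by simp
  then show "a \<notin> P" using point_mult_iff[OF P ab(1) *(2)] by blast
qed (use ab in \<open>auto simp: nonvanishing_def\<close>)

lemma nonvanishing_nonzero:
  assumes P: "P \<in> proj_points gr" and "nonvanishing n z P"
  shows "z \<noteq> 0"
proof -
  obtain d a b where *: "a \<notin> P" "b \<notin> P" "z = Fract a b"
    using assms(2) unfolding nonvanishing_def by blast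
  then have "a \<noteq> 0" "b \<noteq> 0" using not_point_nonzero[OF P] by auto
  then show ?thesis using *(3) by (simp add: Zero_fract_def eq_fract)
qed

lemma twist_sections_divide:
  assumes U: "openin (proj_top gr) U"
    and s: "s \<in> twist_sections gr (n + k) U" and t: "t \<in> twist_sections gr n U"
    and nv: "\<And>P. P \<in> U \<Longrightarrow> nonvanishing n (t P) P"
  shows "(\<lambda>P\<in>U. s P / t P) \<in> twist_sections gr k U"
proof (rule twist_sectionsI[OF U])
  fix P assume P: "P \<in> U"
  note P' = open_points[OF U P]
  obtain V d a b where V: "openin (proj_top gr) V" "P \<in> V" "V \<subseteq> U" "a \<in> gr (d + (n + k))" "b \<in> gr d"
    "\<And>Q. Q \<in> V \<Longrightarrow> b \<notin> Q" "\<And>Q. Q \<in> V \<Longrightarrow> s Q = Fract a b"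
    by (rule twist_sectionsE[OF s P], rule that, assumption+)
  obtain V' d' a' b' where V': "openin (proj_top gr) V'" "P \<in> V'" "V' \<subseteq> U" "a' \<in> gr (d' + n)" "b' \<in> gr d'"
    "\<And>Q. Q \<in> V' \<Longrightarrow> b' \<notin> Q" "\<And>Q. Q \<in> V' \<Longrightarrow> t Q = Fract a' b'"
    by (rule twist_sectionsE[OF t P], rule that, assumption+)
  have "a * b' \<in> gr ((d + d' + n) + k)" using gr_mult[OF V(4) V'(5)] by (simp add: ac_simps)
  moreover have "b * a' \<in> gr (d + d' + n)" using gr_mult[OF V(5) V'(4)] by (simp add: ac_simps)
  moreover have "a' \<notin> P"
    using nv[OF P] nonvanishing_fraction_iff[OF P' V'(4,5)] V' by simp
  then have "b * a' \<notin> P" using point_mult_iff[OF P' V(5) V'(4)] V by blast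
  ultimately show "\<exists>V d a b. openin (proj_top gr) V \<and> P \<in> V \<and> a \<in> gr (d + k) \<and> b \<in> gr d \<and>
      b \<notin> P \<and> (\<forall>Q\<in>U \<inter> V. b \<notin> Q \<longrightarrow> (\<lambda>P\<in>U. s P / t P) Q = Fract a b)"
    using V V'
    by (intro exI[of _ "V \<inter> V'"] exI[of _ "d + d' + n"] exI[of _ "a * b'"] exI[of _ "b * a'"]) auto
qed simp

lemma nonvanishing_nbhd:
  assumes U: "openin (proj_top gr) U" and s: "s \<in> twist_sections gr n U" and P: "P \<in> U"
    and nv: "nonvanishing n (s P) P"
  obtains V where "openin (proj_top gr) V" "P \<in> V" "V \<subseteq> U" "\<And>Q. Q \<in> V \<Longrightarrow> nonvanishing n (s Q) Q"
proof -
  obtain V d a b where V: "openin (proj_top gr) V" "P \<in> V" "V \<subseteq> U" "a \<in> gr (d + n)" "b \<in> gr d"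
    "\<And>Q. Q \<in> V \<Longrightarrow> b \<notin> Q" "\<And>Q. Q \<in> V \<Longrightarrow> s Q = Fract a b"
    by (rule twist_sectionsE[OF s P], rule that, assumption+)
  have "a \<notin> P" using nv nonvanishing_fraction_iff[OF open_points[OF U P] V(4,5)] V by simp
  then have "P \<in> V \<inter> basic_open a" using V(2) open_points[OF U P] by simp
  moreover have "openin (proj_top gr) (V \<inter> basic_open a)"
    using V(1,4) openin_basic_open by blast
  moreover have "nonvanishing n (s Q) Q" if "Q \<in> V \<inter> basic_open a" for Q
    using that V nonvanishing_fraction_iff[of Q a d n b] by simp
  ultimately show thesis using that V(3) by blast
qed

lemma Proj_simps [simp]:
  "top_of (Proj \<iota> gr) = proj_top gr"
  "carrier (ring_of (Proj \<iota> gr) U) = twist_sections gr 0 U"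
  "s \<otimes>\<^bsub>ring_of (Proj \<iota> gr) U\<^esub> t = (\<lambda>P\<in>U. s P * t P)"
  "s \<oplus>\<^bsub>ring_of (Proj \<iota> gr) U\<^esub> t = (\<lambda>P\<in>U. s P + t P)"
  "\<one>\<^bsub>ring_of (Proj \<iota> gr) U\<^esub> = (\<lambda>P\<in>U. 1)"
  "res (Proj \<iota> gr) V s = restrict s V"
  "scal (Proj \<iota> gr) U c = (\<lambda>P\<in>U. Fract (\<iota> c) 1)"
  by (simp_all add: Proj_def)

lemma twisting_sheaf_simps [simp]:
  "carrier (mod_of (twisting_sheaf gr n) U) = twist_sections gr n U"
  "s \<oplus>\<^bsub>mod_of (twisting_sheaf gr n) U\<^esub> t = (\<lambda>P\<in>U. s P + t P)"
  "t \<odot>\<^bsub>mod_of (twisting_sheaf gr n) U\<^esub> s = (\<lambda>P\<in>U. t P * s P)"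
  "mres (twisting_sheaf gr n) V s = restrict s V"
  by (simp_all add: twisting_sheaf_def)

lemma Units_Proj_iff:
  assumes U: "openin (proj_top gr) U" and s: "s \<in> twist_sections gr 0 U"
  shows "s \<in> Units (ring_of (Proj \<iota> gr) U) \<longleftrightarrow> (\<forall>P\<in>U. nonvanishing 0 (s P) P)"
proof
  assume "s \<in> Units (ring_of (Proj \<iota> gr) U)"
  then obtain t where t: "t \<in> twist_sections gr 0 U" "(\<lambda>P\<in>U. t P * s P) = (\<lambda>P\<in>U. 1)"
    unfolding Units_def by auto
  show "\<forall>P\<in>U. nonvanishing 0 (s P) P"
  proof
    fix P assume P: "P \<in> U"
    note P' = open_points[OF U P]
    obtain V d a b where V: "openin (proj_top gr) V" "P \<in> V" "V \<subseteq> U" "a \<in> gr (d + 0)" "b \<in> gr d"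
      "\<And>Q. Q \<in> V \<Longrightarrow> b \<notin> Q" "\<And>Q. Q \<in> V \<Longrightarrow> s Q = Fract a b"
      by (rule twist_sectionsE[OF s P], rule that, assumption+)
    obtain V' d' a' b' where V': "openin (proj_top gr) V'" "P \<in> V'" "V' \<subseteq> U" "a' \<in> gr (d' + 0)" "b' \<in> gr d'"
      "\<And>Q. Q \<in> V' \<Longrightarrow> b' \<notin> Q" "\<And>Q. Q \<in> V' \<Longrightarrow> t Q = Fract a' b'"
      by (rule twist_sectionsE[OF t(1) P], rule that, assumption+)
    have "t P * s P = 1" using fun_cong[OF t(2), of P] P by simp
    then have "Fract (a' * a) (b' * b) = Fract 1 1" using V V' by (simp add: One_fract_def)
    moreover have "b' * b \<notin> P" using point_mult_iff[OF P' V'(5) V(5)] V V' by blast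
    ultimately have "a' * a \<notin> P" using not_point_nonzero[OF P', of "b' * b"] by (simp add: eq_fract)
    then have "a \<notin> P" using point_mult_iff[OF P' V'(4) V(4)] by blast
    then show "nonvanishing 0 (s P) P"
      using V nonvanishing_fraction_iff[OF P' V(4,5)] by simp
  qed
next
  assume nv: "\<forall>P\<in>U. nonvanishing 0 (s P) P"
  have 1: "(\<lambda>P\<in>U. 1) \<in> twist_sections gr 0 U"
    using twist_sections_const[OF U gr_one] by (simp add: One_fract_def)
  define t where "t = (\<lambda>P\<in>U. (\<lambda>P\<in>U. 1) P / s P)"
  have t: "t \<in> twist_sections gr 0 U"
    using twist_sections_divide[of U "\<lambda>P\<in>U. 1" 0 0 s] 1 s nv U by (simp add: t_def)
  have "t P * s P = 1" if "P \<in> U" for P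
    using that nv nonvanishing_nonzero[OF open_points[OF U that]] by (auto simp: t_def)
  then have "(\<lambda>P\<in>U. t P * s P) = (\<lambda>P\<in>U. 1)" "(\<lambda>P\<in>U. s P * t P) = (\<lambda>P\<in>U. 1)"
    by (auto simp: fun_eq_iff restrict_def mult.commute)
  then show "s \<in> Units (ring_of (Proj \<iota> gr) U)"
    unfolding Units_def using s t by auto
qed

lemma unit_at_Proj_iff:
  assumes U: "openin (proj_top gr) U" and s: "s \<in> twist_sections gr 0 U" and P: "P \<in> U"
  shows "unit_at (Proj \<iota> gr) U s P \<longleftrightarrow> nonvanishing 0 (s P) P"
proof
  assume "unit_at (Proj \<iota> gr) U s P"
  then obtain V where V: "openin (proj_top gr) V" "P \<in> V" "V \<subseteq> U"
    "restrict s V \<in> Units (ring_of (Proj \<iota> gr) V)"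
    unfolding unit_at_def by auto
  then show "nonvanishing 0 (s P) P"
    using Units_Proj_iff[OF V(1) twist_sections_restrict[OF V(1,3) s]] by force
next
  assume "nonvanishing 0 (s P) P"
  then obtain V where V: "openin (proj_top gr) V" "P \<in> V" "V \<subseteq> U"
    "\<And>Q. Q \<in> V \<Longrightarrow> nonvanishing 0 (s Q) Q"
    using nonvanishing_nbhd[OF U s P] by blast
  then have "restrict s V \<in> Units (ring_of (Proj \<iota> gr) V)"
    using Units_Proj_iff[OF V(1) twist_sections_restrict[OF V(1,3) s]] by force
  then show "unit_at (Proj \<iota> gr) U s P"
    unfolding unit_at_def using V by auto
qed

text \<open>Division by \<open>e\<close> inverts multiplication by \<open>e\<close>, and
  \<open>twist_sections_divide\<close> keeps it inside the sheaf.\<close>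

lemma frame_twisting_sheafI:
  assumes U: "openin (proj_top gr) U" and e: "e \<in> twist_sections gr n U"
    and nv: "\<And>P. P \<in> U \<Longrightarrow> nonvanishing n (e P) P"
  shows "frame (Proj \<iota> gr) (twisting_sheaf gr n) U e"
  unfolding frame_def
proof (intro conjI allI impI)
  fix W assume "openin (top_of (Proj \<iota> gr)) W" and WU: "W \<subseteq> U"
  then have W: "openin (proj_top gr) W" by simp
  have eW: "restrict e W \<in> twist_sections gr n W" by (rule twist_sections_restrict[OF W WU e])
  have nz: "e P \<noteq> 0" if "P \<in> W" for P
    using nv[of P] nonvanishing_nonzero[OF open_points[OF W that]] that WU by blast
  show "bij_betw (\<lambda>t. t \<odot>\<^bsub>mod_of (twisting_sheaf gr n) W\<^esub> mres (twisting_sheaf gr n) W e)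
          (carrier (ring_of (Proj \<iota> gr) W)) (carrier (mod_of (twisting_sheaf gr n) W))"
  proof (rule bij_betw_byWitness[where f' = "\<lambda>s. \<lambda>P\<in>W. s P / e P"])
    show "\<forall>t\<in>carrier (ring_of (Proj \<iota> gr) W).
      (\<lambda>P\<in>W. (t \<odot>\<^bsub>mod_of (twisting_sheaf gr n) W\<^esub> mres (twisting_sheaf gr n) W e) P / e P) = t"
      using nz by (auto simp: fun_eq_iff restrict_def dest!: twist_sections_extensional extensional_arb)
    show "\<forall>s\<in>carrier (mod_of (twisting_sheaf gr n) W).
      (\<lambda>P\<in>W. s P / e P) \<odot>\<^bsub>mod_of (twisting_sheaf gr n) W\<^esub> mres (twisting_sheaf gr n) W e = s"
      using nz by (auto simp: fun_eq_iff restrict_def dest!: twist_sections_extensional extensional_arb)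
    show "(\<lambda>t. t \<odot>\<^bsub>mod_of (twisting_sheaf gr n) W\<^esub> mres (twisting_sheaf gr n) W e) `
      carrier (ring_of (Proj \<iota> gr) W) \<subseteq> carrier (mod_of (twisting_sheaf gr n) W)"
      using twist_sections_mult[OF W _ eW, of _ 0] by auto
    have "(\<lambda>P\<in>W. s P / e P) \<in> twist_sections gr 0 W" if s: "s \<in> twist_sections gr n W" for s
    proof -
      have "(\<lambda>P\<in>W. s P / restrict e W P) \<in> twist_sections gr 0 W"
        using s nv WU by (intro twist_sections_divide[OF W _ eW]) auto
      moreover have "(\<lambda>P\<in>W. s P / restrict e W P) = (\<lambda>P\<in>W. s P / e P)" by (auto simp: restrict_def)
      ultimately show ?thesis by simp
    qed
    then show "(\<lambda>s. \<lambda>P\<in>W. s P / e P) ` carrier (mod_of (twisting_sheaf gr n) W) \<subseteq>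
      carrier (ring_of (Proj \<iota> gr) W)" by auto
  qed
qed (use e in simp)

text \<open>A free generator divides every section over \<open>U\<close>, in particular
  \<open>y / 1\<close>. The latter does not vanish at \<open>P\<close>, so neither does
  \<open>e\<close>.\<close>

lemma frame_twisting_sheafD:
  assumes fr: "frame (Proj \<iota> gr) (twisting_sheaf gr n) U e"
    and U: "openin (proj_top gr) U" and P: "P \<in> U" and y: "y \<in> gr n" "y \<notin> P"
  shows "e \<in> twist_sections gr n U" "nonvanishing n (e P) P"
proof -
  note P' = open_points[OF U P]
  show e: "e \<in> twist_sections gr n U" using fr unfolding frame_def by simp
  have "bij_betw (\<lambda>t. \<lambda>P\<in>U. t P * restrict e U P) (twist_sections gr 0 U) (twist_sections gr n U)"
    using fr U unfolding frame_def by simp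
  then obtain t where t: "t \<in> twist_sections gr 0 U" "(\<lambda>P\<in>U. Fract y 1) = (\<lambda>P\<in>U. t P * restrict e U P)"
    using twist_sections_const[OF U y(1)] unfolding bij_betw_def by blast
  obtain V d a b where V: "openin (proj_top gr) V" "P \<in> V" "V \<subseteq> U" "a \<in> gr (d + n)" "b \<in> gr d"
    "\<And>Q. Q \<in> V \<Longrightarrow> b \<notin> Q" "\<And>Q. Q \<in> V \<Longrightarrow> e Q = Fract a b"
    by (rule twist_sectionsE[OF e P], rule that, assumption+)
  obtain V' d' a' b' where V': "openin (proj_top gr) V'" "P \<in> V'" "V' \<subseteq> U" "a' \<in> gr (d' + 0)" "b' \<in> gr d'"
    "\<And>Q. Q \<in> V' \<Longrightarrow> b' \<notin> Q" "\<And>Q. Q \<in> V' \<Longrightarrow> t Q = Fract a' b'"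
    by (rule twist_sectionsE[OF t(1) P], rule that, assumption+)
  have "Fract y 1 = Fract (a' * a) (b' * b)" using fun_cong[OF t(2), of P] V V' P by simp
  moreover have bb: "b' * b \<notin> P" using point_mult_iff[OF P' V'(5) V(5)] V V' by blast
  ultimately have "y * (b' * b) = a' * a" using not_point_nonzero[OF P' bb] by (simp add: eq_fract)
  then have "a' * a \<notin> P" using point_mult_iff[OF P' y(1) gr_mult[OF V'(5) V(5)]] bb y by simp
  then have "a \<notin> P" using point_mult_iff[OF P' V'(4) V(4)] by blast
  then show "nonvanishing n (e P) P" using V nonvanishing_fraction_iff[OF P' V(4,5)] by simp
qed

lemma line_bundle_twisting_sheaf:
  assumes "\<And>P. P \<in> proj_points gr \<Longrightarrow> \<exists>y\<in>gr n. y \<notin> P"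
  shows "line_bundle (Proj \<iota> gr) (twisting_sheaf gr n)"
  unfolding line_bundle_def
proof
  fix P assume "P \<in> topspace (top_of (Proj \<iota> gr))"
  then obtain y where y: "P \<in> proj_points gr" "y \<in> gr n" "y \<notin> P" using assms by auto
  have "frame (Proj \<iota> gr) (twisting_sheaf gr n) (basic_open y) (\<lambda>P\<in>basic_open y. Fract y 1)"
  proof (rule frame_twisting_sheafI[OF openin_basic_open[OF y(2)]])
    show "nonvanishing n ((\<lambda>P\<in>basic_open y. Fract y 1) Q) Q" if "Q \<in> basic_open y" for Q
      using nonvanishing_fraction_iff[of Q y 0 n 1] that y(2) point_one[of Q] by simp
  qed (rule twist_sections_const[OF openin_basic_open[OF y(2)] y(2)])
  then show "\<exists>U e. openin (top_of (Proj \<iota> gr)) U \<and> P \<in> U \<and> frame (Proj \<iota> gr) (twisting_sheaf gr n) U e"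
    using y openin_basic_open[OF y(2)] by (intro exI[of _ "basic_open y"]) auto
qed

end

section \<open>Existence of homogeneous primes and global sections\<close>

context graded_domain
begin

text \<open>In a domain the zero ideal is a point, the generic one, and it lies in every nonempty
  open set. Each local fraction of \<open>s\<close> therefore takes the value that \<open>s\<close>
  has there. This makes a section over an open set a single element of the fraction field.\<close>

lemma twist_sections_constant:
  assumes U: "openin (proj_top gr) U" and s: "s \<in> twist_sections gr n U" and P: "P \<in> U" and Q: "Q \<in> U"
  shows "s P = s Q"
proof -
  let ?J = "\<lambda>d::nat. {0::'r}"
  obtain d x where dx: "d \<ge> 1" "x \<in> gr d" "x \<notin> P"
    using hprime_nontrivial[OF hprime_point[OF open_points[OF U P]]] by blast
  have J: "hprime ?J"
    by (rule hprimeI[of ?J d x]) (use dx not_point_nonzero[OF open_points[OF U P]] in auto)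
  have gen: "hspan ?J \<in> V" if "openin (proj_top gr) V" "R \<in> V" for V R
  proof -
    obtain e y where y: "y \<in> gr e" "y \<notin> R" "basic_open y \<subseteq> V" "R \<in> proj_points gr"
      using \<open>openin (proj_top gr) V\<close> \<open>R \<in> V\<close> unfolding openin_proj_iff by (meson subsetD)
    then have "y \<notin> hspan ?J" using hspan_hprime_homogeneous[OF J y(1)] not_point_nonzero by auto
    then show ?thesis using y(3) hspan_hprime_proj_points[OF J] by auto
  qed
  have "s R = s (hspan ?J)" if R: "R \<in> U" for R
  proof -
    obtain V d a b where V: "openin (proj_top gr) V" "R \<in> V" "V \<subseteq> U" "a \<in> gr (d + n)" "b \<in> gr d"
      "\<And>Q. Q \<in> V \<Longrightarrow> b \<notin> Q" "\<And>Q. Q \<in> V \<Longrightarrow> s Q = Fract a b"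
      by (rule twist_sectionsE[OF s R], rule that, assumption+)
    then show ?thesis using V(7)[OF gen[OF V(1,2)]] V(7)[OF V(2)] by simp
  qed
  then show ?thesis using P Q by simp
qed

text \<open>Zorn's lemma is applied to homogeneous ideals encoded as sets of pairs of a degree and an element.\<close>

definition hideal :: "(nat \<times> 'r) set \<Rightarrow> bool" where
  "hideal M \<longleftrightarrow>
     (\<forall>d x. (d, x) \<in> M \<longrightarrow> x \<in> gr d) \<and> (\<forall>d. (d, 0) \<in> M) \<and>
     (\<forall>d x y. (d, x) \<in> M \<longrightarrow> (d, y) \<in> M \<longrightarrow> (d, x + y) \<in> M) \<and>
     (\<forall>d e x y. x \<in> gr d \<longrightarrow> (e, y) \<in> M \<longrightarrow> (d + e, x * y) \<in> M)"

lemma hidealD: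
  assumes "hideal M"
  shows "(d, x) \<in> M \<Longrightarrow> x \<in> gr d" "(d, 0) \<in> M"
    "(d, x) \<in> M \<Longrightarrow> (d, y) \<in> M \<Longrightarrow> (d, x + y) \<in> M"
    "x \<in> gr d \<Longrightarrow> (e, y) \<in> M \<Longrightarrow> (d + e, x * y) \<in> M"
  using assms unfolding hideal_def by simp_all

lemma hidealI:
  assumes "\<And>d x. (d, x) \<in> M \<Longrightarrow> x \<in> gr d" "\<And>d. (d, 0) \<in> M"
    "\<And>d x y. (d, x) \<in> M \<Longrightarrow> (d, y) \<in> M \<Longrightarrow> (d, x + y) \<in> M"
    "\<And>d e x y. x \<in> gr d \<Longrightarrow> (e, y) \<in> M \<Longrightarrow> (d + e, x * y) \<in> M"
  shows "hideal M"
  using assms unfolding hideal_def by simp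

lemma hideal_Union_chain:
  assumes "subset.chain A C" "C \<noteq> {}" "\<And>M. M \<in> A \<Longrightarrow> hideal M"
  shows "hideal (\<Union>C)"
proof -
  have C: "\<And>M. M \<in> C \<Longrightarrow> hideal M" "\<And>M N. M \<in> C \<Longrightarrow> N \<in> C \<Longrightarrow> M \<subseteq> N \<or> N \<subseteq> M"
    using assms(1,3) unfolding subset_chain_def by blast+
  show ?thesis
  proof (rule hidealI)
    fix d x y assume "(d, x) \<in> \<Union>C" "(d, y) \<in> \<Union>C"
    then obtain M N where "M \<in> C" "N \<in> C" "(d, x) \<in> M" "(d, y) \<in> N" by blast
    then obtain K where "K \<in> C" "(d, x) \<in> K" "(d, y) \<in> K" using C(2)[of M N] by blast
    then show "(d, x + y) \<in> \<Union>C" using hidealD(3)[OF C(1)] by blast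
  next
    obtain M where "M \<in> C" using assms(2) by blast
    then show "(d, 0) \<in> \<Union>C" for d using hidealD(2)[OF C(1)] by blast
  qed (use hidealD(1,4)[OF C(1)] in blast)+
qed

text \<open>The ideal generated by \<open>M\<close> and \<open>x\<close>; the summand \<open>r * x\<close> with \<open>r = 0\<close> is allowed in every degree.\<close>

definition hideal_insert :: "nat \<Rightarrow> 'r \<Rightarrow> (nat \<times> 'r) set \<Rightarrow> (nat \<times> 'r) set" where
  "hideal_insert d x M =
     {(k, j + r * x) | k j r. (k, j) \<in> M \<and> (r = 0 \<or> (\<exists>i. k = i + d \<and> r \<in> gr i))}"

lemma hideal_insertI:
  "(k, j) \<in> M \<Longrightarrow> z = j + r * x \<Longrightarrow> r = 0 \<or> (\<exists>i. k = i + d \<and> r \<in> gr i) \<Longrightarrow> (k, z) \<in> hideal_insert d x M"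
  unfolding hideal_insert_def by blast

lemma hideal_insertE:
  assumes "(k, z) \<in> hideal_insert d x M"
  obtains j r where "(k, j) \<in> M" "z = j + r * x" "r = 0 \<or> (\<exists>i. k = i + d \<and> r \<in> gr i)"
  using assms unfolding hideal_insert_def by blast

lemma hideal_insert:
  assumes M: "hideal M" and x: "x \<in> gr d"
  shows "hideal (hideal_insert d x M)" "M \<subseteq> hideal_insert d x M" "(d, x) \<in> hideal_insert d x M"
proof -
  show "M \<subseteq> hideal_insert d x M"
    using hideal_insertI[of _ _ M _ 0 x d] by auto
  show "(d, x) \<in> hideal_insert d x M"
    using hideal_insertI[of d 0 M x 1 x d] hidealD(2)[OF M] by simp
  show "hideal (hideal_insert d x M)"
  proof (rule hidealI)
    fix k y assume "(k, y) \<in> hideal_insert d x M"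
    then show "y \<in> gr k"
      unfolding hideal_insert_def using hidealD(1)[OF M] x by (auto intro!: gr_add gr_mult)
  next
    show "(k, 0) \<in> hideal_insert d x M" for k
      using \<open>M \<subseteq> hideal_insert d x M\<close> hidealD(2)[OF M] by blast
  next
    fix k y z assume yz: "(k, y) \<in> hideal_insert d x M" "(k, z) \<in> hideal_insert d x M"
    obtain j r where *: "(k, j) \<in> M" "y = j + r * x" "r = 0 \<or> (\<exists>i. k = i + d \<and> r \<in> gr i)"
      by (rule hideal_insertE[OF yz(1)])
    obtain j' r' where **: "(k, j') \<in> M" "z = j' + r' * x" "r' = 0 \<or> (\<exists>i. k = i + d \<and> r' \<in> gr i)"
      by (rule hideal_insertE[OF yz(2)])
    have "y + z = (j + j') + (r + r') * x" using * ** by (simp add: algebra_simps)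
    moreover have "(k, j + j') \<in> M" using hidealD(3)[OF M] * ** by blast
    moreover have "r + r' = 0 \<or> (\<exists>i. k = i + d \<and> r + r' \<in> gr i)" using *(3) **(3) gr_add by auto
    ultimately show "(k, y + z) \<in> hideal_insert d x M" by (intro hideal_insertI)
  next
    fix k e y z assume y: "y \<in> gr k" and z: "(e, z) \<in> hideal_insert d x M"
    obtain j r where *: "(e, j) \<in> M" "z = j + r * x" "r = 0 \<or> (\<exists>i. e = i + d \<and> r \<in> gr i)"
      by (rule hideal_insertE[OF z])
    have "y * z = y * j + (y * r) * x" using * by (simp add: algebra_simps)
    moreover have "(k + e, y * j) \<in> M" using hidealD(4)[OF M y] * by blast
    moreover have "y * r = 0 \<or> (\<exists>i. k + e = i + d \<and> y * r \<in> gr i)"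
      using *(3) gr_mult[OF y] by (metis add.assoc mult_zero_right)
    ultimately show "(k + e, y * z) \<in> hideal_insert d x M" by (intro hideal_insertI)
  qed
qed

text \<open>An ideal maximal among those that contain \<open>I\<close> and no power of
  \<open>f\<close> is prime. It is a point because \<open>f\<close> has positive degree and lies
  outside it.\<close>

lemma point_avoiding_powers:
  assumes I: "hideal I" and f: "f \<in> gr e" "e \<ge> 1" and If: "\<And>n. (n * e, f ^ n) \<notin> I"
  obtains P where "P \<in> proj_points gr" "f \<notin> P" "\<And>d x. (d, x) \<in> I \<Longrightarrow> x \<in> P"
proof -
  define A where "A = {M. hideal M \<and> I \<subseteq> M \<and> (\<forall>n. (n * e, f ^ n) \<notin> M)}"
  have "\<exists>M\<in>A. \<forall>X\<in>A. M \<subseteq> X \<longrightarrow> X = M"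
  proof (rule subset_Zorn_nonempty)
    show "A \<noteq> {}" unfolding A_def using I If by blast
    fix C assume C: "C \<noteq> {}" "subset.chain A C"
    then have "hideal (\<Union>C)" using hideal_Union_chain[OF C(2,1)] by (simp add: A_def)
    moreover have "C \<subseteq> A" using C(2) unfolding subset_chain_def by blast
    ultimately show "\<Union>C \<in> A" using C(1) unfolding A_def by blast
  qed
  then obtain M where MA: "M \<in> A" and max: "\<And>X. X \<in> A \<Longrightarrow> M \<subseteq> X \<Longrightarrow> X = M" by blast
  then have M: "hideal M" "I \<subseteq> M" "\<And>n. (n * e, f ^ n) \<notin> M" unfolding A_def by auto
  have power: "\<exists>n j r i. (n * e, j) \<in> M \<and> f ^ n = j + r * x \<and> n * e = i + d \<and> r \<in> gr i"
    if x: "x \<in> gr d" "(d, x) \<notin> M" for d x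
  proof -
    have "hideal_insert d x M \<notin> A"
      using max[of "hideal_insert d x M"] hideal_insert(2,3)[OF M(1) x(1)] x(2) by blast
    then obtain n where "(n * e, f ^ n) \<in> hideal_insert d x M"
      unfolding A_def using hideal_insert[OF M(1) x(1)] M(2) by blast
    then obtain j r where jr: "(n * e, j) \<in> M" "f ^ n = j + r * x" "r = 0 \<or> (\<exists>i. n * e = i + d \<and> r \<in> gr i)"
      by (rule hideal_insertE)
    have "r \<noteq> 0"
    proof
      assume "r = 0"
      then have "f ^ n = j" using jr(2) by simp
      then show False using jr(1) M(3)[of n] by simp
    qed
    then show ?thesis using jr by blast
  qed
  have J: "hprime (\<lambda>d. {x. (d, x) \<in> M})"
  proof (rule hprimeI[of _ e f])
    show "f \<notin> {x. (e, x) \<in> M}" using M(3)[of 1] by simp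
    fix d d' x y assume xy: "x \<in> gr d" "y \<in> gr d'" "x * y \<in> {x. (d + d', x) \<in> M}" "x \<notin> {x. (d, x) \<in> M}"
    show "y \<in> {x. (d', x) \<in> M}"
    proof (rule ccontr)
      assume y: "y \<notin> {x. (d', x) \<in> M}"
      obtain n j r i where 1: "(n * e, j) \<in> M" "f ^ n = j + r * x" "n * e = i + d" "r \<in> gr i"
        using power[OF xy(1)] xy(4) by auto
      obtain n' j' r' i' where 2: "(n' * e, j') \<in> M" "f ^ n' = j' + r' * y" "n' * e = i' + d'" "r' \<in> gr i'"
        using power[OF xy(2)] y by auto
      \<comment> \<open>Each summand has a factor \<open>j\<close>, \<open>j'\<close> or
        \<open>x * y\<close> from \<open>M\<close>, so a power of \<open>f\<close> would lie in
        \<open>M\<close>.\<close>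
      have "f ^ (n + n') = f ^ n' * j + r * x * j' + r * r' * (x * y)"
        unfolding power_add 1(2) 2(2) by (simp add: algebra_simps)
      moreover have "(n' * e + n * e, f ^ n' * j) \<in> M"
        using hidealD(4)[OF M(1) gr_power[OF f(1)] 1(1)] .
      moreover have "(i + d + n' * e, r * x * j') \<in> M"
        using hidealD(4)[OF M(1) gr_mult[OF 1(4) xy(1)] 2(1)] .
      moreover have "(i + i' + (d + d'), r * r' * (x * y)) \<in> M"
        using hidealD(4)[OF M(1) gr_mult[OF 1(4) 2(4)]] xy(3) by simp
      moreover have "n' * e + n * e = (n + n') * e" "i + d + n' * e = (n + n') * e"
        "i + i' + (d + d') = (n + n') * e"
        using 1(3) 2(3) by (simp_all add: algebra_simps)
      ultimately have "((n + n') * e, f ^ (n + n')) \<in> M"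
        using hidealD(3)[OF M(1)] by metis
      then show False using M(3) by blast
    qed
  qed (use hidealD[OF M(1)] f in auto)
  show thesis
  proof (rule that)
    show "hspan (\<lambda>d. {x. (d, x) \<in> M}) \<in> proj_points gr" by (rule hspan_hprime_proj_points[OF J])
    show "f \<notin> hspan (\<lambda>d. {x. (d, x) \<in> M})"
      using hspan_hprime_homogeneous[OF J f(1)] M(3)[of 1] by simp
    show "x \<in> hspan (\<lambda>d. {x. (d, x) \<in> M})" if "(d, x) \<in> I" for d x
      using hspan_hprime_homogeneous[OF J, of x d] that M(2) hidealD(1)[OF M(1)] by auto
  qed
qed

text \<open>The denominators of \<open>s\<close> form a homogeneous ideal. If it contained no power
  of \<open>f\<close>, some point would contain all of them, although near that point
  \<open>s\<close> is a fraction whose denominator lies outside it.\<close>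

lemma global_section_power_denominator:
  assumes s: "s \<in> twist_sections gr n (proj_points gr)" and "P \<in> proj_points gr"
    and f: "f \<in> gr e" "e \<ge> 1"
  shows "\<exists>m. \<exists>a\<in>gr (m * e + n). s P * Fract (f ^ m) 1 = Fract a 1"
proof (rule ccontr)
  assume contr: "\<not> ?thesis"
  let ?I = "{(d, b). b \<in> gr d \<and> (\<exists>a\<in>gr (d + n). s P * Fract b 1 = Fract a 1)}"
  have top: "openin (proj_top gr) (proj_points gr)" using openin_topspace[of "proj_top gr"] by simp
  have I: "hideal ?I"
  proof (rule hidealI)
    show "(d, 0) \<in> ?I" for d by (auto intro!: bexI[of _ 0] simp: Zero_fract_def[symmetric])
    fix d x y assume "(d, x) \<in> ?I" "(d, y) \<in> ?I"
    then obtain a b where "x \<in> gr d" "y \<in> gr d" "a \<in> gr (d + n)" "b \<in> gr (d + n)"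
      "s P * Fract x 1 = Fract a 1" "s P * Fract y 1 = Fract b 1" by auto
    moreover have "s P * Fract (x + y) 1 = s P * Fract x 1 + s P * Fract y 1"
      by (simp flip: distrib_left)
    ultimately show "(d, x + y) \<in> ?I" by (auto intro!: gr_add bexI[of _ "a + b"])
  next
    fix d k x y assume "x \<in> gr d" "(k, y) \<in> ?I"
    then obtain b where "x \<in> gr d" "y \<in> gr k" "b \<in> gr (k + n)" "s P * Fract y 1 = Fract b 1" by auto
    moreover have "s P * Fract (x * y) 1 = Fract x 1 * (s P * Fract y 1)" by (simp add: mult.left_commute)
    ultimately show "(d + k, x * y) \<in> ?I"
      using gr_mult[of x d b "k + n"] gr_mult[of x d y k] by (auto simp: add.assoc intro!: bexI[of _ "x * b"])
  qed auto
  have nI: "(m * e, f ^ m) \<notin> ?I" for m using contr by blast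
  obtain Q where Q: "Q \<in> proj_points gr" "f \<notin> Q" "\<And>d x. (d, x) \<in> ?I \<Longrightarrow> x \<in> Q"
    by (rule point_avoiding_powers[OF I f nI], rule that, assumption+)
  obtain V d a b where V: "openin (proj_top gr) V" "Q \<in> V" "V \<subseteq> proj_points gr" "a \<in> gr (d + n)" "b \<in> gr d"
    "\<And>P. P \<in> V \<Longrightarrow> b \<notin> P" "\<And>P. P \<in> V \<Longrightarrow> s P = Fract a b"
    by (rule twist_sectionsE[OF s Q(1)], rule that, assumption+)
  have "s P = Fract a b" using twist_sections_constant[OF top s assms(2) Q(1)] V by simp
  moreover have "b \<noteq> 0" using not_point_nonzero[OF Q(1) V(6)[OF V(2)]] .
  ultimately have "s P * Fract b 1 = Fract a 1" by (simp add: eq_fract)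
  then have "b \<in> Q" using V(4,5) by (intro Q(3)[of d]) auto
  then show False using V(2,6) by blast
qed

end

section \<open>A criterion for closed immersions\<close>

text \<open>
  The hypothesis \<open>gen\<close> says that the chart ring of \<open>gr2\<close> where \<open>\<phi> y\<close> is invertible is generated
  by the image of \<open>\<phi>\<close>, i.e. that the map of charts is surjective on rings.
\<close>

locale veronese_embedding = A: graded_domain gr1 + B: graded_domain gr2
  for gr1 :: "nat \<Rightarrow> 's::idom set" and gr2 :: "nat \<Rightarrow> 'r::idom set" +
  fixes \<phi> :: "'s \<Rightarrow> 'r" and l :: nat and E :: "'s set" and \<iota>1 :: "'k \<Rightarrow> 's" and \<iota>2 :: "'k \<Rightarrow> 'r"
  assumes l_pos: "l > 0"
    and phi_add: "\<phi> (x + y) = \<phi> x + \<phi> y"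
    and phi_mult: "\<phi> (x * y) = \<phi> x * \<phi> y"
    and phi_one: "\<phi> 1 = 1"
    and phi_gr: "x \<in> gr1 d \<Longrightarrow> \<phi> x \<in> gr2 (l * d)"
    and phi_const: "\<phi> (\<iota>1 c) = \<iota>2 c"
    and E_gr: "y \<in> E \<Longrightarrow> y \<in> gr1 1"
    and degree_one_cover: "Q \<in> proj_points gr1 \<Longrightarrow> \<exists>y\<in>gr1 1. y \<notin> Q"
    and kernel_cover:
      "Q \<in> proj_points gr1 \<Longrightarrow> (\<And>d g. g \<in> gr1 d \<Longrightarrow> \<phi> g = 0 \<Longrightarrow> g \<in> Q) \<Longrightarrow> \<exists>y\<in>E. y \<notin> Q"
    and cover: "P \<in> proj_points gr2 \<Longrightarrow> \<exists>y\<in>E. \<phi> y \<notin> P"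
    and gen: "y \<in> E \<Longrightarrow> s \<in> gr2 (l * d) \<Longrightarrow> \<exists>m. \<exists>g\<in>gr1 (d + m). \<phi> g = s * \<phi> y ^ m"
begin

lemma phi_zero: "\<phi> 0 = 0"
  using phi_add[of 0 0] by (metis add_0_left add_cancel_right_right)

lemma phi_uminus: "\<phi> (- x) = - \<phi> x"
  using phi_add[of x "- x"] phi_zero by (simp add: eq_neg_iff_add_eq_0 add.commute)

lemma phi_diff: "\<phi> (x - y) = \<phi> x - \<phi> y"
  using phi_add[of x "- y"] by (simp add: phi_uminus)

lemma phi_power: "\<phi> (x ^ n) = \<phi> x ^ n"
  by (induction n) (simp_all add: phi_one phi_mult)

lemma E_gr2: "y \<in> E \<Longrightarrow> \<phi> y \<in> gr2 l"
  using phi_gr[OF E_gr, of y] by simp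

text \<open>Contraction of a prime along \<open>\<phi>\<close>. It is formed degree by degree
  because \<open>\<phi>\<close> is defined on the whole type, which may be larger than the graded
  ring.\<close>

definition pt_map :: "'r set \<Rightarrow> 's set" where
  "pt_map P = hspan (\<lambda>d. {g \<in> gr1 d. \<phi> g \<in> P})"

lemma hprime_pt_map:
  assumes P: "P \<in> proj_points gr2"
  shows "A.hprime (\<lambda>d. {g \<in> gr1 d. \<phi> g \<in> P})"
proof -
  obtain y where y: "y \<in> E" "\<phi> y \<notin> P" using cover[OF P] by blast
  show ?thesis
  proof (rule A.hprimeI[of _ 1 y])
    fix d e x z assume "x \<in> gr1 d" "z \<in> {g \<in> gr1 e. \<phi> g \<in> P}"
    then show "x * z \<in> {g \<in> gr1 (d + e). \<phi> g \<in> P}"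
      using B.point_mult_iff[OF P phi_gr phi_gr, of x d z e] by (auto simp: phi_mult A.gr_mult)
  next
    fix d e x z
    assume "x \<in> gr1 d" "z \<in> gr1 e" "x * z \<in> {g \<in> gr1 (d + e). \<phi> g \<in> P}" "x \<notin> {g \<in> gr1 d. \<phi> g \<in> P}"
    then show "z \<in> {g \<in> gr1 e. \<phi> g \<in> P}"
      using B.point_mult_iff[OF P phi_gr phi_gr, of x d z e] by (auto simp: phi_mult)
  qed (use y E_gr B.point_zero[OF P] B.point_add[OF P] in \<open>auto simp: phi_zero phi_add A.gr_add\<close>)
qed

lemma pt_map_point: "P \<in> proj_points gr2 \<Longrightarrow> pt_map P \<in> proj_points gr1"
  unfolding pt_map_def by (rule A.hspan_hprime_proj_points[OF hprime_pt_map])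

lemma pt_map_iff: "P \<in> proj_points gr2 \<Longrightarrow> g \<in> gr1 d \<Longrightarrow> g \<in> pt_map P \<longleftrightarrow> \<phi> g \<in> P"
  unfolding pt_map_def using A.hspan_hprime_homogeneous[OF hprime_pt_map] by simp

abbreviation "X \<equiv> Proj \<iota>2 gr2"
abbreviation "Y \<equiv> Proj \<iota>1 gr1"
abbreviation "pre \<equiv> preim X pt_map"

lemma preim_iff: "P \<in> pre V \<longleftrightarrow> P \<in> proj_points gr2 \<and> pt_map P \<in> V"
  by (simp add: preim_def)

lemma preim_basic_open: "g \<in> gr1 d \<Longrightarrow> pre (A.basic_open g) = B.basic_open (\<phi> g)"
  using pt_map_iff pt_map_point by (auto simp: preim_iff)

lemma openin_preim:
  assumes V: "openin (proj_top gr1) V"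
  shows "openin (proj_top gr2) (pre V)"
  unfolding B.openin_proj_iff
proof (intro conjI ballI)
  show "pre V \<subseteq> proj_points gr2" by (auto simp: preim_iff)
  fix P assume P: "P \<in> pre V"
  then have P': "P \<in> proj_points gr2" "pt_map P \<in> V" by (auto simp: preim_iff)
  then obtain d s where s: "s \<in> gr1 d" "s \<notin> pt_map P" "A.basic_open s \<subseteq> V"
    using V unfolding A.openin_proj_iff by meson
  have "B.basic_open (\<phi> s) \<subseteq> pre V" unfolding preim_basic_open[OF s(1), symmetric] using s(3) by (auto simp: preim_iff)
  then show "\<exists>d. \<exists>s\<in>gr2 d. s \<notin> P \<and> B.basic_open s \<subseteq> pre V"
    using pt_map_iff[OF P'(1) s(1)] s(2) phi_gr[OF s(1)] by blast
qed

lemma continuous_pt_map: "continuous_map (proj_top gr2) (proj_top gr1) pt_map"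
  unfolding continuous_map_def
  using openin_preim pt_map_point by (auto simp: preim_def)

text \<open>\<open>gen\<close> handles only degrees divisible by \<open>l\<close>, and
  \<open>s ^ l\<close> has such a degree while lying in the same points as \<open>s\<close>. Hence
  on the chart of \<open>y\<close> every basic open set is the preimage of one in the
  target.\<close>

lemma pt_map_power_lift:
  assumes P: "P \<in> proj_points gr2" and y: "y \<in> E" "\<phi> y \<notin> P" and s: "s \<in> gr2 e"
  obtains m g where "g \<in> gr1 (e + m)" "\<phi> g = s ^ l * \<phi> y ^ m"
    "\<And>P. P \<in> proj_points gr2 \<Longrightarrow> \<phi> y \<notin> P \<Longrightarrow> g \<in> pt_map P \<longleftrightarrow> s \<in> P"
proof -
  obtain m g where g: "g \<in> gr1 (e + m)" "\<phi> g = s ^ l * \<phi> y ^ m"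
    using gen[OF y(1) B.gr_power[OF s]] by blast
  have "g \<in> pt_map P \<longleftrightarrow> s \<in> P" if "P \<in> proj_points gr2" "\<phi> y \<notin> P" for P
    using that g pt_map_iff[OF that(1) g(1)] l_pos
      B.point_mult_iff[OF that(1) B.gr_power[OF s, of l] B.gr_power[OF E_gr2[OF y(1)], of m]]
      B.point_power_iff[OF that(1) s] B.point_power_iff[OF that(1) E_gr2[OF y(1)]] by simp
  then show thesis using that g by blast
qed

lemma inj_pt_map: "inj_on pt_map (proj_points gr2)"
proof (rule inj_onI)
  fix P P' assume P: "P \<in> proj_points gr2" "P' \<in> proj_points gr2" "pt_map P = pt_map P'"
  obtain y where y: "y \<in> E" "\<phi> y \<notin> P" using cover[OF P(1)] by blast
  then have y': "\<phi> y \<notin> P'"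
    using pt_map_iff[OF P(1) E_gr[OF y(1)]] pt_map_iff[OF P(2) E_gr[OF y(1)]] P(3) by simp
  show "P = P'"
  proof (rule B.points_eqI[OF P(1,2)])
    fix d x assume x: "x \<in> gr2 d"
    obtain m g where "g \<in> gr1 (d + m)" "\<phi> g = x ^ l * \<phi> y ^ m"
      "\<And>P. P \<in> proj_points gr2 \<Longrightarrow> \<phi> y \<notin> P \<Longrightarrow> g \<in> pt_map P \<longleftrightarrow> x \<in> P"
      by (rule pt_map_power_lift[OF P(1) y x], rule that, assumption+)
    then show "x \<in> P \<longleftrightarrow> x \<in> P'" using P y y' by metis
  qed
qed

text \<open>The topology of the source is induced by \<open>pt_map\<close>; with injectivity this is
  what the embedding property amounts to.\<close>

lemma preim_nbhd:
  assumes U: "openin (proj_top gr2) U" and P: "P \<in> U"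
  obtains T where "openin (proj_top gr1) T" "pt_map P \<in> T" "pre T \<subseteq> U"
proof -
  note P' = B.open_points[OF U P]
  obtain d s where s: "s \<in> gr2 d" "s \<notin> P" "B.basic_open s \<subseteq> U"
    using U P unfolding B.openin_proj_iff by meson
  obtain y where y: "y \<in> E" "\<phi> y \<notin> P" using cover[OF P'] by blast
  obtain m g where g: "g \<in> gr1 (d + m)" "\<phi> g = s ^ l * \<phi> y ^ m"
    "\<And>P. P \<in> proj_points gr2 \<Longrightarrow> \<phi> y \<notin> P \<Longrightarrow> g \<in> pt_map P \<longleftrightarrow> s \<in> P"
    by (rule pt_map_power_lift[OF P' y s(1)], rule that, assumption+)
  let ?T = "A.basic_open g \<inter> A.basic_open y"
  have "openin (proj_top gr1) ?T"
    using A.openin_basic_open[OF g(1)] A.openin_basic_open[OF E_gr[OF y(1)]] by blast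
  moreover have "pt_map P \<in> ?T"
    using g(3)[OF P' y(2)] s(2) pt_map_iff[OF P' E_gr[OF y(1)]] y(2) pt_map_point[OF P'] by simp
  moreover have "pre ?T \<subseteq> U"
  proof
    fix P assume "P \<in> pre ?T"
    then have "P \<in> proj_points gr2" "g \<notin> pt_map P" "\<phi> y \<notin> P"
      using pt_map_iff[OF _ E_gr[OF y(1)], of P] by (auto simp: preim_iff)
    then show "P \<in> U" using g(3)[of P] s(3) by auto
  qed
  ultimately show thesis using that by blast
qed

lemma embedding_pt_map: "embedding_map (proj_top gr2) (proj_top gr1) pt_map"
proof -
  let ?S = "pt_map ` proj_points gr2"
  have sub: "?S \<subseteq> proj_points gr1" using pt_map_point by blast
  have "homeomorphic_map (proj_top gr2) (subtopology (proj_top gr1) ?S) pt_map"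
  proof (rule bijective_open_imp_homeomorphic_map)
    show "continuous_map (proj_top gr2) (subtopology (proj_top gr1) ?S) pt_map"
      using continuous_pt_map by (simp add: continuous_map_in_subtopology)
    show "open_map (proj_top gr2) (subtopology (proj_top gr1) ?S) pt_map"
      unfolding open_map_def
    proof (intro allI impI)
      fix U assume U: "openin (proj_top gr2) U"
      let ?T = "\<Union>{T. openin (proj_top gr1) T \<and> pre T \<subseteq> U}"
      have "openin (proj_top gr1) ?T" by blast
      moreover have "pt_map ` U = ?T \<inter> ?S"
      proof
        show "pt_map ` U \<subseteq> ?T \<inter> ?S"
        proof (rule image_subsetI)
          fix P assume P: "P \<in> U"
          obtain T where "openin (proj_top gr1) T" "pt_map P \<in> T" "pre T \<subseteq> U"
            by (rule preim_nbhd[OF U P])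
          then show "pt_map P \<in> ?T \<inter> ?S" using B.open_points[OF U P] by blast
        qed
        show "?T \<inter> ?S \<subseteq> pt_map ` U" by (auto simp: preim_iff subset_iff)
      qed
      ultimately show "openin (subtopology (proj_top gr1) ?S) (pt_map ` U)"
        unfolding openin_subtopology by blast
    qed
    show "pt_map ` topspace (proj_top gr2) = topspace (subtopology (proj_top gr1) ?S)"
      using sub by auto
    show "inj_on pt_map (topspace (proj_top gr2))" using inj_pt_map by simp
  qed
  then show ?thesis unfolding embedding_map_def by simp
qed

text \<open>
  For a point \<open>Q\<close> containing the kernel and an element \<open>y\<close> not in \<open>Q\<close>, the predicate \<open>num y Q k s\<close> says that the
  numerator of \<open>s\<close>, on the chart of \<open>y\<close>, lies in \<open>Q\<close>.
\<close>

definition num :: "'s \<Rightarrow> 's set \<Rightarrow> nat \<Rightarrow> 'r \<Rightarrow> bool" where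
  "num y Q k s \<longleftrightarrow> (\<exists>m. \<exists>g\<in>gr1 (k + m). g \<in> Q \<and> \<phi> g = s * \<phi> y ^ m)"

context
  fixes Q y
  assumes Q: "Q \<in> proj_points gr1" and ker: "\<And>d g. g \<in> gr1 d \<Longrightarrow> \<phi> g = 0 \<Longrightarrow> g \<in> Q"
    and y: "y \<in> E" "y \<notin> Q"
begin

lemma times_power_in_Q: "g \<in> gr1 d \<Longrightarrow> g * y ^ m \<in> Q \<longleftrightarrow> g \<in> Q"
  using A.point_mult_iff[OF Q _ A.gr_power[OF E_gr[OF y(1)]]] A.point_power_iff[OF Q E_gr[OF y(1)]] y(2)
  by blast

lemma times_power_gr: "g \<in> gr1 d \<Longrightarrow> g * y ^ m \<in> gr1 (d + m)"
  using A.gr_mult[OF _ A.gr_power[OF E_gr[OF y(1)], of m]] by simp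

lemma in_Q_cong:
  assumes "g \<in> gr1 d" "g' \<in> gr1 d" "\<phi> g = \<phi> g'"
  shows "g \<in> Q \<longleftrightarrow> g' \<in> Q"
proof -
  have "g - g' \<in> Q" "g' - g \<in> Q" using assms by (auto intro!: ker[of _ d] A.gr_diff simp: phi_diff)
  then show ?thesis
    using A.point_add[OF Q, of "g - g'" g'] A.point_add[OF Q, of "g' - g" g] by auto
qed

text \<open>The predicate does not depend on the chosen numerator: after multiplication by powers of
  \<open>y\<close>, two choices have the same image under \<open>\<phi>\<close>, so they differ by
  an element of the kernel, which \<open>Q\<close> contains.\<close>

lemma num_iff:
  assumes g: "g \<in> gr1 (k + m)" "\<phi> g = s * \<phi> y ^ m"
  shows "num y Q k s \<longleftrightarrow> g \<in> Q"
proof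
  assume "num y Q k s"
  then obtain m' g' where g': "g' \<in> gr1 (k + m')" "g' \<in> Q" "\<phi> g' = s * \<phi> y ^ m'"
    unfolding num_def by blast
  have "g * y ^ m' \<in> Q \<longleftrightarrow> g' * y ^ m \<in> Q"
  proof (rule in_Q_cong)
    show "g * y ^ m' \<in> gr1 (k + m + m')" using times_power_gr[OF g(1)] .
    show "g' * y ^ m \<in> gr1 (k + m + m')" using times_power_gr[OF g'(1), of m] by (simp add: ac_simps)
    show "\<phi> (g * y ^ m') = \<phi> (g' * y ^ m)" using g g' by (simp add: phi_mult phi_power ac_simps)
  qed
  then show "g \<in> Q" using times_power_in_Q[OF g(1)] times_power_in_Q[OF g'(1)] g'(2) by blast
qed (use assms in \<open>auto simp: num_def\<close>)

lemma num_add: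
  assumes s: "s \<in> gr2 (l * k)" "num y Q k s" and t: "t \<in> gr2 (l * k)" "num y Q k t"
  shows "num y Q k (s + t)"
proof -
  obtain m g where g: "g \<in> gr1 (k + m)" "\<phi> g = s * \<phi> y ^ m" using gen[OF y(1) s(1)] by blast
  obtain m' g' where g': "g' \<in> gr1 (k + m')" "\<phi> g' = t * \<phi> y ^ m'" using gen[OF y(1) t(1)] by blast
  have "g \<in> Q" "g' \<in> Q" using num_iff[OF g] num_iff[OF g'] s t by auto
  then have "g * y ^ m' + g' * y ^ m \<in> Q"
    using times_power_in_Q[OF g(1)] times_power_in_Q[OF g'(1)] A.point_add[OF Q] by blast
  moreover have "g * y ^ m' + g' * y ^ m \<in> gr1 (k + (m + m'))"
    using A.gr_add times_power_gr[OF g(1), of m'] times_power_gr[OF g'(1), of m] by (simp add: ac_simps)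
  moreover have "\<phi> (g * y ^ m' + g' * y ^ m) = (s + t) * \<phi> y ^ (m + m')"
    using g g' by (simp add: phi_add phi_mult phi_power power_add algebra_simps)
  ultimately show ?thesis unfolding num_def by blast
qed

lemma num_mult:
  assumes s: "s \<in> gr2 (l * k)" and t: "t \<in> gr2 (l * k')"
  shows "num y Q (k + k') (s * t) \<longleftrightarrow> num y Q k s \<or> num y Q k' t"
proof -
  obtain m g where g: "g \<in> gr1 (k + m)" "\<phi> g = s * \<phi> y ^ m" using gen[OF y(1) s(1)] by blast
  obtain m' g' where g': "g' \<in> gr1 (k' + m')" "\<phi> g' = t * \<phi> y ^ m'" using gen[OF y(1) t(1)] by blast
  have "g * g' \<in> gr1 (k + k' + (m + m'))" using A.gr_mult[OF g(1) g'(1)] by (simp add: ac_simps)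
  moreover have "\<phi> (g * g') = (s * t) * \<phi> y ^ (m + m')"
    using g g' by (simp add: phi_mult power_add ac_simps)
  ultimately have "num y Q (k + k') (s * t) \<longleftrightarrow> g * g' \<in> Q" by (rule num_iff)
  then show ?thesis using A.point_mult_iff[OF Q g(1) g'(1)] num_iff[OF g] num_iff[OF g'] by simp
qed

text \<open>The prime above \<open>Q\<close>: an element belongs to it when all its homogeneous
  multiples of degree divisible by \<open>l\<close> have their numerator in \<open>Q\<close>.
  Compared with a condition on \<open>s ^ l\<close>, this form makes closure under addition
  immediate.\<close>

definition lift_parts :: "nat \<Rightarrow> 'r set" where
  "lift_parts d = {s \<in> gr2 d. \<forall>e k t. t \<in> gr2 e \<longrightarrow> d + e = l * k \<longrightarrow> num y Q k (s * t)}"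

lemma lift_partsD: "s \<in> lift_parts d \<Longrightarrow> t \<in> gr2 e \<Longrightarrow> d + e = l * k \<Longrightarrow> num y Q k (s * t)"
  unfolding lift_parts_def by simp

lemma hprime_lift_parts: "B.hprime lift_parts"
proof (rule B.hprimeI[of _ l "\<phi> y"])
  show "lift_parts d \<subseteq> gr2 d" for d by (auto simp: lift_parts_def)
  have "num y Q k 0" for k
    using num_iff[of 0 k 0 0] A.point_zero[OF Q] by (simp add: phi_zero)
  then show "0 \<in> lift_parts d" for d by (simp add: lift_parts_def)
  show "s + s' \<in> lift_parts d" if s: "s \<in> lift_parts d" "s' \<in> lift_parts d" for d s s'
  proof -
    have "num y Q k ((s + s') * t)" if t: "t \<in> gr2 e" "d + e = l * k" for e k t
      unfolding distrib_right
    proof (rule num_add)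
      show "s * t \<in> gr2 (l * k)" "s' * t \<in> gr2 (l * k)"
        using B.gr_mult[of s d t e] B.gr_mult[of s' d t e] s t by (auto simp: lift_parts_def)
    qed (use s t in \<open>auto simp: lift_parts_def\<close>)
    then show ?thesis using s B.gr_add by (auto simp: lift_parts_def)
  qed
  show "x * s \<in> lift_parts (d + e)" if x: "x \<in> gr2 d" and s: "s \<in> lift_parts e" for d e x s
  proof -
    have "num y Q k (x * s * t)" if t: "t \<in> gr2 f" "d + e + f = l * k" for f k t
    proof -
      have "x * t \<in> gr2 (d + f)" "e + (d + f) = l * k"
        using B.gr_mult[OF x t(1)] t(2) by simp_all
      then have "num y Q k (s * (x * t))" using lift_partsD[OF s] by blast
      then show ?thesis by (simp add: ac_simps)
    qed
    then show ?thesis using s x B.gr_mult by (auto simp: lift_parts_def)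
  qed
  show "y' \<in> lift_parts e" if x: "x \<in> gr2 d" and y': "y' \<in> gr2 e"
    and xy: "x * y' \<in> lift_parts (d + e)" and nx: "x \<notin> lift_parts d" for d e x y'
  proof -
    obtain e1 k1 t1 where t1: "t1 \<in> gr2 e1" "d + e1 = l * k1" "\<not> num y Q k1 (x * t1)"
      using nx x unfolding lift_parts_def by blast
    have "num y Q k (y' * t)" if t: "t \<in> gr2 f" "e + f = l * k" for f k t
    proof -
      have "t1 * t \<in> gr2 (e1 + f)" "(d + e) + (e1 + f) = l * (k1 + k)"
        using B.gr_mult[OF t1(1) t(1)] t1(2) t(2) by (simp_all add: algebra_simps)
      then have "num y Q (k1 + k) (x * y' * (t1 * t))" using lift_partsD[OF xy] by blast
      then have "num y Q (k1 + k) ((x * t1) * (y' * t))" by (simp add: ac_simps)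
      moreover have "x * t1 \<in> gr2 (l * k1)" "y' * t \<in> gr2 (l * k)"
        using B.gr_mult[OF x t1(1)] B.gr_mult[OF y' t(1)] t1(2) t(2) by simp_all
      ultimately show ?thesis using num_mult t1(3) by blast
    qed
    then show ?thesis using y' by (simp add: lift_parts_def)
  qed
  show "l \<ge> 1" using l_pos by simp
  show "\<phi> y \<in> gr2 l" by (rule E_gr2[OF y(1)])
  have "\<not> num y Q 1 (\<phi> y * 1)"
    using num_iff[of y 1 0 "\<phi> y"] E_gr[OF y(1)] y(2) by simp
  then show "\<phi> y \<notin> lift_parts l"
    using lift_partsD[OF _ B.gr_one, of "\<phi> y" l 1] by auto
qed

lemma pt_map_lift: "pt_map (hspan lift_parts) = Q"
proof (rule A.points_eqI[OF pt_map_point[OF B.hspan_hprime_proj_points[OF hprime_lift_parts]] Q])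
  fix d g assume g: "g \<in> gr1 d"
  have "g \<in> pt_map (hspan lift_parts) \<longleftrightarrow> \<phi> g \<in> lift_parts (l * d)"
    using pt_map_iff[OF B.hspan_hprime_proj_points[OF hprime_lift_parts] g]
      B.hspan_hprime_homogeneous[OF hprime_lift_parts phi_gr[OF g]] by simp
  also have "\<dots> \<longleftrightarrow> g \<in> Q"
  proof
    assume "\<phi> g \<in> lift_parts (l * d)"
    then have "num y Q d (\<phi> g * 1)" using lift_partsD[OF _ B.gr_one] by simp
    then show "g \<in> Q" using num_iff[of g d 0 "\<phi> g"] g by simp
  next
    assume gQ: "g \<in> Q"
    have "num y Q k (\<phi> g * t)" if t: "t \<in> gr2 e" "l * d + e = l * k" for e k t
    proof -
      \<comment> \<open>The degrees of \<open>\<phi> g\<close> and of the product are multiples of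
        \<open>l\<close>, hence so is the degree of \<open>t\<close>, and \<open>num_mult\<close>
        applies.\<close>
      have "d \<le> k" using t(2) l_pos by (metis le_add1 mult_le_cancel1)
      then have e: "e = l * (k - d)" using t(2) by (simp add: diff_mult_distrib2)
      have "num y Q d (\<phi> g)" using num_iff[of g d 0 "\<phi> g"] g gQ by simp
      then have "num y Q (d + (k - d)) (\<phi> g * t)"
        using num_mult[OF phi_gr[OF g]] t(1) e by blast
      then show ?thesis using \<open>d \<le> k\<close> by simp
    qed
    then show "\<phi> g \<in> lift_parts (l * d)" using phi_gr[OF g] by (simp add: lift_parts_def)
  qed
  finally show "g \<in> pt_map (hspan lift_parts) \<longleftrightarrow> g \<in> Q" .
qed

lemma in_image_pt_map: "Q \<in> pt_map ` proj_points gr2"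
  using pt_map_lift B.hspan_hprime_proj_points[OF hprime_lift_parts] by blast

end

text \<open>The image is the zero locus of the kernel. \<open>kernel_cover\<close> provides, for a
  point of this locus, the chart on which the prime above it is constructed.\<close>

lemma image_pt_map_iff:
  "Q \<in> pt_map ` proj_points gr2 \<longleftrightarrow>
     Q \<in> proj_points gr1 \<and> (\<forall>d. \<forall>g\<in>gr1 d. \<phi> g = 0 \<longrightarrow> g \<in> Q)"
proof
  assume "Q \<in> pt_map ` proj_points gr2"
  then show "Q \<in> proj_points gr1 \<and> (\<forall>d. \<forall>g\<in>gr1 d. \<phi> g = 0 \<longrightarrow> g \<in> Q)"
    using pt_map_point pt_map_iff B.point_zero by auto
next
  assume Q: "Q \<in> proj_points gr1 \<and> (\<forall>d. \<forall>g\<in>gr1 d. \<phi> g = 0 \<longrightarrow> g \<in> Q)"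
  then obtain y where "y \<in> E" "y \<notin> Q" using kernel_cover by blast
  then show "Q \<in> pt_map ` proj_points gr2" using in_image_pt_map Q by blast
qed

lemma openin_compl_image: "openin (proj_top gr1) (proj_points gr1 - pt_map ` proj_points gr2)"
  unfolding A.openin_proj_iff
proof (intro conjI ballI)
  fix Q assume "Q \<in> proj_points gr1 - pt_map ` proj_points gr2"
  then obtain d g where g: "g \<in> gr1 d" "\<phi> g = 0" "g \<notin> Q" using image_pt_map_iff[of Q] by blast
  then have "A.basic_open g \<subseteq> proj_points gr1 - pt_map ` proj_points gr2"
    using pt_map_iff[OF _ g(1)] B.point_zero by auto
  then show "\<exists>d. \<exists>s\<in>gr1 d. s \<notin> Q \<and> A.basic_open s \<subseteq> proj_points gr1 - pt_map ` proj_points gr2"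
    using g by blast
qed simp

lemma closedin_image: "closedin (proj_top gr1) (pt_map ` proj_points gr2)"
  unfolding closedin_def using openin_compl_image pt_map_point by auto

end

section \<open>Pulling back sections along the map of points\<close>

context veronese_embedding
begin

text \<open>
  The partial map induced by \<open>\<phi>\<close> on fractions; it depends on the fraction alone, so it can
  be applied to a section point by point.
\<close>

definition frac_map :: "'s fract \<Rightarrow> 'r fract" where
  "frac_map z = (THE w. \<exists>a b. z = Fract a b \<and> \<phi> b \<noteq> 0 \<and> w = Fract (\<phi> a) (\<phi> b))"

lemma frac_map_Fract:
  assumes "\<phi> b \<noteq> 0"
  shows "frac_map (Fract a b) = Fract (\<phi> a) (\<phi> b)"
  unfolding frac_map_def
proof (rule the_equality)
  fix w assume "\<exists>a' b'. Fract a b = Fract a' b' \<and> \<phi> b' \<noteq> 0 \<and> w = Fract (\<phi> a') (\<phi> b')"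
  then obtain a' b' where *: "Fract a b = Fract a' b'" "\<phi> b' \<noteq> 0" "w = Fract (\<phi> a') (\<phi> b')" by blast
  have "b \<noteq> 0" "b' \<noteq> 0" using assms *(2) phi_zero by auto
  then have "\<phi> (a * b') = \<phi> (a' * b)" using *(1) by (simp add: eq_fract)
  then show "w = Fract (\<phi> a) (\<phi> b)" using * assms by (simp add: eq_fract phi_mult)
qed (use assms in blast)

text \<open>\<open>frac_map\<close> does not see degrees, so one definition serves as the sheaf map
  on functions and as the map from \<open>O(1)\<close> to \<open>O(l)\<close>.\<close>

definition pull :: "'s set set \<Rightarrow> ('s set \<Rightarrow> 's fract) \<Rightarrow> 'r set \<Rightarrow> 'r fract" where
  "pull V t = (\<lambda>P\<in>pre V. frac_map (t (pt_map P)))"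

lemma pull_at_point: "pt_map P \<in> V \<Longrightarrow> P \<in> proj_points gr2 \<Longrightarrow> pull V t P = frac_map (t (pt_map P))"
  by (simp add: pull_def preim_iff)

lemma pull_extensional: "pull V t \<in> extensional (pre V)"
  by (simp add: pull_def)

lemma pull_at:
  assumes t: "t \<in> twist_sections gr1 n V" and P: "P \<in> pre V"
  obtains V' d a b where "openin (proj_top gr1) V'" "pt_map P \<in> V'" "V' \<subseteq> V" "a \<in> gr1 (d + n)" "b \<in> gr1 d"
    "\<phi> b \<notin> P" "\<And>Q. Q \<in> V' \<Longrightarrow> b \<notin> Q" "\<And>Q. Q \<in> V' \<Longrightarrow> t Q = Fract a b"
    "\<And>R. R \<in> pre V' \<Longrightarrow> \<phi> b \<notin> R \<and> pull V t R = Fract (\<phi> a) (\<phi> b)"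
proof -
  have P': "P \<in> proj_points gr2" "pt_map P \<in> V" using P by (simp_all add: preim_iff)
  obtain V' d a b where V: "openin (proj_top gr1) V'" "pt_map P \<in> V'" "V' \<subseteq> V" "a \<in> gr1 (d + n)" "b \<in> gr1 d"
    "\<And>Q. Q \<in> V' \<Longrightarrow> b \<notin> Q" "\<And>Q. Q \<in> V' \<Longrightarrow> t Q = Fract a b"
    by (rule A.twist_sectionsE[OF t P'(2)], rule that, assumption+)
  have R: "\<phi> b \<notin> R \<and> pull V t R = Fract (\<phi> a) (\<phi> b)" if "R \<in> pre V'" for R
  proof -
    have R: "R \<in> proj_points gr2" "pt_map R \<in> V'" "R \<in> pre V" using that V(3) by (auto simp: preim_iff)
    have "\<phi> b \<notin> R" using pt_map_iff[OF R(1) V(5)] V(6)[OF R(2)] by simp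
    then show ?thesis
      using frac_map_Fract[of b a] B.not_point_nonzero[OF R(1)] V(7)[OF R(2)] R(3) by (simp add: pull_def)
  qed
  moreover have "\<phi> b \<notin> P" using R[of P] P'(1) V(2) by (simp add: preim_iff)
  ultimately show thesis using V that by blast
qed

lemma pull_sections:
  assumes V: "openin (proj_top gr1) V" and t: "t \<in> twist_sections gr1 n V"
  shows "pull V t \<in> twist_sections gr2 (l * n) (pre V)"
proof (rule B.twist_sectionsI[OF openin_preim[OF V]])
  show "pull V t \<in> extensional (pre V)" by (simp add: pull_def)
  fix P assume P: "P \<in> pre V"
  obtain V' d a b where V': "openin (proj_top gr1) V'" "pt_map P \<in> V'" "V' \<subseteq> V" "a \<in> gr1 (d + n)" "b \<in> gr1 d"
    "\<phi> b \<notin> P" "\<And>Q. Q \<in> V' \<Longrightarrow> b \<notin> Q" "\<And>Q. Q \<in> V' \<Longrightarrow> t Q = Fract a b"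
    "\<And>R. R \<in> pre V' \<Longrightarrow> \<phi> b \<notin> R \<and> pull V t R = Fract (\<phi> a) (\<phi> b)"
    by (rule pull_at[OF t P], rule that, assumption+)
  have "\<phi> a \<in> gr2 (l * d + l * n)" "\<phi> b \<in> gr2 (l * d)"
    using phi_gr[OF V'(4)] phi_gr[OF V'(5)] by (simp_all add: distrib_left)
  moreover have "P \<in> pre V'" using P V'(2) by (simp add: preim_iff)
  ultimately show "\<exists>W d a b. openin (proj_top gr2) W \<and> P \<in> W \<and> a \<in> gr2 (d + l * n) \<and> b \<in> gr2 d \<and>
      b \<notin> P \<and> (\<forall>Q\<in>pre V \<inter> W. b \<notin> Q \<longrightarrow> pull V t Q = Fract a b)"
    using openin_preim[OF V'(1)] V'(6,9)
    by (intro exI[of _ "pre V'"] exI[of _ "l * d"] exI[of _ "\<phi> a"] exI[of _ "\<phi> b"]) auto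
qed

lemma pull_mult:
  assumes s: "s \<in> twist_sections gr1 m V" and t: "t \<in> twist_sections gr1 n V"
  shows "pull V (\<lambda>P\<in>V. s P * t P) = (\<lambda>P\<in>pre V. pull V s P * pull V t P)"
proof -
  have "frac_map (s (pt_map P) * t (pt_map P)) = pull V s P * pull V t P" if P: "P \<in> pre V" for P
  proof -
    obtain V' d a b where 1: "openin (proj_top gr1) V'" "pt_map P \<in> V'" "V' \<subseteq> V" "a \<in> gr1 (d + m)" "b \<in> gr1 d"
      "\<phi> b \<notin> P" "\<And>Q. Q \<in> V' \<Longrightarrow> b \<notin> Q" "\<And>Q. Q \<in> V' \<Longrightarrow> s Q = Fract a b"
      "\<And>R. R \<in> pre V' \<Longrightarrow> \<phi> b \<notin> R \<and> pull V s R = Fract (\<phi> a) (\<phi> b)"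
      by (rule pull_at[OF s P], rule that, assumption+)
    obtain V'' d' a' b' where 2: "openin (proj_top gr1) V''" "pt_map P \<in> V''" "V'' \<subseteq> V" "a' \<in> gr1 (d' + n)" "b' \<in> gr1 d'"
      "\<phi> b' \<notin> P" "\<And>Q. Q \<in> V'' \<Longrightarrow> b' \<notin> Q" "\<And>Q. Q \<in> V'' \<Longrightarrow> t Q = Fract a' b'"
      "\<And>R. R \<in> pre V'' \<Longrightarrow> \<phi> b' \<notin> R \<and> pull V t R = Fract (\<phi> a') (\<phi> b')"
      by (rule pull_at[OF t P], rule that, assumption+)
    have P': "P \<in> proj_points gr2" "P \<in> pre V'" "P \<in> pre V''" using P 1(2) 2(2) by (auto simp: preim_iff)
    then have "\<phi> b \<noteq> 0" "\<phi> b' \<noteq> 0" using 1(6) 2(6) B.not_point_nonzero by auto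
    then show ?thesis
      using 1(8)[OF 1(2)] 2(8)[OF 2(2)] 1(9)[OF P'(2)] 2(9)[OF P'(3)] frac_map_Fract[of "b * b'" "a * a'"]
      by (simp add: phi_mult)
  qed
  then show ?thesis
    by (intro extensionalityI[of _ "pre V"]) (auto simp: pull_at_point preim_iff pull_extensional)
qed

lemma pull_add:
  assumes s: "s \<in> twist_sections gr1 n V" and t: "t \<in> twist_sections gr1 n V"
  shows "pull V (\<lambda>P\<in>V. s P + t P) = (\<lambda>P\<in>pre V. pull V s P + pull V t P)"
proof -
  have "frac_map (s (pt_map P) + t (pt_map P)) = pull V s P + pull V t P" if P: "P \<in> pre V" for P
  proof -
    obtain V' d a b where 1: "openin (proj_top gr1) V'" "pt_map P \<in> V'" "V' \<subseteq> V" "a \<in> gr1 (d + n)" "b \<in> gr1 d"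
      "\<phi> b \<notin> P" "\<And>Q. Q \<in> V' \<Longrightarrow> b \<notin> Q" "\<And>Q. Q \<in> V' \<Longrightarrow> s Q = Fract a b"
      "\<And>R. R \<in> pre V' \<Longrightarrow> \<phi> b \<notin> R \<and> pull V s R = Fract (\<phi> a) (\<phi> b)"
      by (rule pull_at[OF s P], rule that, assumption+)
    obtain V'' d' a' b' where 2: "openin (proj_top gr1) V''" "pt_map P \<in> V''" "V'' \<subseteq> V" "a' \<in> gr1 (d' + n)" "b' \<in> gr1 d'"
      "\<phi> b' \<notin> P" "\<And>Q. Q \<in> V'' \<Longrightarrow> b' \<notin> Q" "\<And>Q. Q \<in> V'' \<Longrightarrow> t Q = Fract a' b'"
      "\<And>R. R \<in> pre V'' \<Longrightarrow> \<phi> b' \<notin> R \<and> pull V t R = Fract (\<phi> a') (\<phi> b')"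
      by (rule pull_at[OF t P], rule that, assumption+)
    have P': "P \<in> proj_points gr2" "P \<in> pre V'" "P \<in> pre V''" using P 1(2) 2(2) by (auto simp: preim_iff)
    then have nz: "\<phi> b \<noteq> 0" "\<phi> b' \<noteq> 0" using 1(6) 2(6) B.not_point_nonzero by auto
    then have "b \<noteq> 0" "b' \<noteq> 0" using phi_zero by auto
    then show ?thesis
      using nz 1(8)[OF 1(2)] 2(8)[OF 2(2)] 1(9)[OF P'(2)] 2(9)[OF P'(3)]
        frac_map_Fract[of "b * b'" "a * b' + a' * b"]
      by (simp add: phi_mult phi_add)
  qed
  then show ?thesis
    by (intro extensionalityI[of _ "pre V"]) (auto simp: pull_at_point preim_iff pull_extensional)
qed

lemma pull_const: "pull V (\<lambda>P\<in>V. Fract a 1) = (\<lambda>P\<in>pre V. Fract (\<phi> a) 1)"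
  using frac_map_Fract[of 1 a] by (auto simp: pull_def preim_iff phi_one fun_eq_iff restrict_def)

lemma pull_restrict: "W \<subseteq> V \<Longrightarrow> pull W (restrict t W) = restrict (pull V t) (pre W)"
  by (auto simp: pull_def preim_iff fun_eq_iff restrict_def)

lemma ringed_morphism_pull: "ringed_morphism X Y pt_map pull"
  unfolding ringed_morphism_def
proof (intro conjI allI impI)
  show "continuous_map (top_of X) (top_of Y) pt_map" using continuous_pt_map by simp
  fix V assume "openin (top_of Y) V"
  then have V: "openin (proj_top gr1) V" by simp
  show "pull V \<in> ring_hom (ring_of Y V) (ring_of X (pre V))"
  proof (rule ring_hom_memI)
    show "pull V \<one>\<^bsub>ring_of Y V\<^esub> = \<one>\<^bsub>ring_of X (pre V)\<^esub>"
      using pull_const[of V 1] by (simp add: phi_one One_fract_def)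
  qed (use pull_sections[OF V, of _ 0] pull_mult[of _ 0 V _ 0] pull_add[of _ 0 V] in auto)
  show "pull V (scal Y V c) = scal X (pre V) c" for c
    using pull_const[of V "\<iota>1 c"] by (simp add: phi_const)
  show "pull W (res Y W t) = res X (pre W) (pull V t)"
    if "openin (top_of Y) W" "W \<subseteq> V" "t \<in> carrier (ring_of Y V)" for W t
    using pull_restrict[OF that(2)] by simp
qed

text \<open>Used twice: \<open>n = 0\<close> shows that the maps of stalks are local,
  \<open>n = 1\<close> that frames of \<open>O(1)\<close> become frames of
  \<open>O(l)\<close>.\<close>

lemma pull_nonvanishing_iff:
  assumes V: "openin (proj_top gr1) V" and t: "t \<in> twist_sections gr1 n V" and P: "P \<in> pre V"
  shows "B.nonvanishing (l * n) (pull V t P) P \<longleftrightarrow> A.nonvanishing n (t (pt_map P)) (pt_map P)"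
proof -
  have P': "P \<in> proj_points gr2" "pt_map P \<in> V" using P by (simp_all add: preim_iff)
  obtain V' d a b where V': "openin (proj_top gr1) V'" "pt_map P \<in> V'" "V' \<subseteq> V" "a \<in> gr1 (d + n)" "b \<in> gr1 d"
    "\<phi> b \<notin> P" "\<And>Q. Q \<in> V' \<Longrightarrow> b \<notin> Q" "\<And>Q. Q \<in> V' \<Longrightarrow> t Q = Fract a b"
    "\<And>R. R \<in> pre V' \<Longrightarrow> \<phi> b \<notin> R \<and> pull V t R = Fract (\<phi> a) (\<phi> b)"
    by (rule pull_at[OF t P], rule that, assumption+)
  have "\<phi> a \<in> gr2 (l * d + l * n)" "\<phi> b \<in> gr2 (l * d)"
    using phi_gr[OF V'(4)] phi_gr[OF V'(5)] by (simp_all add: distrib_left)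
  then have "B.nonvanishing (l * n) (pull V t P) P \<longleftrightarrow> \<phi> a \<notin> P"
    using V'(2,6,9) P' B.nonvanishing_fraction_iff[OF P'(1)] by (simp add: preim_iff)
  also have "\<dots> \<longleftrightarrow> A.nonvanishing n (t (pt_map P)) (pt_map P)"
    using V'(2,7,8) pt_map_iff[OF P'(1) V'(4)] A.nonvanishing_fraction_iff[OF pt_map_point[OF P'(1)] V'(4,5)]
    by simp
  finally show ?thesis .
qed

lemma local_morphism_pull: "local_morphism X Y pt_map pull"
  unfolding local_morphism_def
proof (intro conjI allI impI)
  fix V t P assume "openin (top_of Y) V" "t \<in> carrier (ring_of Y V)" and P: "P \<in> pre V"
    and u: "unit_at X (pre V) (pull V t) P"
  then have V: "openin (proj_top gr1) V" and t: "t \<in> twist_sections gr1 0 V" by simp_all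
  have pt: "pull V t \<in> twist_sections gr2 0 (pre V)" using pull_sections[OF V t] by simp
  have "B.nonvanishing 0 (pull V t P) P"
    using u unfolding B.unit_at_Proj_iff[OF openin_preim[OF V] pt P] .
  then have "A.nonvanishing 0 (t (pt_map P)) (pt_map P)"
    using pull_nonvanishing_iff[OF V t P] by simp
  then show "unit_at Y V t (pt_map P)"
    using P by (subst A.unit_at_Proj_iff[OF V t]) (simp_all add: preim_iff)
qed (rule ringed_morphism_pull)

text \<open>Off the closed image a neighbourhood has empty preimage and the zero section will do. At
  a point of the image, numerator and denominator of a local fraction are lifted separately.\<close>

lemma pull_surjective:
  assumes V: "openin (proj_top gr1) V" and s: "s \<in> twist_sections gr2 0 (pre V)" and Q: "Q \<in> V"
  shows "\<exists>W t. openin (proj_top gr1) W \<and> Q \<in> W \<and> W \<subseteq> V \<and> t \<in> twist_sections gr1 0 W \<and>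
    pull W t = restrict s (pre W)"
proof (cases "Q \<in> pt_map ` proj_points gr2")
  case False
  let ?W = "V \<inter> (proj_points gr1 - pt_map ` proj_points gr2)"
  have W: "openin (proj_top gr1) ?W" using openin_compl_image V by blast
  have "pre ?W = {}" by (auto simp: preim_iff)
  then have "pull ?W (\<lambda>P\<in>?W. Fract 0 1) = restrict s (pre ?W)"
    by (intro ext) (simp add: pull_def)
  moreover have "(\<lambda>P\<in>?W. Fract 0 1) \<in> twist_sections gr1 0 ?W"
    by (rule A.twist_sections_const[OF W A.gr_zero])
  ultimately show ?thesis using W Q False A.open_points[OF V Q] by blast
next
  case True
  then obtain P where P: "P \<in> proj_points gr2" "Q = pt_map P" by blast
  then have PV: "P \<in> pre V" using Q by (simp add: preim_iff)
  obtain U d a b where U: "openin (proj_top gr2) U" "P \<in> U" "U \<subseteq> pre V" "a \<in> gr2 (d + 0)" "b \<in> gr2 d"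
    "\<And>Q. Q \<in> U \<Longrightarrow> b \<notin> Q" "\<And>Q. Q \<in> U \<Longrightarrow> s Q = Fract a b"
    by (rule B.twist_sectionsE[OF s PV], rule that, assumption+)
  obtain T where T: "openin (proj_top gr1) T" "pt_map P \<in> T" "pre T \<subseteq> U"
    by (rule preim_nbhd[OF U(1,2)])
  obtain y where y: "y \<in> E" "\<phi> y \<notin> P" using cover[OF P(1)] by blast
  \<comment> \<open>The fraction \<open>a / b\<close> is rewritten as \<open>a * b ^ (l - 1)\<close>
    over \<open>b ^ l\<close>; both now have degree \<open>l * d\<close>, which \<open>gen\<close>
    accepts.\<close>
  have "a * b ^ (l - 1) \<in> gr2 (d + (l - 1) * d)"
    using B.gr_mult[OF U(4) B.gr_power[OF U(5), of "l - 1"]] by simp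
  moreover have "d + (l - 1) * d = l * d" using l_pos by (cases l) auto
  ultimately have num: "a * b ^ (l - 1) \<in> gr2 (l * d)" by simp
  obtain m g where g: "g \<in> gr1 (d + m)" "\<phi> g = a * b ^ (l - 1) * \<phi> y ^ m"
    using gen[OF y(1) num] by blast
  obtain m' g' where g': "g' \<in> gr1 (d + m')" "\<phi> g' = b ^ l * \<phi> y ^ m'"
    "\<And>P. P \<in> proj_points gr2 \<Longrightarrow> \<phi> y \<notin> P \<Longrightarrow> g' \<in> pt_map P \<longleftrightarrow> b \<in> P"
    by (rule pt_map_power_lift[OF P(1) y U(5)], rule that, assumption+)
  note yE = E_gr[OF y(1)]
  let ?W = "V \<inter> T \<inter> A.basic_open g' \<inter> A.basic_open y"
  \<comment> \<open>The two lifts carry different powers of \<open>y\<close>; cross-multiplying by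
    them equalizes the degrees and cancels the powers.\<close>
  let ?a = "g * y ^ m'" and ?b = "g' * y ^ m"
  have W: "openin (proj_top gr1) ?W"
    using V T(1) A.openin_basic_open[OF g'(1)] A.openin_basic_open[OF yE] by blast
  have QW: "Q \<in> ?W"
    using Q T(2) P g'(3)[OF P(1) y(2)] U(2,6) pt_map_iff[OF P(1) yE] y(2) pt_map_point[OF P(1)] by simp
  have grb: "?b \<in> gr1 (d + m + m')" and gra: "?a \<in> gr1 (d + m + m')"
    using A.gr_mult[OF g'(1) A.gr_power[OF yE, of m]] A.gr_mult[OF g(1) A.gr_power[OF yE, of m']]
    by (simp_all add: ac_simps)
  have b: "?b \<notin> R" if "R \<in> ?W" for R
    using that A.point_mult_iff[OF _ g'(1) A.gr_power[OF yE, of m], of R] A.point_power_iff[OF _ yE, of R]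
    by auto
  have t: "(\<lambda>P\<in>?W. Fract ?a ?b) \<in> twist_sections gr1 0 ?W"
    using A.twist_sections_fraction[OF W, of ?a "d + m + m'" 0 ?b] gra grb b by simp
  have "pull ?W (\<lambda>P\<in>?W. Fract ?a ?b) R = restrict s (pre ?W) R" for R
  proof (cases "R \<in> pre ?W")
    case True
    then have R: "R \<in> proj_points gr2" "pt_map R \<in> ?W" "R \<in> pre T" by (auto simp: preim_iff)
    then have RU: "R \<in> U" using T(3) by blast
    have "\<phi> ?b \<notin> R" using pt_map_iff[OF R(1) grb] b[OF R(2)] by simp
    then have b0: "\<phi> ?b \<noteq> 0" using B.not_point_nonzero[OF R(1)] by blast
    have "b \<noteq> 0" using U(6)[OF RU] B.not_point_nonzero[OF R(1)] by blast
    moreover have "b ^ l = b ^ (l - 1) * b" using l_pos by (cases l) auto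
    ultimately have "Fract (\<phi> ?a) (\<phi> ?b) = Fract a b"
      using b0 by (simp add: eq_fract phi_mult phi_power g(2) g'(2) ac_simps)
    then show ?thesis
      using True R(2) U(7)[OF RU] frac_map_Fract[OF b0, of ?a] by (simp add: pull_def)
  qed (simp add: pull_def)
  then show ?thesis using W QW t by (intro exI[of _ ?W] exI[of _ "\<lambda>P\<in>?W. Fract ?a ?b"]) auto
qed

lemma closed_immersion_pull: "closed_immersion X Y pt_map pull"
  unfolding closed_immersion_def
  using local_morphism_pull embedding_pt_map closedin_image pull_surjective by simp

text \<open>Some element of degree one is nonzero at each point of the target, so a frame of
  \<open>O(1)\<close> vanishes nowhere; its pullback then vanishes nowhere either and is a
  frame.\<close>

lemma pullback_iso_pull: "pullback_iso X Y pt_map pull (twisting_sheaf gr1 1) (twisting_sheaf gr2 l)"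
  unfolding pullback_iso_def
proof (intro conjI exI allI impI)
  show "line_bundle Y (twisting_sheaf gr1 1)"
    by (rule A.line_bundle_twisting_sheaf[OF degree_one_cover])
  show "hom_over X Y pt_map pull (twisting_sheaf gr1 1) (twisting_sheaf gr2 l) pull"
    unfolding hom_over_def
    using pull_sections[of _ _ 1] pull_add[of _ 1] pull_mult[of _ 0 _ _ 1] pull_restrict by simp
  fix V e assume "openin (top_of Y) V" and fr: "frame Y (twisting_sheaf gr1 1) V e"
  then have V: "openin (proj_top gr1) V" by simp
  have e: "e \<in> twist_sections gr1 1 V" using fr unfolding frame_def by simp
  show "frame X (twisting_sheaf gr2 l) (pre V) (pull V e)"
  proof (rule B.frame_twisting_sheafI[OF openin_preim[OF V]])
    show "pull V e \<in> twist_sections gr2 l (pre V)" using pull_sections[OF V e] by simp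
    fix P assume P: "P \<in> pre V"
    then have Q: "pt_map P \<in> V" by (simp add: preim_iff)
    obtain y where "y \<in> gr1 1" "y \<notin> pt_map P" using degree_one_cover[OF A.open_points[OF V Q]] by blast
    then have "A.nonvanishing 1 (e (pt_map P)) (pt_map P)" using A.frame_twisting_sheafD(2)[OF fr V Q] by blast
    then show "B.nonvanishing l (pull V e P) P" using pull_nonvanishing_iff[OF V e P] by simp
  qed
qed

end

section \<open>Weighted polynomial rings\<close>

lemma (in graded_domain) gr_prod:
  assumes "\<And>i. i \<in> A \<Longrightarrow> x i \<in> gr (d i)"
  shows "(\<Prod>i\<in>A. x i) \<in> gr (\<Sum>i\<in>A. d i)"
  using assms by (induction A rule: infinite_finite_induct) (auto intro: gr_mult)

definition wdeg :: "nat list \<Rightarrow> (nat \<Rightarrow>\<^sub>0 nat) \<Rightarrow> nat" where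
  "wdeg a m = (\<Sum>i<length a. a ! i * Poly_Mapping.lookup m i)"

lemma wdeg_add: "wdeg a (m + n) = wdeg a m + wdeg a n"
  by (simp add: wdeg_def lookup_add sum.distrib distrib_left)

lemma wdeg_zero [simp]: "wdeg a 0 = 0"
  by (simp add: wdeg_def)

lemma wdeg_single: "i < length a \<Longrightarrow> wdeg a (Poly_Mapping.single i n) = a ! i * n"
  by (simp add: wdeg_def lookup_single when_def if_distrib cong: if_cong)

lemma wpoly_part_iff:
  "f \<in> wpoly_part a d \<longleftrightarrow>
     (\<forall>m\<in>Poly_Mapping.keys f. Poly_Mapping.keys m \<subseteq> {..<length a} \<and> wdeg a m = d)"
  by (simp add: wpoly_part_def wdeg_def)

lemma single_in_wpoly_part:
  "Poly_Mapping.keys m \<subseteq> {..<length a} \<Longrightarrow> wdeg a m = d \<Longrightarrow> Poly_Mapping.single m c \<in> wpoly_part a d"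
  by (auto simp: wpoly_part_iff)

lemma keys_add_nat: "Poly_Mapping.keys ((m :: nat \<Rightarrow>\<^sub>0 nat) + n) = Poly_Mapping.keys m \<union> Poly_Mapping.keys n"
  by (auto simp: in_keys_iff lookup_add)

lemma graded_domain_wpoly_part: "graded_domain (wpoly_part a :: nat \<Rightarrow> 'k::field npoly set)"
proof
  fix x y :: "'k npoly" and d e
  show "x + y \<in> wpoly_part a d" if "x \<in> wpoly_part a d" "y \<in> wpoly_part a d"
    using that Poly_Mapping.keys_add[of x y] unfolding wpoly_part_iff by blast
  show "- x \<in> wpoly_part a d" if "x \<in> wpoly_part a d"
    using that by (simp add: wpoly_part_iff in_keys_iff)
  show "x * y \<in> wpoly_part a (d + e)" if x: "x \<in> wpoly_part a d" and y: "y \<in> wpoly_part a e"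
    unfolding wpoly_part_iff
  proof
    fix m assume "m \<in> Poly_Mapping.keys (x * y)"
    then obtain m1 m2 where m: "m = m1 + m2" "m1 \<in> Poly_Mapping.keys x" "m2 \<in> Poly_Mapping.keys y"
      using keys_mult[of x y] by blast
    then show "Poly_Mapping.keys m \<subseteq> {..<length a} \<and> wdeg a m = d + e"
      using x y unfolding wpoly_part_iff by (simp add: keys_add_nat wdeg_add)
  qed
  fix c :: "nat \<Rightarrow> 'k npoly" and D
  assume c: "\<And>d. c d \<in> wpoly_part a d" and s: "(\<Sum>d\<le>D. c d) = 0" and d: "d \<le> D"
  show "c d = 0"
  proof (rule ccontr)
    assume "c d \<noteq> 0"
    then obtain m where m: "m \<in> Poly_Mapping.keys (c d)" by (metis keys_eq_empty ex_in_conv)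
    have "Poly_Mapping.lookup (c e) m = 0" if "e \<noteq> d" for e
      using c[of e] c[of d] m that unfolding wpoly_part_iff by (metis in_keys_iff)
    then have "(\<Sum>e\<le>D. Poly_Mapping.lookup (c e) m) = (\<Sum>e\<in>{d}. Poly_Mapping.lookup (c e) m)"
      using d by (intro sum.mono_neutral_right) auto
    then have "Poly_Mapping.lookup (\<Sum>d\<le>D. c d) m = Poly_Mapping.lookup (c d) m" by (simp add: lookup_sum)
    then show False using s m by (simp add: in_keys_iff)
  qed
qed (auto simp: wpoly_part_iff)

global_interpretation wpoly: graded_domain "wpoly_part a :: nat \<Rightarrow> 'k::field npoly set" for a
  by (rule graded_domain_wpoly_part)

lemma sum_singles:
  "f = (\<Sum>m\<in>Poly_Mapping.keys f. Poly_Mapping.single m (Poly_Mapping.lookup f m))"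
proof (rule poly_mapping_eqI)
  fix n
  have "(\<Sum>m\<in>Poly_Mapping.keys f. Poly_Mapping.lookup (Poly_Mapping.single m (Poly_Mapping.lookup f m)) n) =
    (\<Sum>m\<in>Poly_Mapping.keys f. if m = n then Poly_Mapping.lookup f n else 0)"
    by (intro sum.cong) (auto simp: lookup_single when_def)
  then show "Poly_Mapping.lookup f n =
    Poly_Mapping.lookup (\<Sum>m\<in>Poly_Mapping.keys f. Poly_Mapping.single m (Poly_Mapping.lookup f m)) n"
    by (simp add: lookup_sum in_keys_iff)
qed

lemma single_mult_eq_sum:
  "Poly_Mapping.single n c * f =
     (\<Sum>m\<in>Poly_Mapping.keys f. Poly_Mapping.single (n + m) (c * Poly_Mapping.lookup f m))"
  by (subst (1) sum_singles[of f]) (simp add: sum_distrib_left mult_single)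

lemma lookup_monomial_mult:
  fixes f :: "'k::field npoly"
  shows "Poly_Mapping.lookup (Poly_Mapping.single n 1 * f) (n + m) = Poly_Mapping.lookup f m"
proof -
  have "(\<Sum>m'\<in>Poly_Mapping.keys f. Poly_Mapping.lookup (Poly_Mapping.single (n + m') (Poly_Mapping.lookup f m')) (n + m)) =
    (\<Sum>m'\<in>Poly_Mapping.keys f. if m' = m then Poly_Mapping.lookup f m else 0)"
    by (intro sum.cong) (auto simp: lookup_single when_def)
  then show ?thesis by (simp add: single_mult_eq_sum lookup_sum in_keys_iff)
qed

lemma keys_monomial_mult:
  fixes f :: "'k::field npoly"
  shows "Poly_Mapping.keys (Poly_Mapping.single n 1 * f) = (+) n ` Poly_Mapping.keys f"
proof
  show "Poly_Mapping.keys (Poly_Mapping.single n 1 * f) \<subseteq> (+) n ` Poly_Mapping.keys f"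
    using keys_mult[of "Poly_Mapping.single n 1" f] by auto
  show "(+) n ` Poly_Mapping.keys f \<subseteq> Poly_Mapping.keys (Poly_Mapping.single n 1 * f)"
    by (auto simp: in_keys_iff lookup_monomial_mult)
qed

abbreviation pvar :: "nat \<Rightarrow> 'k::field npoly" where
  "pvar i \<equiv> Poly_Mapping.single (Poly_Mapping.single i (Suc 0)) 1"

lemma pvar_in: "i < length a \<Longrightarrow> a ! i = d \<Longrightarrow> pvar i \<in> wpoly_part a d"
  by (rule single_in_wpoly_part) (auto simp: wdeg_single)

lemma pvar_power: "(pvar i :: 'k::field npoly) ^ n = Poly_Mapping.single (Poly_Mapping.single i n) 1"
  by (induction n) (simp_all add: mult_single flip: single_add)

lemma monomial_split:
  fixes m :: "nat \<Rightarrow>\<^sub>0 nat"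
  assumes "i \<in> Poly_Mapping.keys m"
  shows "m = Poly_Mapping.single i 1 + (m - Poly_Mapping.single i 1)"
  using assms by (intro poly_mapping_eqI) (auto simp: lookup_add lookup_minus lookup_single when_def in_keys_iff)

text \<open>Every monomial of positive degree has a variable as a factor, so a prime with all
  variables would contain all elements of positive degree.\<close>

lemma point_avoids_pvar:
  assumes P: "P \<in> proj_points (wpoly_part a :: nat \<Rightarrow> 'k::field npoly set)"
  obtains i where "i < length a" "pvar i \<notin> P"
proof (rule ccontr)
  assume "\<not> thesis"
  then have all: "pvar i \<in> P" if "i < length a" for i using that \<open>\<And>i. i < length a \<Longrightarrow> pvar i \<notin> P \<Longrightarrow> thesis\<close> by blast
  obtain d f where f: "d \<ge> 1" "f \<in> wpoly_part a d" "f \<notin> P"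
    using wpoly.hprime_nontrivial[OF wpoly.hprime_point[OF P]] by auto
  have "Poly_Mapping.single m (Poly_Mapping.lookup f m) \<in> P" if m: "m \<in> Poly_Mapping.keys f" for m
  proof -
    have m': "Poly_Mapping.keys m \<subseteq> {..<length a}" "wdeg a m = d" using f m unfolding wpoly_part_iff by auto
    then have "m \<noteq> 0" using f(1) by auto
    then obtain i where i: "i \<in> Poly_Mapping.keys m" by (metis keys_eq_empty ex_in_conv)
    let ?n = "m - Poly_Mapping.single i 1"
    have split: "m = Poly_Mapping.single i 1 + ?n" using monomial_split[OF i] .
    have "Poly_Mapping.keys ?n \<subseteq> {..<length a}"
      using keys_add_nat[of "Poly_Mapping.single i 1" ?n] split m'(1) by simp
    then have "Poly_Mapping.single ?n (Poly_Mapping.lookup f m) \<in> wpoly_part a (wdeg a ?n)"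
      by (rule single_in_wpoly_part) simp
    moreover have il: "i < length a" using i m'(1) by auto
    ultimately have "pvar i * Poly_Mapping.single ?n (Poly_Mapping.lookup f m) \<in> P"
      using wpoly.point_mult_iff[OF P pvar_in[OF il refl]] all[OF il] by blast
    then show ?thesis using split by (simp add: mult_single)
  qed
  then have "f \<in> P" by (subst sum_singles) (rule wpoly.point_sum[OF P])
  then show False using f(3) by blast
qed

section \<open>Evaluation of polynomials at polynomials\<close>

definition mev :: "(nat \<Rightarrow> 'k::field npoly) \<Rightarrow> (nat \<Rightarrow>\<^sub>0 nat) \<Rightarrow> 'k npoly" where
  "mev v m = (\<Prod>i\<in>Poly_Mapping.keys m. v i ^ Poly_Mapping.lookup m i)"

definition ev :: "(nat \<Rightarrow> 'k::field npoly) \<Rightarrow> 'k npoly \<Rightarrow> 'k npoly" where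
  "ev v f = (\<Sum>m\<in>Poly_Mapping.keys f. Poly_Mapping.single 0 (Poly_Mapping.lookup f m) * mev v m)"

lemma mev_superset:
  "finite A \<Longrightarrow> Poly_Mapping.keys m \<subseteq> A \<Longrightarrow> mev v m = (\<Prod>i\<in>A. v i ^ Poly_Mapping.lookup m i)"
  unfolding mev_def by (rule prod.mono_neutral_left) (auto simp: in_keys_iff)

lemma mev_add: "mev v (m + n) = mev v m * mev v n"
proof -
  let ?A = "Poly_Mapping.keys m \<union> Poly_Mapping.keys n"
  have "mev v (m + n) = (\<Prod>i\<in>?A. v i ^ Poly_Mapping.lookup (m + n) i)"
    by (rule mev_superset) (auto simp: keys_add_nat)
  also have "\<dots> = (\<Prod>i\<in>?A. v i ^ Poly_Mapping.lookup m i) * (\<Prod>i\<in>?A. v i ^ Poly_Mapping.lookup n i)"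
    by (simp add: lookup_add power_add prod.distrib)
  also have "\<dots> = mev v m * mev v n"
    by (simp add: mev_superset[of ?A])
  finally show ?thesis .
qed

lemma ev_superset:
  "finite A \<Longrightarrow> Poly_Mapping.keys f \<subseteq> A \<Longrightarrow>
     ev v f = (\<Sum>m\<in>A. Poly_Mapping.single 0 (Poly_Mapping.lookup f m) * mev v m)"
  unfolding ev_def by (rule sum.mono_neutral_left) (auto simp: in_keys_iff)

lemma ev_add: "ev v (f + g) = ev v f + ev v g"
proof -
  let ?A = "Poly_Mapping.keys f \<union> Poly_Mapping.keys g"
  have "ev v (f + g) = (\<Sum>m\<in>?A. Poly_Mapping.single 0 (Poly_Mapping.lookup (f + g) m) * mev v m)"
    by (rule ev_superset) (auto simp: Poly_Mapping.keys_add)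
  also have "\<dots> = ev v f + ev v g"
    by (simp add: ev_superset[of ?A] lookup_add single_add distrib_right sum.distrib)
  finally show ?thesis .
qed

lemma ev_zero [simp]: "ev v 0 = 0"
  by (simp add: ev_def)

lemma ev_sum: "ev v (\<Sum>i\<in>A. f i) = (\<Sum>i\<in>A. ev v (f i))"
  by (induction A rule: infinite_finite_induct) (simp_all add: ev_add)

lemma ev_single: "ev v (Poly_Mapping.single m c) = Poly_Mapping.single 0 c * mev v m"
  by (cases "c = 0") (simp_all add: ev_def)

lemma ev_const [simp]: "ev v (Poly_Mapping.single 0 c) = Poly_Mapping.single 0 c"
  by (simp add: ev_single mev_def)

lemma ev_one [simp]: "ev v 1 = 1"
  using ev_const[of v 1] by simp

lemma ev_pvar [simp]: "ev v (pvar i) = v i"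
  by (simp add: ev_single mev_def)

lemma ev_mult: "ev v (f * g) = ev v f * ev v g"
proof -
  have single: "ev v (Poly_Mapping.single m c * Poly_Mapping.single n d) =
    ev v (Poly_Mapping.single m c) * ev v (Poly_Mapping.single n d)" for m n c d
  proof -
    have "Poly_Mapping.single 0 (c * d) = (Poly_Mapping.single 0 c * Poly_Mapping.single 0 d :: 'a npoly)"
      by (simp add: mult_single)
    then show ?thesis by (simp add: mult_single ev_single mev_add ac_simps)
  qed
  let ?s = "\<lambda>f. \<Sum>m\<in>Poly_Mapping.keys f. Poly_Mapping.single m (Poly_Mapping.lookup f m)"
  have "ev v (?s f * ?s g) = ev v (?s f) * ev v (?s g)"
    by (simp only: sum_product ev_sum single)
  then show ?thesis by (simp only: sum_singles[symmetric])
qed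

lemma ev_power: "ev v (f ^ n) = ev v f ^ n"
  by (induction n) (simp_all add: ev_mult)

text \<open>The grading of the values is left arbitrary in order to cover both the full polynomial
  ring and the subring without terms linear in \<open>x\<^sub>0\<close>.\<close>

lemma ev_graded:
  fixes gr :: "nat \<Rightarrow> 'k::field npoly set"
  assumes "graded_domain gr" and const: "\<And>c. Poly_Mapping.single 0 c \<in> gr 0"
    and v: "\<And>i. i < length a \<Longrightarrow> v i \<in> gr (l * a ! i)" and f: "f \<in> wpoly_part a d"
  shows "ev v f \<in> gr (l * d)"
proof -
  interpret graded_domain gr by fact
  have "Poly_Mapping.single 0 (Poly_Mapping.lookup f m) * mev v m \<in> gr (l * d)"
    if m: "m \<in> Poly_Mapping.keys f" for m
  proof -
    have m': "Poly_Mapping.keys m \<subseteq> {..<length a}" "wdeg a m = d" using f m unfolding wpoly_part_iff by auto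
    have "(\<Prod>i<length a. v i ^ Poly_Mapping.lookup m i) \<in> gr (\<Sum>i<length a. Poly_Mapping.lookup m i * (l * a ! i))"
      using v by (intro gr_prod gr_power) auto
    moreover have "(\<Sum>i<length a. Poly_Mapping.lookup m i * (l * a ! i)) = l * d"
      unfolding m'(2)[symmetric] wdeg_def sum_distrib_left by (intro sum.cong) auto
    ultimately have "mev v m \<in> gr (l * d)" using mev_superset[OF _ m'(1), of v] by simp
    then show ?thesis using gr_mult[OF const] by fastforce
  qed
  then show ?thesis unfolding ev_def by (rule gr_sum)
qed

lemma const_in_wpoly_part [simp]: "Poly_Mapping.single 0 c \<in> wpoly_part a 0"
  by (rule single_in_wpoly_part) auto

text \<open>A power of a different variable leaves the exponent of \<open>i\<close> unchanged, so
  comparing monomials shows that \<open>pvar i ^ s\<close> divides every term of \<open>f\<close>.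
  This replaces unique factorization.\<close>

lemma monomial_dvd:
  fixes f g :: "'k::field npoly"
  assumes eq: "pvar j ^ r * f = pvar i ^ s * g" and "i \<noteq> j" and f: "f \<in> wpoly_part a (s * a ! i + n)"
    and i: "i < length a"
  obtains f' where "f' \<in> wpoly_part a n" "f = pvar i ^ s * f'"
proof -
  let ?e = "Poly_Mapping.single i s"
  define f' where "f' = (\<Sum>m\<in>Poly_Mapping.keys f. Poly_Mapping.single (m - ?e) (Poly_Mapping.lookup f m))"
  have split: "m = ?e + (m - ?e)" if m: "m \<in> Poly_Mapping.keys f" for m
  proof -
    have "(+) (Poly_Mapping.single j r) ` Poly_Mapping.keys f = (+) ?e ` Poly_Mapping.keys g"
      using arg_cong[OF eq, of Poly_Mapping.keys] by (simp only: pvar_power keys_monomial_mult)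
    then have "Poly_Mapping.single j r + m \<in> (+) ?e ` Poly_Mapping.keys g" using m by blast
    then obtain m' where "Poly_Mapping.single j r + m = ?e + m'" by blast
    then have "Poly_Mapping.lookup (Poly_Mapping.single j r + m) i = Poly_Mapping.lookup (?e + m') i" by simp
    then have "Poly_Mapping.lookup m i \<ge> s" using \<open>i \<noteq> j\<close> by (simp add: lookup_add lookup_single when_def)
    then show ?thesis
      by (intro poly_mapping_eqI) (auto simp: lookup_add lookup_minus lookup_single when_def)
  qed
  have "pvar i ^ s * f' = (\<Sum>m\<in>Poly_Mapping.keys f. Poly_Mapping.single (?e + (m - ?e)) (Poly_Mapping.lookup f m))"
    unfolding f'_def pvar_power sum_distrib_left mult_single by simp
  also have "\<dots> = (\<Sum>m\<in>Poly_Mapping.keys f. Poly_Mapping.single m (Poly_Mapping.lookup f m))"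
    using split by (intro sum.cong) auto
  finally have ff': "f = pvar i ^ s * f'" by (simp add: sum_singles[symmetric])
  have "f' \<in> wpoly_part a n"
    unfolding f'_def
  proof (rule wpoly.gr_sum, rule single_in_wpoly_part)
    fix m assume m: "m \<in> Poly_Mapping.keys f"
    have m': "Poly_Mapping.keys m \<subseteq> {..<length a}" "wdeg a m = s * a ! i + n"
      using f m unfolding wpoly_part_iff by auto
    have "Poly_Mapping.keys m = Poly_Mapping.keys ?e \<union> Poly_Mapping.keys (m - ?e)"
      using split[OF m] keys_add_nat[of ?e "m - ?e"] by simp
    then show "Poly_Mapping.keys (m - ?e) \<subseteq> {..<length a}" using m'(1) by blast
    have "wdeg a m = a ! i * s + wdeg a (m - ?e)"
      using split[OF m] wdeg_add[of a ?e "m - ?e"] wdeg_single[OF i, of s] by simp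
    then show "wdeg a (m - ?e) = n" using m'(2) by simp
  qed
  then show thesis using ff' that by blast
qed

lemma monomial_nonzero [simp]: "Poly_Mapping.single m 1 \<noteq> (0 :: 'k::field npoly)"
  by (metis lookup_single_eq lookup_zero zero_neq_one)

text \<open>A global section can be written with a power of \<open>x\<^sub>0\<close> and also with a
  power of \<open>x\<^sub>1\<close> as denominator; as these are different variables, the
  denominator cancels.\<close>

lemma global_sections_wpoly:
  fixes s :: "'k::field npoly set \<Rightarrow> 'k npoly fract" and P :: "'k npoly set"
  assumes a: "length a \<ge> 2" "\<And>i. i < length a \<Longrightarrow> a ! i \<ge> 1"
    and s: "s \<in> twist_sections (wpoly_part a) n (proj_points (wpoly_part a))"
    and P: "P \<in> proj_points (wpoly_part a)"
  obtains \<sigma> where "\<sigma> \<in> wpoly_part a n" "\<And>Q. Q \<in> proj_points (wpoly_part a) \<Longrightarrow> s Q = Fract \<sigma> 1"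
proof -
  have lt: "0 < length a" "1 < length a" using a(1) by auto
  obtain k f where f: "f \<in> wpoly_part a (k * a ! 0 + n)" "s P * Fract (pvar 0 ^ k) 1 = Fract f 1"
    using wpoly.global_section_power_denominator[OF s P pvar_in[OF lt(1) refl] a(2)[OF lt(1)]] by blast
  obtain r g where g: "g \<in> wpoly_part a (r * a ! 1 + n)" "s P * Fract (pvar 1 ^ r) 1 = Fract g 1"
    using wpoly.global_section_power_denominator[OF s P pvar_in[OF lt(2) refl] a(2)[OF lt(2)]] by blast
  have "Fract (pvar 1 ^ r) 1 * (s P * Fract (pvar 0 ^ k) 1) = Fract (pvar 0 ^ k) 1 * (s P * Fract (pvar 1 ^ r) 1)"
    by (simp only: ac_simps)
  then have "pvar 1 ^ r * f = pvar 0 ^ k * g"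
    unfolding f(2) g(2) by (simp add: eq_fract)
  then obtain \<sigma> where \<sigma>: "\<sigma> \<in> wpoly_part a n" "f = pvar 0 ^ k * \<sigma>"
    by (rule monomial_dvd) (use f lt in auto)
  have nz: "Fract (pvar 0 ^ k) 1 \<noteq> (0 :: 'k npoly fract)" by (simp add: Zero_fract_def eq_fract)
  have "s P * Fract (pvar 0 ^ k) 1 = Fract \<sigma> 1 * Fract (pvar 0 ^ k) 1"
    unfolding f(2) \<sigma>(2) by (simp add: mult.commute)
  then have "s P = Fract \<sigma> 1" by (simp only: mult_right_cancel[OF nz])
  moreover have "s Q = s P" if "Q \<in> proj_points (wpoly_part a)" for Q
    using wpoly.twist_sections_constant[OF _ s that P] openin_topspace[of "proj_top (wpoly_part a)"] by simp
  ultimately show thesis using that \<sigma>(1) by simp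
qed

section \<open>Functions near a point of a closed immersion\<close>

text \<open>The map \<open>\<theta>\<close> turns the coordinates into global sections
  \<open>\<sigma> i\<close> of \<open>O(l)\<close>, and linearity over \<open>h\<close> then
  determines \<open>h\<close> on chart functions as evaluation at \<open>\<sigma>\<close>.
  Surjectivity of the sheaf map writes any germ \<open>u\<close> at \<open>P\<close> as the image of
  a fraction \<open>a / b\<close> of forms of equal degree.\<close>

lemma closed_immersion_local_fraction:
  fixes gr :: "nat \<Rightarrow> 'k::field npoly set" and N :: nat
    and f :: "'k npoly set \<Rightarrow> 'k npoly set"
    and h :: "'k npoly set set \<Rightarrow> ('k npoly set \<Rightarrow> 'k npoly fract) \<Rightarrow> 'k npoly set \<Rightarrow> 'k npoly fract"
  defines "X \<equiv> Proj (Poly_Mapping.single 0) gr"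
    and "w \<equiv> replicate (N + 1) (1 :: nat)"
  defines "Y \<equiv> Proj (Poly_Mapping.single 0 :: 'k \<Rightarrow> _) (wpoly_part w)"
  assumes gr: "graded_domain gr" and const: "\<And>c. Poly_Mapping.single 0 c \<in> gr 0"
    and ci: "closed_immersion X Y f h"
    and pb: "pullback_iso X Y f h (twisting_sheaf (wpoly_part w) 1) (twisting_sheaf gr l)"
    and global: "\<And>s. s \<in> twist_sections gr l (proj_points gr) \<Longrightarrow>
      \<exists>\<sigma>\<in>gr l. \<forall>P\<in>proj_points gr. s P = Fract \<sigma> 1"
    and P: "P \<in> proj_points gr" and y: "y \<in> gr l" "y \<notin> P"
    and U: "openin (proj_top gr) U" "P \<in> U" and u: "u \<in> twist_sections gr 0 U"
  obtains \<sigma> d a b where "\<And>i. i < N + 1 \<Longrightarrow> \<sigma> i \<in> gr l" "a \<in> wpoly_part w d" "b \<in> wpoly_part w d"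
    "ev \<sigma> b \<notin> P" "u P = Fract (ev \<sigma> a) (ev \<sigma> b)"
proof -
  interpret B: graded_domain gr by fact
  define pre where "pre = preim X f"
  let ?A = "wpoly_part w :: nat \<Rightarrow> 'k npoly set"
  have lm: "ringed_morphism X Y f h" and emb: "embedding_map (proj_top gr) (proj_top ?A) f"
    using ci unfolding closed_immersion_def local_morphism_def by (simp_all add: X_def Y_def)
  have cont: "continuous_map (proj_top gr) (proj_top ?A) f"
    using lm unfolding ringed_morphism_def by (simp add: X_def Y_def)
  have pre_iff: "R \<in> pre V \<longleftrightarrow> R \<in> proj_points gr \<and> f R \<in> V" for R V
    by (simp add: pre_def preim_def X_def)
  have pre_open: "openin (proj_top gr) (pre V)" if "openin (proj_top ?A) V" for V
  proof -
    have "pre V = {R \<in> topspace (proj_top gr). f R \<in> V}" by (auto simp: pre_iff)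
    then show ?thesis using openin_continuous_map_preimage[OF cont that] by simp
  qed
  have pre_mono: "pre W \<subseteq> pre V" if "W \<subseteq> V" for W V using that by (auto simp: pre_iff)
  have h_hom: "h V \<in> ring_hom (ring_of Y V) (ring_of X (pre V))" if "openin (proj_top ?A) V" for V
    using lm that unfolding ringed_morphism_def pre_def by (simp add: Y_def)
  have h_mem: "h V t \<in> twist_sections gr 0 (pre V)" if "openin (proj_top ?A) V" "t \<in> twist_sections ?A 0 V" for V t
    using ring_hom_closed[OF h_hom[OF that(1)], of t] that(2) by (simp add: X_def Y_def)
  have h_mult: "h V (\<lambda>Q\<in>V. s Q * t Q) R = h V s R * h V t R"
    if "openin (proj_top ?A) V" "s \<in> twist_sections ?A 0 V" "t \<in> twist_sections ?A 0 V" "R \<in> pre V" for V s t R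
    using ring_hom_mult[OF h_hom[OF that(1)], of s t] that by (simp add: X_def Y_def)
  have h_add: "h V (\<lambda>Q\<in>V. s Q + t Q) R = h V s R + h V t R"
    if "openin (proj_top ?A) V" "s \<in> twist_sections ?A 0 V" "t \<in> twist_sections ?A 0 V" "R \<in> pre V" for V s t R
    using ring_hom_add[OF h_hom[OF that(1)], of s t] that by (simp add: X_def Y_def)
  have h_const: "h V (\<lambda>Q\<in>V. Fract (Poly_Mapping.single 0 c) 1) R = Fract (Poly_Mapping.single 0 c) 1"
    if "openin (proj_top ?A) V" "R \<in> pre V" for V c R
    using lm that unfolding ringed_morphism_def pre_def by (simp add: X_def Y_def)
  have h_one: "h V (\<lambda>Q\<in>V. 1) R = 1" if "openin (proj_top ?A) V" "R \<in> pre V" for V R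
    using h_const[OF that, of 1] by (simp add: One_fract_def)
  have h_res: "h W (restrict t W) = restrict (h V t) (pre W)"
    if "openin (proj_top ?A) V" "openin (proj_top ?A) W" "W \<subseteq> V" "t \<in> twist_sections ?A 0 V" for V W t
    using lm that unfolding ringed_morphism_def pre_def by (simp add: X_def Y_def)
  obtain \<theta> where hom: "hom_over X Y f h (twisting_sheaf ?A 1) (twisting_sheaf gr l) \<theta>"
    and fr: "\<And>V e. openin (proj_top ?A) V \<Longrightarrow> frame Y (twisting_sheaf ?A 1) V e \<Longrightarrow>
      frame X (twisting_sheaf gr l) (pre V) (\<theta> V e)"
    using pb unfolding pullback_iso_def pre_def by (auto simp: Y_def)
  have \<theta>_mem: "\<theta> V m \<in> twist_sections gr l (pre V)"
    if "openin (proj_top ?A) V" "m \<in> twist_sections ?A 1 V" for V m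
    using hom that unfolding hom_over_def pre_def by (simp add: X_def Y_def)
  have \<theta>_smult: "\<theta> V (\<lambda>Q\<in>V. t Q * m Q) R = h V t R * \<theta> V m R"
    if "openin (proj_top ?A) V" "m \<in> twist_sections ?A 1 V" "t \<in> twist_sections ?A 0 V" "R \<in> pre V" for V m t R
    using hom that unfolding hom_over_def pre_def by (simp add: X_def Y_def)
  have \<theta>_res: "\<theta> W (restrict m W) = restrict (\<theta> V m) (pre W)"
    if "openin (proj_top ?A) V" "openin (proj_top ?A) W" "W \<subseteq> V" "m \<in> twist_sections ?A 1 V" for V W m
    using hom that unfolding hom_over_def pre_def by (simp add: X_def Y_def)

  have ci_lift: "\<exists>W t. openin (proj_top ?A) W \<and> Q \<in> W \<and> W \<subseteq> V \<and> t \<in> twist_sections ?A 0 W \<and>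
      h W t = restrict s (pre W)"
    if "openin (proj_top ?A) V" "s \<in> twist_sections gr 0 (pre V)" "Q \<in> V" for V s Q
    using ci that unfolding closed_immersion_def pre_def by (simp add: X_def Y_def)

  let ?Y = "proj_points ?A"
  have Yo: "openin (proj_top ?A) ?Y" using openin_topspace[of "proj_top ?A"] by simp
  have fP: "f R \<in> ?Y" if "R \<in> proj_points gr" for R
    using cont that unfolding continuous_map_def by auto
  have preY: "pre ?Y = proj_points gr" using fP by (auto simp: pre_iff)
  have len: "length w = N + 1" by (simp add: w_def)
  have var: "pvar i \<in> ?A 1" if "i < N + 1" for i
    using that by (intro pvar_in) (simp_all add: w_def del: replicate_Suc)
  define Ys where "Ys i V = (\<lambda>Q\<in>V. Fract (pvar i :: 'k npoly) 1)" for i and V :: "'k npoly set set"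
  have Ys: "Ys i V \<in> twist_sections ?A 1 V" if "i < N + 1" "openin (proj_top ?A) V" for i V
    unfolding Ys_def by (rule wpoly.twist_sections_const[OF that(2) var[OF that(1)]])
  have "\<exists>\<sigma>\<in>gr l. \<forall>P\<in>proj_points gr. \<theta> ?Y (Ys i ?Y) P = Fract \<sigma> 1" if "i < N + 1" for i
    using global[of "\<theta> ?Y (Ys i ?Y)"] \<theta>_mem[OF Yo Ys[OF that Yo]] preY by simp
  then obtain \<sigma> where \<sigma>: "\<And>i. i < N + 1 \<Longrightarrow> \<sigma> i \<in> gr l"
    "\<And>i R. i < N + 1 \<Longrightarrow> R \<in> proj_points gr \<Longrightarrow> \<theta> ?Y (Ys i ?Y) R = Fract (\<sigma> i) 1"
    by metis
  have \<theta>Ys: "\<theta> V (Ys i V) R = Fract (\<sigma> i) 1"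
    if V: "openin (proj_top ?A) V" and "i < N + 1" "R \<in> pre V" for V i R
  proof -
    have sub: "V \<subseteq> ?Y" using wpoly.open_points[OF V] by blast
    have "restrict (Ys i ?Y) V = Ys i V" unfolding Ys_def using sub by (auto simp: fun_eq_iff restrict_def)
    then have "\<theta> V (Ys i V) = restrict (\<theta> ?Y (Ys i ?Y)) (pre V)"
      using \<theta>_res[OF Yo V sub Ys[OF that(2) Yo]] by simp
    then show ?thesis using \<sigma>(2)[OF that(2)] that(3) by (simp add: pre_iff)
  qed

  obtain j where j: "j < N + 1" "pvar j \<notin> f P"
    using point_avoids_pvar[OF fP[OF P]] unfolding len by blast
  let ?D = "wpoly.basic_open w (pvar j) :: 'k npoly set set"
  have Do: "openin (proj_top ?A) ?D" by (rule wpoly.openin_basic_open[OF var[OF j(1)]])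
  have PD: "P \<in> pre ?D" using P j(2) fP[OF P] by (simp add: pre_iff)
  have "frame Y (twisting_sheaf ?A 1) ?D (Ys j ?D)"
    unfolding Y_def
  proof (rule wpoly.frame_twisting_sheafI[OF Do Ys[OF j(1) Do]])
    show "wpoly.nonvanishing w 1 (Ys j ?D Q) Q" if "Q \<in> ?D" for Q
      using wpoly.nonvanishing_fraction_iff[of Q w "pvar j" 0 1 1] that var[OF j(1)] wpoly.point_one[of Q w]
      by (simp add: Ys_def)
  qed
  \<comment> \<open>\<open>\<theta>\<close> sends the frame \<open>x\<^sub>j\<close> of
    \<open>O(1)\<close> to a frame of \<open>O(l)\<close>, which cannot vanish at \<open>P\<close>
    because the section \<open>y\<close> does not.\<close>
  then have "B.nonvanishing l (\<theta> ?D (Ys j ?D) P) P"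
    using B.frame_twisting_sheafD(2)[OF fr[OF Do, unfolded X_def] pre_open[OF Do] PD y] by blast
  then have "B.nonvanishing l (Fract (\<sigma> j) 1) P" using \<theta>Ys[OF Do j(1) PD] by simp
  then have \<sigma>j: "\<sigma> j \<notin> P"
    using B.nonvanishing_fraction_iff[OF P, of "\<sigma> j" 0 l 1] \<sigma>(1)[OF j(1)] B.point_one[OF P] by simp
  then have \<sigma>j0: "\<sigma> j \<noteq> 0" using B.not_point_nonzero[OF P] by blast
  have jpow: "pvar j ^ d \<notin> Q" if "Q \<in> ?D" for d Q
    using wpoly.point_power_iff[OF _ var[OF j(1)], of Q d] that by auto

  define q where "q g d V = (\<lambda>Q\<in>V. Fract g (pvar j ^ d))" for g :: "'k npoly" and d and V :: "'k npoly set set"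
  have q: "q g d V \<in> twist_sections ?A 0 V" if "openin (proj_top ?A) V" "V \<subseteq> ?D" "g \<in> ?A d" for g d V
    unfolding q_def
  proof (rule wpoly.twist_sections_fraction[OF that(1), of g d 0 "pvar j ^ d"])
    show "pvar j ^ d \<notin> Q" if "Q \<in> V" for Q using jpow that \<open>V \<subseteq> ?D\<close> by blast
    show "pvar j ^ d \<in> ?A d" using wpoly.gr_power[OF var[OF j(1)], of d] by simp
  qed (use that in simp)
  have hq: "h V (q g d V) R = Fract (ev \<sigma> g) (\<sigma> j ^ d)"
    if V: "openin (proj_top ?A) V" "V \<subseteq> ?D" and g: "g \<in> ?A d" and R: "R \<in> pre V" for V R g d
  proof -
    have hvar: "h V (q (pvar i) 1 V) R = Fract (\<sigma> i) (\<sigma> j ^ 1)" if i: "i < N + 1" for i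
    proof -
      \<comment> \<open>Linearity of \<open>\<theta>\<close>, applied to
        \<open>x\<^sub>i = (x\<^sub>i / x\<^sub>j) x\<^sub>j\<close>, yields the value of
        \<open>h\<close> on \<open>x\<^sub>i / x\<^sub>j\<close>. Products and sums then extend it
        to all forms over powers of \<open>x\<^sub>j\<close>.\<close>
      have "(\<lambda>Q\<in>V. q (pvar i) 1 V Q * Ys j V Q) = Ys i V"
        by (auto simp: q_def Ys_def fun_eq_iff restrict_def eq_fract)
      then have "Fract (\<sigma> i) 1 = h V (q (pvar i) 1 V) R * Fract (\<sigma> j) 1"
        using \<theta>_smult[OF V(1) Ys[OF j(1) V(1)] q[OF V var[OF i]] R] \<theta>Ys[OF V(1) i R] \<theta>Ys[OF V(1) j(1) R]
        by simp
      then have "h V (q (pvar i) 1 V) R = Fract (\<sigma> i) 1 / Fract (\<sigma> j) 1"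
        using \<sigma>j0 by (simp add: nonzero_eq_divide_eq Zero_fract_def eq_fract)
      then show ?thesis by simp
    qed
    have hmult: "h V (q (g1 * g2) (d1 + d2) V) R = h V (q g1 d1 V) R * h V (q g2 d2 V) R"
      if "g1 \<in> ?A d1" "g2 \<in> ?A d2" for g1 g2 d1 d2
    proof -
      have "q (g1 * g2) (d1 + d2) V = (\<lambda>Q\<in>V. q g1 d1 V Q * q g2 d2 V Q)"
        by (auto simp: q_def fun_eq_iff restrict_def power_add)
      then show ?thesis using h_mult[OF V(1) q[OF V that(1)] q[OF V that(2)] R] by simp
    qed
    have hadd: "h V (q (g1 + g2) d V) R = h V (q g1 d V) R + h V (q g2 d V) R"
      if "g1 \<in> ?A d" "g2 \<in> ?A d" for g1 g2 d
    proof -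
      have "q (g1 + g2) d V = (\<lambda>Q\<in>V. q g1 d V Q + q g2 d V Q)"
        by (auto simp: q_def fun_eq_iff restrict_def eq_fract algebra_simps)
      then show ?thesis using h_add[OF V(1) q[OF V that(1)] q[OF V that(2)] R] by simp
    qed
    have hconst: "h V (q (Poly_Mapping.single 0 c) 0 V) R = Fract (Poly_Mapping.single 0 c) 1" for c
      using h_const[OF V(1) R, of c] by (simp add: q_def)
    have mono: "h V (q (Poly_Mapping.single m c) d V) R = Fract (ev \<sigma> (Poly_Mapping.single m c)) (\<sigma> j ^ d)"
      if "Poly_Mapping.keys m \<subseteq> {..<length w}" "wdeg w m = d" for m c d
      using that
    proof (induction d arbitrary: m)
      case 0
      have "m = 0"
      proof (rule ccontr)
        assume "m \<noteq> 0"
        then obtain i where i: "i \<in> Poly_Mapping.keys m" by (metis keys_eq_empty ex_in_conv)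
        then have "i < length w" "w ! i = 1" using 0(1) by (auto simp: w_def simp del: replicate_Suc)
        moreover from this have "w ! i * Poly_Mapping.lookup m i \<le> wdeg w m"
          unfolding wdeg_def by (intro member_le_sum) auto
        ultimately show False using 0(2) i by (simp add: in_keys_iff)
      qed
      then show ?case using hconst by simp
    next
      case (Suc d)
      have "m \<noteq> 0" using Suc.prems(2) by auto
      then obtain i where i: "i \<in> Poly_Mapping.keys m" by (metis keys_eq_empty ex_in_conv)
      let ?n = "m - Poly_Mapping.single i 1"
      have split: "m = Poly_Mapping.single i 1 + ?n" using monomial_split[OF i] .
      have il: "i < length w" using i Suc.prems(1) by auto
      then have iN: "i < N + 1" using len by simp
      have wi: "w ! i = 1" using il by (simp add: w_def del: replicate_Suc)
      have n1: "Poly_Mapping.keys ?n \<subseteq> {..<length w}"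
        using keys_add_nat[of "Poly_Mapping.single i 1" ?n] split Suc.prems(1) by simp
      have "wdeg w m = 1 + wdeg w ?n"
        using split wdeg_add[of w "Poly_Mapping.single i 1" ?n] wdeg_single[OF il, of 1] wi by simp
      then have n2: "wdeg w ?n = d" using Suc.prems(2) by simp
      have "Poly_Mapping.single m c = pvar i * Poly_Mapping.single ?n c"
        using split by (simp add: mult_single)
      then show ?case
        using hmult[OF var[OF iN] single_in_wpoly_part[OF n1 n2, of c]] Suc.IH[OF n1 n2] hvar[OF iN]
        by (simp add: ev_mult)
    qed
    have "h V (q (\<Sum>m\<in>M. Poly_Mapping.single m (Poly_Mapping.lookup g m)) d V) R =
      Fract (ev \<sigma> (\<Sum>m\<in>M. Poly_Mapping.single m (Poly_Mapping.lookup g m))) (\<sigma> j ^ d)"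
      if "M \<subseteq> Poly_Mapping.keys g" for M
      using finite_subset[OF that finite_keys] that
    proof (induction M rule: finite_induct)
      case empty
      have "q 0 d V = (\<lambda>Q\<in>V. Fract (Poly_Mapping.single 0 0) 1)"
        by (auto simp: q_def fun_eq_iff restrict_def eq_fract)
      then have "h V (q 0 d V) R = Fract 0 1" using h_const[OF V(1) R, of 0] by simp
      then show ?case using \<sigma>j0 by (simp add: eq_fract)
    next
      case (insert m M)
      have m: "Poly_Mapping.keys m \<subseteq> {..<length w}" "wdeg w m = d" if "m \<in> Poly_Mapping.keys g" for m
        using g that unfolding wpoly_part_iff by auto
      have "Poly_Mapping.single m' (Poly_Mapping.lookup g m') \<in> ?A d" if "m' \<in> insert m M" for m'
        using insert.prems that by (intro single_in_wpoly_part m) auto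
      then have mem: "Poly_Mapping.single m (Poly_Mapping.lookup g m) \<in> ?A d"
        "(\<Sum>m\<in>M. Poly_Mapping.single m (Poly_Mapping.lookup g m)) \<in> ?A d"
        by (auto intro: wpoly.gr_sum)
      have mk: "m \<in> Poly_Mapping.keys g" using insert.prems by simp
      show ?case
        using insert hadd[OF mem] mono[OF m[OF mk]] \<sigma>j0
        by (simp add: ev_add eq_fract algebra_simps)
    qed
    from this[of "Poly_Mapping.keys g"] show ?thesis by (simp add: sum_singles[symmetric])
  qed

  \<comment> \<open>The embedding induces the topology of the source, so \<open>U\<close> contains
    the preimage of a neighbourhood of \<open>f P\<close>.\<close>
  obtain T where T: "openin (proj_top ?A) T" "f P \<in> T" "pre T \<subseteq> U"
  proof -
    have hm: "homeomorphic_map (proj_top gr) (subtopology (proj_top ?A) (f ` proj_points gr)) f"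
      using emb unfolding embedding_map_def by simp
    have "openin (subtopology (proj_top ?A) (f ` proj_points gr)) (f ` U)"
      using homeomorphic_map_openness[OF hm, of U] U B.open_points[OF U(1)] by auto
    then obtain T where T: "openin (proj_top ?A) T" "f ` U = T \<inter> f ` proj_points gr"
      unfolding openin_subtopology by blast
    have inj: "inj_on f (proj_points gr)"
      using homeomorphic_imp_injective_map[OF hm] by simp
    have "R \<in> U" if "R \<in> pre T" for R
    proof -
      have "R \<in> proj_points gr" "f R \<in> f ` U" using that T(2) by (auto simp: pre_iff)
      then show ?thesis using inj B.open_points[OF U(1)] by (auto dest: inj_onD)
    qed
    then show thesis using that[OF T(1)] T(2) U(2) by blast
  qed
  let ?V = "T \<inter> ?D"
  have Vo: "openin (proj_top ?A) ?V" using T(1) Do by blast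
  have VU: "pre ?V \<subseteq> U" using T(3) by (auto simp: pre_iff)
  have ur: "restrict u (pre ?V) \<in> twist_sections gr 0 (pre ?V)"
    by (rule B.twist_sections_restrict[OF pre_open[OF Vo] VU u])
  have PV: "f P \<in> ?V" using T(2) PD by (simp add: pre_iff)
  obtain W t where W: "openin (proj_top ?A) W" "f P \<in> W" "W \<subseteq> ?V" "t \<in> twist_sections ?A 0 W"
    "h W t = restrict (restrict u (pre ?V)) (pre W)"
    using ci_lift[OF Vo ur PV] by blast
  obtain V d a b where V: "openin (proj_top ?A) V" "f P \<in> V" "V \<subseteq> W" "a \<in> ?A (d + 0)" "b \<in> ?A d"
    "\<And>Q. Q \<in> V \<Longrightarrow> b \<notin> Q" "\<And>Q. Q \<in> V \<Longrightarrow> t Q = Fract a b"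
    by (rule wpoly.twist_sectionsE[OF W(4,2)], rule that, assumption+)
  have VD: "V \<subseteq> ?D" using V(3) W(3) by blast
  have PV': "P \<in> pre V" using P V(2) by (simp add: pre_iff)
  have a: "a \<in> ?A d" using V(4) by simp
  have b0: "b \<noteq> 0" using V(2,6) wpoly.not_point_nonzero[OF fP[OF P]] by blast
  have tV: "restrict t V \<in> twist_sections ?A 0 V" by (rule wpoly.twist_sections_restrict[OF V(1,3) W(4)])
  have hb: "h V (q b d V) P = Fract (ev \<sigma> b) (\<sigma> j ^ d)" by (rule hq[OF V(1) VD V(5) PV'])
  have "h V (restrict t V) P = u P"
    using h_res[OF W(1) V(1,3) W(4)] W(5) PV' pre_mono[OF V(3)] pre_mono[OF W(3)] by auto
  \<comment> \<open>The value of \<open>h\<close> is known only for denominators that are powers of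
    \<open>x\<^sub>j\<close>; multiplying \<open>a / b\<close> by
    \<open>b / x\<^sub>j\<^sup>d\<close> reduces to that case.\<close>
  moreover have "(\<lambda>Q\<in>V. restrict t V Q * q b d V Q) = q a d V"
    using V(7) b0 by (auto simp: q_def fun_eq_iff restrict_def eq_fract)
  ultimately have uP: "u P * Fract (ev \<sigma> b) (\<sigma> j ^ d) = Fract (ev \<sigma> a) (\<sigma> j ^ d)"
    using h_mult[OF V(1) tV q[OF V(1) VD V(5)] PV'] hb hq[OF V(1) VD a PV'] by simp
  \<comment> \<open>The function \<open>b / x\<^sub>j\<^sup>d\<close> is invertible near
    \<open>f P\<close>. Its image is thus invertible at \<open>P\<close>, which keeps the numerator
    \<open>ev \<sigma> b\<close> outside \<open>P\<close>.\<close>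
  have "ev \<sigma> b \<notin> P"
  proof -
    let ?r = "\<lambda>Q\<in>V. Fract (pvar j ^ d) b"
    have r: "?r \<in> twist_sections ?A 0 V"
      using wpoly.twist_sections_fraction[OF V(1), of "pvar j ^ d" d 0 b] V(5,6)
        wpoly.gr_power[OF var[OF j(1)], of d] by simp
    have "(\<lambda>Q\<in>V. q b d V Q * ?r Q) = (\<lambda>Q\<in>V. 1)"
      using b0 by (auto simp: q_def fun_eq_iff restrict_def eq_fract One_fract_def)
    then have 1: "h V (q b d V) P * h V ?r P = 1"
      using h_mult[OF V(1) q[OF V(1) VD V(5)] r PV'] h_one[OF V(1) PV'] by simp
    obtain V' e a' b' where V': "openin (proj_top gr) V'" "P \<in> V'" "V' \<subseteq> pre V" "a' \<in> gr (e + 0)" "b' \<in> gr e"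
      "\<And>Q. Q \<in> V' \<Longrightarrow> b' \<notin> Q" "\<And>Q. Q \<in> V' \<Longrightarrow> h V ?r Q = Fract a' b'"
      by (rule B.twist_sectionsE[OF h_mem[OF V(1) r] PV'], rule that, assumption+)
    have b': "b' \<notin> P" "b' \<noteq> 0" using V'(2,6) B.not_point_nonzero[OF P] by blast+
    have "Fract (ev \<sigma> b * a') (\<sigma> j ^ d * b') = Fract 1 1"
      using 1 hb V'(2,7) by (simp add: One_fract_def)
    then have eq: "ev \<sigma> b * a' = \<sigma> j ^ d * b'" using \<sigma>j0 b'(2) by (simp add: eq_fract)
    have "\<sigma> j ^ d * b' \<notin> P"
      using B.point_mult_iff[OF P B.gr_power[OF \<sigma>(1)[OF j(1)]] V'(5)]
        B.point_power_iff[OF P \<sigma>(1)[OF j(1)]] \<sigma>j b'(1) by blast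
    moreover have "ev \<sigma> b \<in> gr (l * d)"
      by (rule ev_graded[OF gr const _ V(5)]) (simp add: \<sigma>(1) w_def del: replicate_Suc)
    ultimately show ?thesis using eq B.point_mult_iff[OF P _ V'(4), of "ev \<sigma> b" "l * d"] by auto
  qed
  moreover from this have "ev \<sigma> b \<noteq> 0" using B.not_point_nonzero[OF P] by blast
  then have nz: "Fract (ev \<sigma> b) (\<sigma> j ^ d) \<noteq> 0"
    using \<sigma>j0 by (simp add: Zero_fract_def eq_fract)
  have "u P = Fract (ev \<sigma> a) (\<sigma> j ^ d) / Fract (ev \<sigma> b) (\<sigma> j ^ d)"
    by (simp only: nonzero_eq_divide_eq[OF nz] uP)
  then have "u P = Fract (ev \<sigma> a) (ev \<sigma> b)"
    using \<sigma>j0 \<open>ev \<sigma> b \<noteq> 0\<close> by (simp add: eq_fract)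
  ultimately show thesis using that[of \<sigma> a d b, OF \<sigma>(1) a V(5)] by blast
qed

section \<open>The Veronese map of a weighted projective space\<close>

definition wmonos :: "nat list \<Rightarrow> nat \<Rightarrow> (nat \<Rightarrow>\<^sub>0 nat) set" where
  "wmonos a d = {m. Poly_Mapping.keys m \<subseteq> {..<length a} \<and> wdeg a m = d}"

lemma lookup_le_wdeg:
  assumes "i < length a" "a ! i \<ge> 1"
  shows "Poly_Mapping.lookup m i \<le> wdeg a m"
proof -
  have "a ! i * Poly_Mapping.lookup m i \<le> wdeg a m"
    unfolding wdeg_def using assms(1) by (intro member_le_sum) auto
  moreover have "1 * Poly_Mapping.lookup m i \<le> a ! i * Poly_Mapping.lookup m i"
    using assms(2) by (intro mult_right_mono) auto
  ultimately show ?thesis by (metis le_trans mult_1)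
qed

lemma finite_wmonos:
  assumes "\<And>i. i < length a \<Longrightarrow> a ! i \<ge> 1"
  shows "finite (wmonos a d)"
proof (rule finite_imageD)
  let ?f = "\<lambda>m. map (Poly_Mapping.lookup m) [0..<length a]"
  have "?f ` wmonos a d \<subseteq> {xs. set xs \<subseteq> {..d} \<and> length xs = length a}"
    using lookup_le_wdeg assms by (fastforce simp: wmonos_def)
  then show "finite (?f ` wmonos a d)"
    by (rule finite_subset) (rule finite_lists_length_eq, simp)
  show "inj_on ?f (wmonos a d)"
  proof (rule inj_onI, rule poly_mapping_eqI)
    fix m n i assume mn: "m \<in> wmonos a d" "n \<in> wmonos a d" "?f m = ?f n"
    show "Poly_Mapping.lookup m i = Poly_Mapping.lookup n i"
    proof (cases "i < length a")
      case False
      then have "i \<notin> Poly_Mapping.keys m" "i \<notin> Poly_Mapping.keys n" using mn by (auto simp: wmonos_def)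
      then show ?thesis by (simp add: in_keys_iff)
    qed (use mn in auto)
  qed
qed

text \<open>The counter records the number of summands, which is the degree of the corresponding
  monomial in the target coordinates (\<open>msum_lift\<close>).\<close>

inductive msum :: "(nat \<Rightarrow>\<^sub>0 nat) set \<Rightarrow> nat \<Rightarrow> (nat \<Rightarrow>\<^sub>0 nat) \<Rightarrow> bool" for S where
  msum_zero: "msum S 0 0"
| msum_Suc: "m \<in> S \<Longrightarrow> msum S k n \<Longrightarrow> msum S (Suc k) (m + n)"

text \<open>
  On the chart of the variable \<open>j\<close>, the parts of degree at most \<open>l\<close> are split off one after the other
  and filled up to degree \<open>l\<close> with that variable.
\<close>

lemma chart_decomposition:
  assumes j: "j < length a" and l: "l = a ! j * q" and pos: "\<And>i. i < length a \<Longrightarrow> a ! i \<ge> 1"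
    and step: "\<And>n. Poly_Mapping.keys n \<subseteq> {..<length a} \<Longrightarrow> Poly_Mapping.lookup n j = 0 \<Longrightarrow> wdeg a n > 0 \<Longrightarrow>
      a ! j dvd wdeg a n \<Longrightarrow> \<exists>n' r. n = n' + r \<and> wdeg a n' > 0 \<and> a ! j dvd wdeg a n' \<and> wdeg a n' \<le> l"
    and n: "Poly_Mapping.keys n \<subseteq> {..<length a}" "Poly_Mapping.lookup n j = 0" "wdeg a n + a ! j * k = l * d"
  shows "\<exists>m. msum (wmonos a l) (d + m) (n + Poly_Mapping.single j (k + m * q))"
  using n
proof (induction "wdeg a n" arbitrary: n k rule: less_induct)
  case less
  have aj: "a ! j > 0" using pos[OF j] by simp
  show ?case
  proof (cases "wdeg a n = 0")
    case True
    have "n = 0"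
    proof (rule poly_mapping_eqI)
      fix i show "Poly_Mapping.lookup n i = Poly_Mapping.lookup 0 i"
        using lookup_le_wdeg[of i a n] pos[of i] less.prems(1) True
        by (cases "i < length a") (auto simp: subset_iff in_keys_iff)
    qed
    have "k = q * d" using less.prems(3) True aj l by simp
    have "msum (wmonos a l) e (Poly_Mapping.single j (q * e))" for e
    proof (induction e)
      case (Suc e)
      have "Poly_Mapping.single j q \<in> wmonos a l" using j l by (simp add: wmonos_def wdeg_single)
      from msum_Suc[OF this Suc] show ?case by (simp add: single_add[symmetric])
    qed (simp add: msum_zero)
    then show ?thesis using \<open>n = 0\<close> \<open>k = q * d\<close> by (intro exI[of _ 0]) simp
  next
    case False
    have "a ! j dvd wdeg a n" using less.prems(3) l by (metis dvd_add_left_iff dvd_triv_left mult.assoc)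
    then obtain n' r where r: "n = n' + r" "wdeg a n' > 0" "a ! j dvd wdeg a n'" "wdeg a n' \<le> l"
      using step[OF less.prems(1,2)] False by auto
    then obtain k' where k': "wdeg a n' = a ! j * k'" by blast
    have "k' \<le> q" using r(4) k' l aj by simp
    have keys: "Poly_Mapping.keys n' \<subseteq> {..<length a}" "Poly_Mapping.keys r \<subseteq> {..<length a}"
      using less.prems(1) r(1) by (auto simp: keys_add_nat)
    have lk: "Poly_Mapping.lookup r j = 0" using less.prems(2) r(1) by (simp add: lookup_add)
    have "wdeg a n = wdeg a n' + wdeg a r" using r(1) by (simp add: wdeg_add)
    then have "wdeg a r < wdeg a n" "wdeg a r + a ! j * (k' + k) = l * d"
      using r(2) less.prems(3) k' by (simp_all add: distrib_left)
    from less.hyps[OF this(1) keys(2) lk this(2)] obtain m where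
      m: "msum (wmonos a l) (d + m) (r + Poly_Mapping.single j (k' + k + m * q))" by blast
    \<comment> \<open>The part \<open>n'\<close> has degree \<open>a ! j * k'\<close> and is filled
      up with \<open>q - k'\<close> copies of variable \<open>j\<close>. They come from one
      additional factor of exponent \<open>q\<close>, whose other \<open>k'\<close> copies are added
      to \<open>k\<close>.\<close>
    have "wdeg a (n' + Poly_Mapping.single j (q - k')) = l"
      using j l k' \<open>k' \<le> q\<close> by (simp add: wdeg_add wdeg_single diff_mult_distrib2)
    then have "n' + Poly_Mapping.single j (q - k') \<in> wmonos a l"
      using keys(1) j by (auto simp: wmonos_def keys_add_nat)
    from msum_Suc[OF this m]
    have "msum (wmonos a l) (d + Suc m) (n' + Poly_Mapping.single j (q - k') + (r + Poly_Mapping.single j (k' + k + m * q)))"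
      by simp
    moreover have "n' + Poly_Mapping.single j (q - k') + (r + Poly_Mapping.single j (k' + k + m * q)) =
      n + Poly_Mapping.single j (k + Suc m * q)"
      using \<open>k' \<le> q\<close> by (intro poly_mapping_eqI) (simp add: r(1) lookup_add lookup_single when_def)
    ultimately show ?thesis by metis
  qed
qed

text \<open>Since \<open>l\<close> is a common multiple of the weights, the power \<open>q i\<close>
  of variable \<open>i\<close> has degree \<open>l\<close>. \<open>step\<close> is the only
  arithmetic condition beyond that.\<close>

locale weighted_veronese =
  fixes a :: "nat list" and l :: nat and Ms :: "(nat \<Rightarrow>\<^sub>0 nat) list" and q :: "nat \<Rightarrow> nat"
  assumes a_pos: "\<And>i. i < length a \<Longrightarrow> a ! i \<ge> 1" and a_nonempty: "a \<noteq> []"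
    and l_pos: "l > 0"
    and Ms: "set Ms = wmonos a l"
    and q: "\<And>i. i < length a \<Longrightarrow> l = a ! i * q i"
    and step: "\<And>j n. j < length a \<Longrightarrow> Poly_Mapping.keys n \<subseteq> {..<length a} \<Longrightarrow> Poly_Mapping.lookup n j = 0 \<Longrightarrow>
      wdeg a n > 0 \<Longrightarrow> a ! j dvd wdeg a n \<Longrightarrow>
      \<exists>n' r. n = n' + r \<and> wdeg a n' > 0 \<and> a ! j dvd wdeg a n' \<and> wdeg a n' \<le> l"
begin

abbreviation "ws \<equiv> replicate (length Ms) (1 :: nat)"

definition v :: "nat \<Rightarrow> 'k::field npoly" where
  "v i = Poly_Mapping.single (Ms ! i) 1"

text \<open>The target coordinates that map to pure powers of the variables: their charts pull back
  to the standard charts of the weighted space.\<close>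

definition E :: "'k::field npoly set" where
  "E = {pvar i | i. i < length Ms \<and> (\<exists>j<length a. Ms ! i = Poly_Mapping.single j (q j))}"

lemma pvar_ws: "i < length Ms \<Longrightarrow> pvar i \<in> wpoly_part ws 1"
  by (rule pvar_in) auto

lemma v_in: "i < length Ms \<Longrightarrow> v i \<in> wpoly_part a l"
  unfolding v_def by (rule single_in_wpoly_part) (use Ms nth_mem[of i Ms] in \<open>auto simp: wmonos_def\<close>)

lemma index_E:
  assumes "j < length a"
  obtains i where "i < length Ms" "Ms ! i = Poly_Mapping.single j (q j)" "pvar i \<in> (E :: 'k::field npoly set)"
    "v i = (pvar j :: 'k npoly) ^ q j"
proof -
  have "Poly_Mapping.single j (q j) \<in> set Ms"
    using assms q[OF assms] by (simp add: Ms wmonos_def wdeg_single)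
  then obtain i where i: "i < length Ms" "Ms ! i = Poly_Mapping.single j (q j)"
    by (auto simp: in_set_conv_nth)
  moreover from this have "pvar i \<in> (E :: 'k npoly set)" unfolding E_def using assms by blast
  moreover have "v i = (pvar j :: 'k npoly) ^ q j" using i by (simp add: v_def pvar_power)
  ultimately show thesis using that by blast
qed

lemma monomial_eq_prod:
  fixes m :: "nat \<Rightarrow>\<^sub>0 nat"
  assumes "Poly_Mapping.keys m \<subseteq> {..<length a}"
  shows "Poly_Mapping.single m (1 :: 'k::field) = (\<Prod>j<length a. pvar j ^ Poly_Mapping.lookup m j)"
proof -
  have "(\<Prod>j\<in>A. pvar j ^ Poly_Mapping.lookup m j) =
    Poly_Mapping.single (\<Sum>j\<in>A. Poly_Mapping.single j (Poly_Mapping.lookup m j)) (1 :: 'k)" for A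
    by (induction A rule: infinite_finite_induct) (simp_all add: pvar_power mult_single)
  moreover have "(\<Sum>j<length a. Poly_Mapping.single j (Poly_Mapping.lookup m j)) = m"
  proof -
    have "(\<Sum>j<length a. Poly_Mapping.single j (Poly_Mapping.lookup m j)) =
      (\<Sum>j\<in>Poly_Mapping.keys m. Poly_Mapping.single j (Poly_Mapping.lookup m j))"
      using assms by (intro sum.mono_neutral_right) (auto simp: in_keys_iff)
    then show ?thesis by (simp add: sum_singles[symmetric])
  qed
  ultimately show ?thesis by simp
qed

text \<open>The \<open>l\<close>-th power of a variable of the target is, modulo the kernel, a monomial in the elements of \<open>E\<close>.\<close>

lemma E_meets_kernel_point:
  fixes Q :: "'k::field npoly set"
  assumes Q: "Q \<in> proj_points (wpoly_part ws)"
    and ker: "\<And>d g. g \<in> wpoly_part ws d \<Longrightarrow> ev v g = 0 \<Longrightarrow> g \<in> Q"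
  shows "\<exists>y\<in>E. y \<notin> Q"
proof (rule ccontr)
  assume "\<not> ?thesis"
  then have EQ: "y \<in> Q" if "y \<in> E" for y using that by blast
  have "\<exists>i. i < length Ms \<and> pvar i \<in> (E :: 'k npoly set) \<and> v i = (pvar j :: 'k npoly) ^ q j" if "j < length a" for j
    using index_E[OF that] by metis
  then obtain idx where idx: "\<And>j. j < length a \<Longrightarrow> idx j < length Ms"
    "\<And>j. j < length a \<Longrightarrow> pvar (idx j) \<in> (E :: 'k npoly set)"
    "\<And>j. j < length a \<Longrightarrow> v (idx j) = (pvar j :: 'k npoly) ^ q j" by metis
  obtain i where i: "i < length Ms" "pvar i \<notin> Q"
    using point_avoids_pvar[OF Q] by (metis length_replicate)
  let ?m = "Ms ! i"
  have m: "Poly_Mapping.keys ?m \<subseteq> {..<length a}" "wdeg a ?m = l"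
    using nth_mem[OF i(1)] Ms by (auto simp: wmonos_def)
  \<comment> \<open>The exponents are chosen so that \<open>g\<close> has the image of
    \<open>pvar i ^ l\<close>: as \<open>q j * a ! j = l\<close>, each factor evaluates to the
    \<open>l\<close>-th power of the \<open>j\<close>-th factor of the monomial.\<close>
  define g where "g = (\<Prod>j<length a. pvar (idx j) ^ (a ! j * Poly_Mapping.lookup ?m j) :: 'k npoly)"
  have gr: "pvar (idx j) ^ n \<in> (wpoly_part ws n :: 'k npoly set)" if "j < length a" for j n
    using wpoly.gr_power[OF pvar_ws[OF idx(1)[OF that]], of n] by simp
  have "g \<in> wpoly_part ws (\<Sum>j<length a. a ! j * Poly_Mapping.lookup ?m j)"
    unfolding g_def using gr by (intro wpoly.gr_prod) auto
  then have g: "g \<in> wpoly_part ws l" using m(2) by (simp add: wdeg_def)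
  have ev_prod: "ev v (\<Prod>j\<in>A. x j) = (\<Prod>j\<in>A. ev v (x j) :: 'k npoly)" for A and x :: "nat \<Rightarrow> 'k npoly"
    by (induction A rule: infinite_finite_induct) (simp_all add: ev_mult)
  have "ev v g = (\<Prod>j<length a. (pvar j ^ Poly_Mapping.lookup ?m j) ^ l)"
    unfolding g_def ev_prod
  proof (rule prod.cong)
    fix j assume "j \<in> {..<length a}"
    then have j: "j < length a" by simp
    have "ev v (pvar (idx j) ^ (a ! j * Poly_Mapping.lookup ?m j)) = (pvar j :: 'k npoly) ^ (q j * (a ! j * Poly_Mapping.lookup ?m j))"
      using idx(3)[OF j] by (simp add: ev_power power_mult)
    also have "q j * (a ! j * Poly_Mapping.lookup ?m j) = Poly_Mapping.lookup ?m j * l" using q[OF j] by simp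
    finally show "ev v (pvar (idx j) ^ (a ! j * Poly_Mapping.lookup ?m j)) = (pvar j ^ Poly_Mapping.lookup ?m j :: 'k npoly) ^ l"
      by (simp add: power_mult)
  qed simp
  also have "\<dots> = ev v (pvar i ^ l)"
    using monomial_eq_prod[OF m(1), where ?'k = 'k] by (simp add: ev_power v_def prod_power_distrib)
  finally have "ev v (pvar i ^ l - g) = 0"
    using ev_add[of v "pvar i ^ l - g" g] by simp
  moreover have il: "pvar i ^ l \<in> wpoly_part ws l" using wpoly.gr_power[OF pvar_ws[OF i(1)], of l] by simp
  ultimately have 1: "pvar i ^ l - g \<in> Q" using ker wpoly.gr_diff[OF il g] by blast
  have "\<exists>j<length a. Poly_Mapping.lookup ?m j \<noteq> 0"
  proof (rule ccontr)
    assume "\<not> ?thesis"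
    then have "wdeg a ?m = 0" by (simp add: wdeg_def)
    then show False using m(2) l_pos by simp
  qed
  then obtain j where j: "j < length a" "Poly_Mapping.lookup ?m j \<noteq> 0" by blast
  have "g = pvar (idx j) ^ (a ! j * Poly_Mapping.lookup ?m j) *
    (\<Prod>j\<in>{..<length a} - {j}. pvar (idx j) ^ (a ! j * Poly_Mapping.lookup ?m j))"
    unfolding g_def using j(1) by (subst prod.remove[of _ j]) auto
  moreover have "(\<Prod>j\<in>{..<length a} - {j}. (pvar (idx j) :: 'k npoly) ^ (a ! j * Poly_Mapping.lookup ?m j)) \<in>
    wpoly_part ws (\<Sum>j\<in>{..<length a} - {j}. a ! j * Poly_Mapping.lookup ?m j)"
    using gr by (intro wpoly.gr_prod) auto
  moreover have "pvar (idx j) ^ (a ! j * Poly_Mapping.lookup ?m j) \<in> Q"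
    using wpoly.point_power_iff[OF Q pvar_ws[OF idx(1)[OF j(1)]]] EQ[OF idx(2)[OF j(1)]] j a_pos[OF j(1)] by simp
  ultimately have "g \<in> Q" using wpoly.point_mult_iff[OF Q gr[OF j(1)]] by auto
  then have "pvar i ^ l \<in> Q" using wpoly.point_add[OF Q 1] by fastforce
  then show False using wpoly.point_power_iff[OF Q pvar_ws[OF i(1)]] i(2) by blast
qed

lemma msum_lift:
  assumes "msum (wmonos a l) k n"
  shows "\<exists>g\<in>wpoly_part ws k. ev v g = Poly_Mapping.single n (1 :: 'k::field)"
  using assms
proof induction
  case msum_zero
  then show ?case by (intro bexI[of _ 1]) simp_all
next
  case (msum_Suc m k n)
  then obtain g where g: "g \<in> wpoly_part ws k" "ev v g = Poly_Mapping.single n (1 :: 'k)" by blast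
  obtain i where i: "i < length Ms" "Ms ! i = m" using msum_Suc(1) Ms by (metis in_set_conv_nth)
  have "pvar i * g \<in> wpoly_part ws (Suc k)" using wpoly.gr_mult[OF pvar_ws[OF i(1)] g(1)] by simp
  moreover have "ev v (pvar i * g) = Poly_Mapping.single (m + n) 1"
    using g(2) i(2) by (simp add: ev_mult v_def mult_single)
  ultimately show ?case by blast
qed

text \<open>The power of variable \<open>j\<close> is separated from \<open>n\<close>, because
  \<open>chart_decomposition\<close> treats exponents without that variable.\<close>

lemma monomial_lift:
  assumes j: "j < length a" and n: "n \<in> wmonos a (l * d)"
  shows "\<exists>m. \<exists>g\<in>wpoly_part ws (d + m). ev v g = Poly_Mapping.single n (1 :: 'k::field) * (pvar j ^ q j) ^ m"
proof -
  let ?k = "Poly_Mapping.lookup n j"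
  let ?n = "n - Poly_Mapping.single j ?k"
  have split: "n = ?n + Poly_Mapping.single j ?k"
    by (intro poly_mapping_eqI) (auto simp: lookup_add lookup_minus lookup_single when_def)
  have n': "Poly_Mapping.keys n \<subseteq> {..<length a}" "wdeg a n = l * d" using n by (auto simp: wmonos_def)
  have "Poly_Mapping.keys ?n \<subseteq> {..<length a}"
    using n'(1) keys_add_nat[of ?n "Poly_Mapping.single j ?k"] split by simp
  moreover have "Poly_Mapping.lookup ?n j = 0" by (simp add: lookup_minus)
  moreover have "wdeg a ?n + a ! j * ?k = l * d"
    using wdeg_add[of a ?n "Poly_Mapping.single j ?k"] wdeg_single[OF j, of ?k] split n'(2) by simp
  ultimately obtain m where "msum (wmonos a l) (d + m) (?n + Poly_Mapping.single j (?k + m * q j))"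
    using chart_decomposition[OF j q[OF j] a_pos step[OF j]] by blast
  moreover have "?n + Poly_Mapping.single j (?k + m * q j) = n + Poly_Mapping.single j (q j * m)"
    using split by (simp add: single_add mult.commute flip: add.assoc)
  ultimately obtain g where g: "g \<in> wpoly_part ws (d + m)"
    "ev v g = Poly_Mapping.single (n + Poly_Mapping.single j (q j * m)) (1 :: 'k)"
    using msum_lift[where ?'k = 'k] by metis
  have "Poly_Mapping.single n (1 :: 'k) * (pvar j ^ q j) ^ m = Poly_Mapping.single (n + Poly_Mapping.single j (q j * m)) 1"
    by (simp only: power_mult[symmetric], simp only: pvar_power mult_single mult_1)
  then show ?thesis using g by metis
qed

text \<open>Different monomials of \<open>s\<close> need different powers of \<open>y\<close>;
  multiplying the lifts by further powers of \<open>y\<close> brings them to a common exponent, so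
  the claim is additive in \<open>s\<close>.\<close>

lemma chart_lift:
  fixes s :: "'k::field npoly"
  assumes y: "y \<in> E" and s: "s \<in> wpoly_part a (l * d)"
  shows "\<exists>m. \<exists>g\<in>wpoly_part ws (d + m). ev v g = s * ev v y ^ m"
proof -
  obtain i j where ij: "y = pvar i" "i < length Ms" "j < length a" "Ms ! i = Poly_Mapping.single j (q j)"
    using y unfolding E_def by auto
  have vy: "ev v y = pvar j ^ q j" using ij by (simp add: v_def pvar_power)
  have yg: "y ^ r \<in> wpoly_part ws r" for r
    using wpoly.gr_power[OF pvar_ws[OF ij(2)], of r] ij(1) by simp
  define G where "G s \<longleftrightarrow> (\<exists>m. \<exists>g\<in>wpoly_part ws (d + m). ev v g = s * ev v y ^ m)" for s :: "'k npoly"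
  have G0: "G 0" unfolding G_def by (intro exI[of _ 0] bexI[of _ 0]) simp_all
  have Gadd: "G (s + t)" if "G s" "G t" for s t
  proof -
    obtain m g where g: "g \<in> wpoly_part ws (d + m)" "ev v g = s * ev v y ^ m" using \<open>G s\<close> unfolding G_def by blast
    obtain r h where h: "h \<in> wpoly_part ws (d + r)" "ev v h = t * ev v y ^ r" using \<open>G t\<close> unfolding G_def by blast
    have "g * y ^ r + h * y ^ m \<in> wpoly_part ws (d + (m + r))"
      using wpoly.gr_add wpoly.gr_mult[OF g(1) yg[of r]] wpoly.gr_mult[OF h(1) yg[of m]] by (simp add: ac_simps)
    moreover have "ev v (g * y ^ r + h * y ^ m) = (s + t) * ev v y ^ (m + r)"
      using g h by (simp add: ev_add ev_mult ev_power power_add algebra_simps)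
    ultimately show ?thesis unfolding G_def by blast
  qed
  have Gsingle: "G (Poly_Mapping.single n c)" if n: "n \<in> wmonos a (l * d)" for n c
  proof -
    obtain m g where g: "g \<in> wpoly_part ws (d + m)"
      "ev v g = Poly_Mapping.single n (1 :: 'k) * (pvar j ^ q j) ^ m"
      using monomial_lift[OF ij(3) n, where ?'k = 'k] by blast
    have "Poly_Mapping.single 0 c * g \<in> wpoly_part ws (d + m)"
      using wpoly.gr_mult[OF const_in_wpoly_part g(1)] by simp
    moreover have "Poly_Mapping.single n c = Poly_Mapping.single 0 c * Poly_Mapping.single n (1 :: 'k)"
      by (simp add: mult_single)
    then have "ev v (Poly_Mapping.single 0 c * g) = Poly_Mapping.single n c * ev v y ^ m"
      using g(2) vy by (simp only: ev_mult ev_const mult.assoc)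
    ultimately show ?thesis unfolding G_def by blast
  qed
  have "G (\<Sum>m\<in>A. Poly_Mapping.single m (Poly_Mapping.lookup s m))" if "A \<subseteq> Poly_Mapping.keys s" for A
    using that
  proof (induction A rule: infinite_finite_induct)
    case (insert m A)
    have "m \<in> wmonos a (l * d)" using insert.prems s unfolding wpoly_part_iff wmonos_def by auto
    then show ?case using insert Gadd Gsingle by simp
  qed (simp_all add: G0)
  from this[of "Poly_Mapping.keys s"] have "G s" by (simp add: sum_singles[symmetric])
  then show ?thesis unfolding G_def .
qed

lemma veronese:
  "veronese_embedding (wpoly_part ws) (wpoly_part a) (ev v) l (E :: 'k::field npoly set)
     (Poly_Mapping.single 0) (Poly_Mapping.single 0)"
proof (rule veronese_embedding.intro[OF graded_domain_wpoly_part graded_domain_wpoly_part],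
    unfold_locales)
  fix x :: "'k npoly" and d assume "x \<in> wpoly_part ws d"
  then show "ev v x \<in> wpoly_part a (l * d)"
    by (intro ev_graded[OF graded_domain_wpoly_part]) (auto simp: v_in)
next
  fix Q :: "'k npoly set" assume Q: "Q \<in> proj_points (wpoly_part ws)"
  obtain i where "i < length ws" "pvar i \<notin> Q" by (rule point_avoids_pvar[OF Q])
  then show "\<exists>y\<in>wpoly_part ws 1. y \<notin> Q" using pvar_ws by auto
next
  fix P :: "'k npoly set" assume P: "P \<in> proj_points (wpoly_part a)"
  obtain j where j: "j < length a" "pvar j \<notin> P" by (rule point_avoids_pvar[OF P])
  obtain i where i: "pvar i \<in> (E :: 'k npoly set)" "v i = (pvar j :: 'k npoly) ^ q j"
    using index_E[OF j(1)] by metis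
  then have "ev v (pvar i) \<notin> P"
    using wpoly.point_power_iff[OF P pvar_in[OF j(1) refl]] j(2) by simp
  then show "\<exists>y\<in>E. ev v y \<notin> P" using i by blast
next
  fix y s :: "'k npoly" and d assume "y \<in> E" "s \<in> wpoly_part a (l * d)"
  then show "\<exists>m. \<exists>g\<in>wpoly_part ws (d + m). ev v g = s * ev v y ^ m" by (rule chart_lift)
next
  fix Q :: "'k npoly set"
  assume "Q \<in> proj_points (wpoly_part ws)" "\<And>d g. g \<in> wpoly_part ws d \<Longrightarrow> ev v g = 0 \<Longrightarrow> g \<in> Q"
  then show "\<exists>y\<in>E. y \<notin> Q" by (rule E_meets_kernel_point)
next
  fix y :: "'k npoly" assume "y \<in> E"
  then show "y \<in> wpoly_part ws 1" using pvar_ws unfolding E_def by blast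
qed (simp_all add: l_pos ev_add ev_mult)

lemma very_ample_weighted:
  "very_ample (weighted_proj_space a :: ('k npoly set, 'k npoly set \<Rightarrow> 'k npoly fract, 'k::field) kspace)
     (weighted_twist a l)"
proof -
  interpret veronese_embedding "wpoly_part ws :: nat \<Rightarrow> 'k npoly set" "wpoly_part a" "ev v" l E
    "Poly_Mapping.single 0" "Poly_Mapping.single 0"
    by (rule veronese)
  \<comment> \<open>The list is nonempty, as it contains a power of variable 0, so the number of
    coordinates has the form \<open>N + 1\<close>.\<close>
  obtain N where N: "length Ms = N + 1"
    using index_E[of 0] a_nonempty that
    by (metis Suc_eq_plus1 length_greater_0_conv less_nat_zero_code not0_implies_Suc)
  show ?thesis
    unfolding very_ample_def weighted_proj_space_def weighted_twist_def N[symmetric]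
    using closed_immersion_pull pullback_iso_pull N by metis
qed

end

section \<open>The weights 1, 6, 2p, 3p\<close>

abbreviation "weights p \<equiv> [1, 6, 2 * p, 3 * p :: nat]"

lemma less_4_cases: "(j :: nat) < 4 \<Longrightarrow> j = 0 \<or> j = 1 \<or> j = 2 \<or> j = 3"
  by linarith

lemma weights_pos: "p \<ge> 1 \<Longrightarrow> j < length (weights p) \<Longrightarrow> weights p ! j \<ge> 1"
  using less_4_cases[of j] by auto

lemma wdeg_weights:
  "wdeg (weights p) m = Poly_Mapping.lookup m 0 + 6 * Poly_Mapping.lookup m 1 +
     2 * p * Poly_Mapping.lookup m 2 + 3 * p * Poly_Mapping.lookup m 3"
  by (simp add: wdeg_def numeral_eq_Suc)

text \<open>
  Besides the obvious parts (the whole exponent, or a pure power of degree at most \<open>6p\<close>) only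
  the part \<open>x\<^sub>0 x\<^sub>1\<^sup>q x\<^sub>i\<close> is needed, where \<open>p = 6q + 1\<close>.
\<close>

lemma chart1_part:
  fixes q :: nat
  assumes p: "p = 6 * q + 1" "p \<ge> 5" and t: "x0 + 2 * p * x2 + 3 * p * x3 = 6 * k" "k > 0"
  shows "\<exists>y0\<le>x0. \<exists>y2\<le>x2. \<exists>y3\<le>x3. \<exists>k'>0. y0 + 2 * p * y2 + 3 * p * y3 = 6 * k' \<and> 6 * k' \<le> 6 * p"
proof -
  consider "x0 \<ge> 6" | "x2 \<ge> 3" | "x3 \<ge> 2" | "x0 < 6" "x2 < 3" "x3 < 2" by linarith
  then show ?thesis
  proof cases
    case 1
    then show ?thesis using p by (intro exI[of _ 6] exI[of _ 0] exI[of _ 1] conjI) auto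
  next
    case 2
    then show ?thesis using p by (intro exI[of _ 0] exI[of _ 3] exI[of _ p] conjI) auto
  next
    case 3
    then show ?thesis using p by (intro exI[of _ 0] exI[of _ 2] exI[of _ p] conjI) auto
  next
    case 4
    show ?thesis
    proof (cases "k \<le> p")
      case True
      then show ?thesis using t by (intro exI[of _ x0] exI[of _ x2] exI[of _ x3] exI[of _ k] conjI) auto
    next
      case False
      have "x2 = 0 \<or> x2 = 1 \<or> x2 = 2" "x3 = 0 \<or> x3 = 1" using 4 by auto
      \<comment> \<open>All other pairs give degree at most \<open>5 * p + 5\<close>, which is below
        \<open>6 * (p + 1)\<close>.\<close>
      then have "x2 = 2" "x3 = 1" using t False 4(1) p by auto
      moreover have "x0 = 5" using t(1) 4(1) p unfolding calculation by presburger
      \<comment> \<open>The part that splits off is \<open>x\<^sub>0 x\<^sub>2 x\<^sub>3\<close>, of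
        degree \<open>5 * p + 1 = 6 * (5 * q + 1)\<close>.\<close>
      ultimately show ?thesis using p
        by (intro exI[of _ 1] exI[of _ 1] exI[of _ "5 * q + 1"] conjI) auto
    qed
  qed
qed

text \<open>If no pure power splits off and the degree exceeds \<open>6 * p\<close>, the exponent
  contains \<open>x\<^sub>0 x\<^sub>1\<^sup>q x\<^sub>3\<close>, whose degree is
  \<open>1 + 6 * q + 3 * p = 2 * p * 2\<close>.\<close>

lemma chart2_part:
  fixes q :: nat
  assumes p: "p = 6 * q + 1" "p \<ge> 5" and t: "x0 + 6 * x1 + 3 * p * x3 = 2 * p * k" "k > 0"
  shows "\<exists>y0\<le>x0. \<exists>y1\<le>x1. \<exists>y3\<le>x3. \<exists>k'>0. y0 + 6 * y1 + 3 * p * y3 = 2 * p * k' \<and> 2 * p * k' \<le> 6 * p"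
proof -
  consider "x0 \<ge> 2 * p" | "x1 \<ge> p" | "x3 \<ge> 2" | "x0 < 2 * p" "x1 < p" "x3 < 2" by linarith
  then show ?thesis
  proof cases
    case 1
    then show ?thesis using p by (intro exI[of _ "2 * p"] exI[of _ 0] exI[of _ 1] conjI) auto
  next
    case 2
    then show ?thesis using p by (intro exI[of _ 0] exI[of _ p] exI[of _ 3] conjI) auto
  next
    case 3
    then show ?thesis using p by (intro exI[of _ 0] exI[of _ 2] exI[of _ 3] conjI) auto
  next
    case 4
    show ?thesis
    proof (cases "k \<le> 3")
      case True
      then show ?thesis using t by (intro exI[of _ x0] exI[of _ x1] exI[of _ x3] exI[of _ k] conjI) auto
    next
      case False
      have x3: "x3 = 0 \<or> x3 = 1" using 4 by auto
      \<comment> \<open>The remaining exponents have degree below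
        \<open>2 * p + 6 * p + 3 * p = 11 * p\<close>.\<close>
      have "2 * p * k < 2 * p * 6" using x3 4 unfolding t(1)[symmetric] by auto
      then have k: "k = 4 \<or> k = 5" using False by auto
      have "x3 = 1" using k x3 4 t(1) by auto
      moreover have "x1 \<ge> q" using k x3 4 t(1) p by auto
      \<comment> \<open>Parity: \<open>3 * p\<close> is odd, while \<open>6 * x1\<close> and
        \<open>2 * p * k\<close> are even.\<close>
      moreover have "x0 \<ge> 1"
      proof (rule ccontr)
        assume "\<not> x0 \<ge> 1"
        then have "6 * x1 + 3 * p = 2 * p * k" using t(1) \<open>x3 = 1\<close> by simp
        then show False using k p(1) by (elim disjE) (simp; presburger)+
      qed
      ultimately show ?thesis using p
        by (intro exI[of _ 1] exI[of _ q] exI[of _ 2] conjI) auto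
    qed
  qed
qed

text \<open>Here the mixed part is \<open>x\<^sub>0 x\<^sub>1\<^sup>q x\<^sub>2\<close>, of degree
  \<open>1 + 6 * q + 2 * p = 3 * p\<close>.\<close>

lemma chart3_part:
  fixes q :: nat
  assumes p: "p = 6 * q + 1" "p \<ge> 5" and t: "x0 + 6 * x1 + 2 * p * x2 = 3 * p * k" "k > 0"
  shows "\<exists>y0\<le>x0. \<exists>y1\<le>x1. \<exists>y2\<le>x2. \<exists>k'>0. y0 + 6 * y1 + 2 * p * y2 = 3 * p * k' \<and> 3 * p * k' \<le> 6 * p"
proof -
  consider "x0 \<ge> 3 * p" | "x1 \<ge> p" | "x2 \<ge> 3" | "x0 < 3 * p" "x1 < p" "x2 < 3" by linarith
  then show ?thesis
  proof cases
    case 1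
    then show ?thesis using p by (intro exI[of _ "3 * p"] exI[of _ 0] exI[of _ 1] conjI) auto
  next
    case 2
    then show ?thesis using p by (intro exI[of _ 0] exI[of _ p] exI[of _ 2] conjI) auto
  next
    case 3
    then show ?thesis using p by (intro exI[of _ 0] exI[of _ 3] exI[of _ 2] conjI) auto
  next
    case 4
    show ?thesis
    proof (cases "k \<le> 2")
      case True
      then show ?thesis using t by (intro exI[of _ x0] exI[of _ x1] exI[of _ x2] exI[of _ k] conjI) auto
    next
      case False
      have x2: "x2 = 0 \<or> x2 = 1 \<or> x2 = 2" using 4 by auto
      \<comment> \<open>The remaining exponents have degree below
        \<open>3 * p + 6 * p + 4 * p = 13 * p\<close>.\<close>
      have "3 * p * k < 3 * p * 5" using x2 4 unfolding t(1)[symmetric] by auto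
      then have k: "k = 3 \<or> k = 4" using False by auto
      have x2': "x2 = 1 \<or> x2 = 2" using k x2 4 t(1) by auto
      moreover have "x1 \<ge> q" using k x2' 4 t(1) p by auto
      \<comment> \<open>Modulo 3: otherwise 3 would divide \<open>2 * p * x2\<close> with
        \<open>x2\<close> equal to 1 or 2 and \<open>p\<close> congruent to 1.\<close>
      moreover have "x0 \<ge> 1"
      proof (rule ccontr)
        assume "\<not> x0 \<ge> 1"
        then have "6 * x1 + 2 * p * x2 = 3 * p * k" using t(1) by simp
        then show False using k p(1) x2' 4 by (elim disjE) (simp; presburger)+
      qed
      ultimately show ?thesis using p
        by (intro exI[of _ 1] exI[of _ q] exI[of _ 1] conjI) auto
    qed
  qed
qed

lemma weights_step:
  fixes q :: nat
  assumes p: "p = 6 * q + 1" "p \<ge> 5" and j: "j < length (weights p)"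
    and n: "Poly_Mapping.keys n \<subseteq> {..<length (weights p)}" "Poly_Mapping.lookup n j = 0"
      "wdeg (weights p) n > 0" "weights p ! j dvd wdeg (weights p) n"
  shows "\<exists>n' r. n = n' + r \<and> wdeg (weights p) n' > 0 \<and> weights p ! j dvd wdeg (weights p) n' \<and>
    wdeg (weights p) n' \<le> 6 * p"
proof -
  define e where "e y0 y1 y2 y3 = Poly_Mapping.single (0::nat) y0 + Poly_Mapping.single 1 y1 +
    Poly_Mapping.single 2 y2 + Poly_Mapping.single 3 y3" for y0 y1 y2 y3 :: nat
  have e_lookup: "Poly_Mapping.lookup (e y0 y1 y2 y3) i =
    (if i = 0 then y0 else if i = 1 then y1 else if i = 2 then y2 else if i = 3 then y3 else 0)" for y0 y1 y2 y3 i
    by (auto simp: e_def lookup_add lookup_single when_def)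
  have e_wdeg: "wdeg (weights p) (e y0 y1 y2 y3) = y0 + 6 * y1 + 2 * p * y2 + 3 * p * y3" for y0 y1 y2 y3
    by (simp only: wdeg_weights e_lookup) simp
  let ?x = "Poly_Mapping.lookup n"
  have part: ?thesis
    if "y0 \<le> ?x 0" "y1 \<le> ?x 1" "y2 \<le> ?x 2" "y3 \<le> ?x 3"
      "y0 + 6 * y1 + 2 * p * y2 + 3 * p * y3 = weights p ! j * k'" "k' > 0" "weights p ! j * k' \<le> 6 * p"
    for y0 y1 y2 y3 k'
  proof (intro exI conjI)
    show "n = e y0 y1 y2 y3 + (n - e y0 y1 y2 y3)"
      using that by (intro poly_mapping_eqI) (simp add: lookup_add lookup_minus e_lookup)
    show "0 < wdeg (weights p) (e y0 y1 y2 y3)"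
      unfolding e_wdeg that(5) using that(6) weights_pos[OF _ j] p by (simp del: nth_Cons_numeral)
  qed (simp_all only: e_wdeg that(5,7) dvd_triv_left)
  obtain k where k: "wdeg (weights p) n = weights p ! j * k" using n(4) by blast
  have k0: "k > 0" using n(3) k by (cases k) auto
  have wd: "?x 0 + 6 * ?x 1 + 2 * p * ?x 2 + 3 * p * ?x 3 = weights p ! j * k"
    using k by (simp only: wdeg_weights)
  have "j < 4" using j by simp
  from less_4_cases[OF this] show ?thesis
  proof (elim disjE)
    \<comment> \<open>The inverted variable has weight 1, so divisibility is vacuous and any single
      variable that occurs can be split off; the last argument of \<open>part\<close> is its
      weight.\<close>
    assume j0: "j = 0"
    then have "?x 1 \<ge> 1 \<or> ?x 2 \<ge> 1 \<or> ?x 3 \<ge> 1" using wd k0 n(2) by (cases "?x 1"; cases "?x 2"; cases "?x 3") auto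
    then show ?thesis
    proof (elim disjE)
      assume "?x 1 \<ge> 1" then show ?thesis using j0 p by (intro part[of 0 1 0 0 6]) auto
    next
      assume "?x 2 \<ge> 1" then show ?thesis using j0 p by (intro part[of 0 0 1 0 "2 * p"]) auto
    next
      assume "?x 3 \<ge> 1" then show ?thesis using j0 p by (intro part[of 0 0 0 1 "3 * p"]) auto
    qed
  next
    assume j1: "j = 1"
    then have "?x 0 + 2 * p * ?x 2 + 3 * p * ?x 3 = 6 * k" using wd n(2) by simp
    from chart1_part[OF p this k0] obtain y0 y2 y3 k' where
      "y0 \<le> ?x 0" "y2 \<le> ?x 2" "y3 \<le> ?x 3" "k' > 0" "y0 + 2 * p * y2 + 3 * p * y3 = 6 * k'" "6 * k' \<le> 6 * p"
      by auto
    then show ?thesis using j1 by (intro part[of y0 0 y2 y3 k']) auto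
  next
    assume j2: "j = 2"
    then have "?x 0 + 6 * ?x 1 + 3 * p * ?x 3 = 2 * p * k" using wd n(2) by simp
    from chart2_part[OF p this k0] obtain y0 y1 y3 k' where
      "y0 \<le> ?x 0" "y1 \<le> ?x 1" "y3 \<le> ?x 3" "k' > 0" "y0 + 6 * y1 + 3 * p * y3 = 2 * p * k'" "2 * p * k' \<le> 6 * p"
      by auto
    then show ?thesis using j2 by (intro part[of y0 y1 0 y3 k']) auto
  next
    assume j3: "j = 3"
    then have "?x 0 + 6 * ?x 1 + 2 * p * ?x 2 = 3 * p * k" using wd n(2) by simp
    from chart3_part[OF p this k0] obtain y0 y1 y2 k' where
      "y0 \<le> ?x 0" "y1 \<le> ?x 1" "y2 \<le> ?x 2" "k' > 0" "y0 + 6 * y1 + 2 * p * y2 = 3 * p * k'" "3 * p * k' \<le> 6 * p"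
      by auto
    then show ?thesis using j3 by (intro part[of y0 y1 y2 0 k']) auto
  qed
qed

lemma very_ample_weights:
  fixes q :: nat
  assumes p: "p = 6 * q + 1" "p \<ge> 5"
  shows "very_ample (weighted_proj_space (weights p) :: ('k npoly set, 'k npoly set \<Rightarrow> 'k npoly fract, 'k::field) kspace)
     (weighted_twist (weights p) (6 * p))"
proof -
  have pos: "weights p ! i \<ge> 1" if "i < length (weights p)" for i
    using weights_pos[OF _ that] p by simp
  obtain Ms where Ms: "set Ms = wmonos (weights p) (6 * p)"
    using finite_list[OF finite_wmonos[OF pos]] by blast
  \<comment> \<open>The list consists of the quotients of \<open>6 * p\<close> by the four
    weights.\<close>
  interpret weighted_veronese "weights p" "6 * p" Ms "\<lambda>j. [6 * p, p, 3, 2] ! j"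
  proof unfold_locales
    show "6 * p = weights p ! i * [6 * p, p, 3, 2] ! i" if "i < length (weights p)" for i
      using less_4_cases[of i] that by auto
    show "\<exists>n' r. n = n' + r \<and> wdeg (weights p) n' > 0 \<and> weights p ! j dvd wdeg (weights p) n' \<and>
        wdeg (weights p) n' \<le> 6 * p"
      if "j < length (weights p)" "Poly_Mapping.keys n \<subseteq> {..<length (weights p)}" "Poly_Mapping.lookup n j = 0"
        "wdeg (weights p) n > 0" "weights p ! j dvd wdeg (weights p) n" for j n
      using weights_step[OF p that] .
  qed (use pos Ms p in auto)
  show ?thesis by (rule very_ample_weighted)
qed

text \<open>
  If \<open>p = 6q + 5\<close>, no monomial of degree \<open>6p\<close> is linear in \<open>x\<^sub>0\<close>. Hence the sections of \<open>O(6p)\<close> do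
  not separate tangent vectors transversal to the divisor \<open>x\<^sub>0 = 0\<close>.
\<close>

lemma no_linear_monomial:
  fixes q :: nat
  assumes p: "p = 6 * q + 5" and m: "wdeg (weights p) m = 6 * p"
  shows "Poly_Mapping.lookup m 0 \<noteq> 1"
proof
  let ?b = "Poly_Mapping.lookup m 1" and ?c = "Poly_Mapping.lookup m 2" and ?d = "Poly_Mapping.lookup m 3"
  assume "Poly_Mapping.lookup m 0 = 1"
  then have eq: "1 + 6 * ?b + 2 * p * ?c + 3 * p * ?d = 6 * p" using m by (simp only: wdeg_weights)
  then have "2 * p * ?c < 2 * p * 3" "3 * p * ?d < 3 * p * 2" by linarith+
  then have "?c = 0 \<or> ?c = 1 \<or> ?c = 2" "?d = 0 \<or> ?d = 1" by auto
  \<comment> \<open>Since \<open>p\<close> is congruent to -1 modulo 6, divisibility by 6 leaves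
    only \<open>?c = 2\<close> and \<open>?d = 1\<close>, and then the left side is at least
    \<open>7 * p + 1\<close>.\<close>
  then show False using eq p by (elim disjE) (simp; presburger)+
qed

definition nonlinear_part :: "nat list \<Rightarrow> nat \<Rightarrow> 'k::field npoly set" where
  "nonlinear_part a d = {f \<in> wpoly_part a d. \<forall>m\<in>Poly_Mapping.keys f. Poly_Mapping.lookup m 0 \<noteq> 1}"

text \<open>Closure under products is the one special point: an exponent sum equal to 1 forces one
  of the summands to be 1.\<close>

lemma graded_domain_nonlinear_part: "graded_domain (nonlinear_part a :: nat \<Rightarrow> 'k::field npoly set)"
proof
  fix x y :: "'k npoly" and d e
  show "x + y \<in> nonlinear_part a d" if "x \<in> nonlinear_part a d" "y \<in> nonlinear_part a d"
    using that Poly_Mapping.keys_add[of x y] wpoly.gr_add[of x a d y] unfolding nonlinear_part_def by blast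
  show "- x \<in> nonlinear_part a d" if "x \<in> nonlinear_part a d"
    using that wpoly.gr_uminus[of x a d] by (simp add: nonlinear_part_def in_keys_iff)
  show "x * y \<in> nonlinear_part a (d + e)" if xy: "x \<in> nonlinear_part a d" "y \<in> nonlinear_part a e"
  proof -
    have "Poly_Mapping.lookup m 0 \<noteq> 1" if m: "m \<in> Poly_Mapping.keys (x * y)" for m
    proof -
      obtain m1 m2 where "m = m1 + m2" "m1 \<in> Poly_Mapping.keys x" "m2 \<in> Poly_Mapping.keys y"
        using keys_mult[of x y] m by blast
      then show ?thesis using xy by (auto simp: nonlinear_part_def lookup_add add_is_1)
    qed
    then show ?thesis using xy wpoly.gr_mult[of x a d y e] by (simp add: nonlinear_part_def)
  qed
  fix c :: "nat \<Rightarrow> 'k npoly" and D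
  assume "\<And>d. c d \<in> nonlinear_part a d" "(\<Sum>d\<le>D. c d) = 0" "d \<le> D"
  then show "c d = 0" using wpoly.gr_indep[of c a D d] by (simp add: nonlinear_part_def)
qed (auto simp: nonlinear_part_def)

text \<open>After clearing denominators, the test function gives an identity between
  \<open>w\<close> times \<open>ev \<sigma> b\<close> and a power of \<open>x\<^sub>1\<close> times
  \<open>ev \<sigma> a\<close>. The left side has a term linear in \<open>x\<^sub>0\<close>, the
  right side has none.\<close>

lemma not_very_ample_weights:
  fixes q :: nat
  assumes p: "p = 6 * q + 5"
  shows "\<not> very_ample (weighted_proj_space (weights p) :: ('k npoly set, 'k npoly set \<Rightarrow> 'k npoly fract, 'k::field) kspace)
     (weighted_twist (weights p) (6 * p))"
proof
  let ?a = "weights p" and ?l = "6 * p"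
  let ?S = "wpoly_part ?a :: nat \<Rightarrow> 'k npoly set"
  assume "very_ample (weighted_proj_space ?a :: ('k npoly set, 'k npoly set \<Rightarrow> 'k npoly fract, 'k) kspace)
     (weighted_twist ?a ?l)"
  then obtain N f h where
    ci: "closed_immersion (Proj (Poly_Mapping.single 0) ?S)
      (Proj (Poly_Mapping.single 0) (wpoly_part (replicate (N + 1) 1) :: nat \<Rightarrow> 'k npoly set)) f h"
    and pb: "pullback_iso (Proj (Poly_Mapping.single 0) ?S)
      (Proj (Poly_Mapping.single 0) (wpoly_part (replicate (N + 1) 1) :: nat \<Rightarrow> 'k npoly set)) f h
      (twisting_sheaf (wpoly_part (replicate (N + 1) 1)) 1) (twisting_sheaf ?S ?l)"
    unfolding very_ample_def weighted_proj_space_def weighted_twist_def by blast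

  have pos: "?a ! i \<ge> 1" if "i < length ?a" for i
    using weights_pos[OF _ that] p by simp
  have x1: "pvar 1 \<in> ?S 6" by (rule pvar_in) simp_all

  \<comment> \<open>Evaluation at \<open>z\<close> sets \<open>x\<^sub>0\<close> to zero; its kernel
    is the prime generated by \<open>x\<^sub>0\<close>, the generic point of the divisor.\<close>
  define z where "z i = (if i = 0 then 0 else pvar i :: 'k npoly)" for i
  define J where "J d = {s \<in> ?S d. ev z s = 0}" for d
  have J: "wpoly.hprime ?a J"
  proof (rule wpoly.hprimeI[of J ?a 6 "pvar 1"])
    show "pvar 1 \<notin> J 6" by (simp add: J_def z_def)
  qed (use x1 in \<open>auto simp: J_def ev_add ev_mult intro: wpoly.gr_add wpoly.gr_mult\<close>)
  define P where "P = hspan J"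
  have P: "P \<in> proj_points ?S" unfolding P_def by (rule wpoly.hspan_hprime_proj_points[OF J])
  have P_iff: "s \<in> P \<longleftrightarrow> ev z s = 0" if "s \<in> ?S d" for s d
    using wpoly.hspan_hprime_homogeneous[OF J that] that by (simp add: P_def J_def)
  have x1P: "pvar 1 \<notin> P" using P_iff[OF x1] by (simp add: z_def)

  define w where "w = Poly_Mapping.single 0 1 + Poly_Mapping.single 2 2 + Poly_Mapping.single (3::nat) (1::nat)"
  \<comment> \<open>Chosen so that \<open>6 * ?e = 7 * p + 1\<close> is the degree of
    \<open>w\<close>.\<close>
  let ?e = "7 * q + 6"
  have w: "Poly_Mapping.single w (1 :: 'k) \<in> ?S (?e * 6 + 0)"
  proof (rule single_in_wpoly_part)
    show "Poly_Mapping.keys w \<subseteq> {..<length ?a}" by (auto simp: w_def keys_add_nat)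
    have "wdeg ?a w = 1 + 7 * p"
      unfolding wdeg_weights by (simp add: w_def lookup_add lookup_single)
    then show "wdeg ?a w = ?e * 6 + 0" using p by simp
  qed
  let ?U = "wpoly.basic_open ?a (pvar 1) :: 'k npoly set set"
  have U: "openin (proj_top ?S) ?U" by (rule wpoly.openin_basic_open[OF x1])
  have PU: "P \<in> ?U" using P x1P by simp
  have x1e: "(pvar 1 :: 'k npoly) ^ ?e \<in> ?S (?e * 6)" by (rule wpoly.gr_power[OF x1])
  have sec: "(\<lambda>Q\<in>?U. Fract (Poly_Mapping.single w 1) (pvar 1 ^ ?e)) \<in> twist_sections ?S 0 ?U"
    by (rule wpoly.twist_sections_fraction[OF U w x1e]) (use wpoly.point_power_iff[OF _ x1] in auto)
  have global: "\<exists>\<sigma>\<in>?S ?l. \<forall>P\<in>proj_points ?S. s P = Fract \<sigma> 1"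
    if s: "s \<in> twist_sections ?S ?l (proj_points ?S)" for s
  proof -
    obtain \<sigma> where "\<sigma> \<in> ?S ?l" "\<And>Q. Q \<in> proj_points ?S \<Longrightarrow> s Q = Fract \<sigma> 1"
      by (rule global_sections_wpoly[OF _ pos s P]) auto
    then show ?thesis by blast
  qed
  have y1: "pvar 1 ^ p \<in> ?S ?l" using wpoly.gr_power[OF x1, of p] by (simp add: mult.commute)
  have y2: "pvar 1 ^ p \<notin> P" using wpoly.point_power_iff[OF P x1] x1P by blast
  obtain \<sigma> d a b where \<sigma>: "\<And>i. i < N + 1 \<Longrightarrow> \<sigma> i \<in> ?S ?l"
    and ab: "a \<in> wpoly_part (replicate (N + 1) 1) d" "b \<in> wpoly_part (replicate (N + 1) 1) d" "ev \<sigma> b \<notin> P"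
    and u: "(\<lambda>Q\<in>?U. Fract (Poly_Mapping.single w 1) (pvar 1 ^ ?e)) P = Fract (ev \<sigma> a) (ev \<sigma> b)"
    by (rule closed_immersion_local_fraction[OF graded_domain_wpoly_part const_in_wpoly_part
          ci pb global P y1 y2 U PU sec], assumption, rule that, assumption+)
  have "ev \<sigma> b \<noteq> 0" using ab(3) wpoly.not_point_nonzero[OF P] by blast
  then have eq: "Poly_Mapping.single w 1 * ev \<sigma> b = Poly_Mapping.single (Poly_Mapping.single 1 ?e) 1 * ev \<sigma> a"
    using u PU by (simp add: eq_fract pvar_power mult.commute)

  \<comment> \<open>Having degree \<open>6 * p\<close>, the sections have no terms linear in
    \<open>x\<^sub>0\<close>; therefore neither has any polynomial in them.\<close>
  have \<sigma>': "\<sigma> i \<in> nonlinear_part ?a (?l * replicate (N + 1) 1 ! i)" if "i < length (replicate (N + 1) (1::nat))" for i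
    using \<sigma>[of i] that no_linear_monomial[OF p]
    by (auto simp: nonlinear_part_def wpoly_part_iff simp del: replicate_Suc)
  have "Poly_Mapping.single 0 c \<in> nonlinear_part ?a 0" for c by (simp add: nonlinear_part_def)
  from ev_graded[OF graded_domain_nonlinear_part this \<sigma>' ab(1)]
  have a: "Poly_Mapping.lookup m 0 \<noteq> 1" if "m \<in> Poly_Mapping.keys (ev \<sigma> a)" for m
    using that by (simp add: nonlinear_part_def)
  have "ev \<sigma> b \<in> ?S (?l * d)"
    by (rule ev_graded[OF graded_domain_wpoly_part const_in_wpoly_part _ ab(2)])
       (use \<sigma> in \<open>simp del: replicate_Suc\<close>)
  \<comment> \<open>As the denominator is not in \<open>P\<close>, it has a monomial
    \<open>m\<close> free of \<open>x\<^sub>0\<close>; then \<open>w + m\<close> is linear in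
    \<open>x\<^sub>0\<close>.\<close>
  then have "ev z (ev \<sigma> b) \<noteq> 0" using P_iff ab(3) by blast
  then obtain m where m: "m \<in> Poly_Mapping.keys (ev \<sigma> b)"
    "Poly_Mapping.single 0 (Poly_Mapping.lookup (ev \<sigma> b) m) * mev z m \<noteq> 0"
    unfolding ev_def[of z] by (rule sum.not_neutral_contains_not_neutral)
  have m0: "Poly_Mapping.lookup m 0 = 0"
  proof (rule ccontr)
    assume "Poly_Mapping.lookup m 0 \<noteq> 0"
    then have "mev z m = 0" unfolding mev_def
      by (intro prod_zero bexI[of _ 0]) (auto simp: z_def in_keys_iff)
    then show False using m(2) by simp
  qed
  have "w + m \<in> Poly_Mapping.keys (Poly_Mapping.single w 1 * ev \<sigma> b)"
    using m(1) by (simp add: keys_monomial_mult)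
  then have "w + m \<in> (+) (Poly_Mapping.single 1 ?e) ` Poly_Mapping.keys (ev \<sigma> a)"
    unfolding eq keys_monomial_mult .
  then obtain m' where m': "m' \<in> Poly_Mapping.keys (ev \<sigma> a)" "w + m = Poly_Mapping.single 1 ?e + m'" by blast
  have "Poly_Mapping.lookup m' 0 = 1"
    using arg_cong[OF m'(2), of "\<lambda>m. Poly_Mapping.lookup m 0"] m0
    by (simp add: w_def lookup_add lookup_single)
  then show False using a[OF m'(1)] by blast
qed

text \<open>At each point some variable is nonzero, and its power of degree \<open>6 * p\<close> is
  a local generator, because every weight divides \<open>6 * p\<close>.\<close>

lemma line_bundle_weights:
  "line_bundle (weighted_proj_space (weights p) :: ('k npoly set, 'k npoly set \<Rightarrow> 'k npoly fract, 'k::field) kspace)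
     (weighted_twist (weights p) (6 * p))"
  unfolding weighted_proj_space_def weighted_twist_def
proof (rule wpoly.line_bundle_twisting_sheaf)
  fix P :: "'k npoly set" assume P: "P \<in> proj_points (wpoly_part (weights p))"
  obtain i where i: "i < length (weights p)" "pvar i \<notin> P" by (rule point_avoids_pvar[OF P])
  let ?q = "[6 * p, p, 3, 2] ! i"
  have "?q * weights p ! i = 6 * p" using less_4_cases[of i] i(1) by auto
  then have "pvar i ^ ?q \<in> wpoly_part (weights p) (6 * p)"
    using wpoly.gr_power[OF pvar_in[OF i(1) refl], of ?q] by metis
  moreover have "pvar i ^ ?q \<notin> P"
    using wpoly.point_power_iff[OF P pvar_in[OF i(1) refl]] i(2) by blast
  ultimately show "\<exists>y\<in>wpoly_part (weights p) (6 * p). y \<notin> P" by blast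
qed

lemma prime_mod_6:
  fixes p :: nat
  assumes "prime p" "p \<ge> 5"
  shows "p mod 6 = 1 \<or> p mod 6 = 5"
proof -
  have "\<not> 2 dvd p" "\<not> 3 dvd p"
    using assms primes_dvd_imp_eq[of 2 p] primes_dvd_imp_eq[of 3 p] by auto
  then show ?thesis by presburger
qed

theorem proposition1p7:
  fixes p l :: nat
    and X :: "('k npoly set, 'k npoly set \<Rightarrow> 'k npoly fract, 'k::field) kspace"
  assumes "prime p" and "p \<ge> 5"
    and "l = Lcm {2, 3, p}"
    and "X = weighted_proj_space [1, 6, 2 * p, 3 * p]"
  shows "l = 6 * p \<and>
    line_bundle X (weighted_twist [1, 6, 2 * p, 3 * p] l) \<and>
    (very_ample X (weighted_twist [1, 6, 2 * p, 3 * p] l) \<longleftrightarrow> p mod 3 = 1)"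
proof -
  have "\<not> 2 dvd p" "\<not> 3 dvd p" using prime_mod_6[OF assms(1,2)] by presburger+
  then have "coprime 3 p" "coprime 2 p" by (auto intro: prime_imp_coprime)
  moreover from this have "coprime 2 (3 * p)" by (simp add: primes_coprime)
  ultimately have l: "l = 6 * p" using assms(3) by (simp add: lcm_coprime)
  show ?thesis
  \<comment> \<open>Since \<open>p\<close> is odd, its residue modulo 3 decides between the residues
    1 and 5 modulo 6.\<close>
  proof (cases "p mod 6 = 1")
    case True
    then obtain q where "p = 6 * q + 1" by (metis mult_div_mod_eq)
    moreover have "p mod 3 = 1" using True by presburger
    ultimately show ?thesis
      using l assms(2,4) very_ample_weights[of p q] line_bundle_weights[of p] by simp
  next
    case False
    then have "p mod 6 = 5" using prime_mod_6[OF assms(1,2)] by simp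
    then obtain q where "p = 6 * q + 5" by (metis mult_div_mod_eq)
    moreover have "p mod 3 \<noteq> 1" using \<open>p mod 6 = 5\<close> by presburger
    ultimately show ?thesis
      using l assms(4) not_very_ample_weights[of p q] line_bundle_weights[of p] by simp
  qed
qed

end
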